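(* Let $E=K(n,m,\mathcal D)$ and $F=K(n,m,\mathcal D')$ be two Bedford-McMullen carpets of non-doubling type, and let $f:E\to F$ be a bi-Lipschitz bijection. Let $\varphi$ be a gauge function such that $\lim_{k\to\infty}k/\varphi(n^{-k})$ exists in $(0,+\infty]$. Then for every $z\in E$, $$\overline\delta_\varphi(z;\mu_E)=\overline\delta_\varphi(f(z);\mu_F),\qquad \underline\delta_\varphi(z;\mu_E)=\underline\delta_\varphi(f(z);\mu_F).$$ Consequently, $V_F=f(V_E)$ and $\dim_HV_E=\dim_HV_F$. In particular, $E$ satisfies the vertical separation condition (that is, $V_E=\emptyset$) if and only if $F$ does.
   Context: Let $n>m\ge 2$ be integers, $\sigma=\log m/\log n$, and let $\mathcal D\subset\{0,\dots,n-1\}\times\{0,\dots,m-1\}$ be nonempty. For $\mathbf d\in\mathcal D$ let $S_{\mathbf d}(z)=\mathrm{diag}(n^{-1},m^{-1})(z+\mathbf d)$ on $\mathbb R^2$, and $S_{\mathbf d_1\dots\mathbf d_k}=S_{\mathbf d_1}\circ\cdots\circ S_{\mathbf d_k}$. The Bedford-McMullen carpet $E=K(n,m,\mathcal D)$ is the unique nonempty compact set with $E=\bigcup_{\mathbf d\in\mathcal D}S_{\mathbf d}(E)$, a metric space with the Euclidean distance. Its uniform Bernoulli measure $\mu_E$ is the unique Borel probability measure supported on $E$ with $\mu_E=\frac1{\#\mathcal D}\sum_{\mathbf d\in\mathcal D}\mu_E\circ S_{\mathbf d}^{-1}$. The fiber sequence is $a_j=\#\{i:(i,j)\in\mathcal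 D\}$, $0\le j\le m-1$. The same notions are used for $F=K(n,m,\mathcal D')$. $B_r(x)$ denotes the open ball. A Borel probability measure $\mu$ is doubling if $\sup_{x\in\mathrm{supp}\,\mu,\ r>0}\mu(B_{2r}(x))/\mu(B_r(x))<\infty$. $E$ is of non-doubling type if $\mu_E$ is not doubling. (Known, due to Li-Wei-Wen: this holds if and only if $a_0a_{m-1}>0$, $a_0\ne a_{m-1}$, and $a_ja_{j+1}>0$ for some $0\le j\le m-2$.) A map $f:X\to Y$ of metric spaces is bi-Lipschitz if there is $C>0$ with $C^{-1}d_X(x,y)\le d_Y(f(x),f(y))\le C\,d_X(x,y)$ for all $x,y\in X$. A gauge function is a strictly decreasing $\varphi:(0,1)\to\mathbb R^+$ with $\lim_{r\to0}\varphi(r)=\infty$. For a measure $\mu$ on a metric space $X$ (here $X=E$ or $F$), $0<\rho<1$ and $z\in X$, the upper doubling index is $$\overline\delta_\varphi(z;\mu,\rho)=\limsup_{r\to0}\ \sup_{z'\in X:\ B_{\rho r}(z')\subset B_r(z)}\frac{\log[\mu(B_r(z))/\mu(B_{\rho r}(z'))]}{\varphi(r)},$$ and the lower doubling index $\underline\delta_\varphi(z;\mu,\rho)$ is obtained by replacing $\limsup$ by $\liminf$. For carpets of non-doubling type and gauge functions with $\lim_k k/\varphi(n^{-k})\in(0,+\infty]$, these values do not depend on $\rho\in(0,n^{-3})$; their common values are denoted $\overline\delta_\varphi(z;\mu_E)$ and $\underline\delta_\varphi(z;\mu_E)$. A coding of $z\in E$ is a sequence $(\mathbf d_j)_{j\ge1}\in\mathcal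 D^\infty$ with $\{z\}=\bigcap_{k\ge1}S_{\mathbf d_1\dots\mathbf d_k}([0,1]^2)$; writing $\mathbf d_j=(x_j,y_j)$, the coding is also written $(\mathbf x,\mathbf y)=((x_j)_j,(y_j)_j)$. $V_E$ is the set of $z\in E$ having two codings $(\mathbf x,\mathbf y)$, $(\mathbf x',\mathbf y')$ with $\mathbf y\ne\mathbf y'$. $\dim_H$ is Hausdorff dimension. *)

theory Defs
  imports "HOL-Probability.Probability"
begin

section \<open>Bedford-McMullen carpets\<close>

definition digit_map :: "nat \<Rightarrow> nat \<Rightarrow> nat \<times> nat \<Rightarrow> real \<times> real \<Rightarrow> real \<times> real" where
  "digit_map n m d z = ((fst z + real (fst d)) / real n, (snd z + real (snd d)) / real m)"

text \<open>By Hutchinson's theorem exactly one set, respectively one measure, satisfies each of the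
  following two predicates (for a nonempty finite digit set); they therefore stand for
  "\<open>E = K(n,m,D)\<close>" and "\<open>M\<close> is the uniform Bernoulli measure of \<open>E\<close>".\<close>

definition is_carpet :: "nat \<Rightarrow> nat \<Rightarrow> (nat \<times> nat) set \<Rightarrow> (real \<times> real) set \<Rightarrow> bool" where
  "is_carpet n m D E \<longleftrightarrow>
     compact E \<and> E \<noteq> {} \<and> E = (\<Union>d\<in>D. digit_map n m d ` E)"

definition is_uniform_bernoulli ::
    "nat \<Rightarrow> nat \<Rightarrow> (nat \<times> nat) set \<Rightarrow> (real \<times> real) set \<Rightarrow> (real \<times> real) measure \<Rightarrow> bool" where
  "is_uniform_bernoulli n m D E M \<longleftrightarrow>
     prob_space M \<and> sets M = sets borel \<and> measure M E = 1 \<and>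
     (\<forall>A\<in>sets borel. measure M A = (1 / real (card D)) * (\<Sum>d\<in>D. measure M (digit_map n m d -` A)))"


section \<open>Doubling measures and doubling indices\<close>

definition msupport :: "'a::topological_space measure \<Rightarrow> 'a set" where
  "msupport M = {x. \<forall>U. open U \<longrightarrow> x \<in> U \<longrightarrow> emeasure M U > 0}"

definition doubling_measure :: "'a::metric_space measure \<Rightarrow> bool" where
  "doubling_measure M \<longleftrightarrow>
     (SUP x\<in>msupport M. SUP r\<in>{0<..}. ereal (measure M (ball x (2 * r)) / measure M (ball x r))) < \<infinity>"

text \<open>Only the values of \<open>\<phi>\<close> on \<open>(0,1)\<close> are relevant.\<close>

definition gauge_function :: "(real \<Rightarrow> real) \<Rightarrow> bool" where
  "gauge_function \<phi> \<longleftrightarrow>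
     (\<forall>r\<in>{0<..<1}. \<phi> r > 0) \<and> strict_antimono_on {0<..<1} \<phi> \<and> filterlim \<phi> at_top (at_right 0)"

text \<open>Open ball of the metric subspace \<open>X\<close>.\<close>

definition ball_in :: "'a::metric_space set \<Rightarrow> 'a \<Rightarrow> real \<Rightarrow> 'a set" where
  "ball_in X z r = ball z r \<inter> X"

definition doubling_ratio ::
    "(real \<Rightarrow> real) \<Rightarrow> 'a::metric_space set \<Rightarrow> 'a measure \<Rightarrow> real \<Rightarrow> 'a \<Rightarrow> real \<Rightarrow> ereal" where
  "doubling_ratio \<phi> X M \<rho> z r =
     (SUP z'\<in>{z'\<in>X. ball_in X z' (\<rho> * r) \<subseteq> ball_in X z r}.
        ereal (ln (measure M (ball_in X z r) / measure M (ball_in X z' (\<rho> * r))) / \<phi> r))"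

definition upper_doubling_index_at ::
    "(real \<Rightarrow> real) \<Rightarrow> 'a::metric_space set \<Rightarrow> 'a measure \<Rightarrow> real \<Rightarrow> 'a \<Rightarrow> ereal" where
  "upper_doubling_index_at \<phi> X M \<rho> z = Limsup (at_right 0) (doubling_ratio \<phi> X M \<rho> z)"

definition lower_doubling_index_at ::
    "(real \<Rightarrow> real) \<Rightarrow> 'a::metric_space set \<Rightarrow> 'a measure \<Rightarrow> real \<Rightarrow> 'a \<Rightarrow> ereal" where
  "lower_doubling_index_at \<phi> X M \<rho> z = Liminf (at_right 0) (doubling_ratio \<phi> X M \<rho> z)"

text \<open>\<open>L\<close> is the common value, over all \<open>\<rho> \<in> (0, n\<^sup>-\<^sup>3)\<close>, of the upper (lower) doubling index
  at \<open>z\<close>.\<close>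

definition has_upper_doubling_index ::
    "nat \<Rightarrow> (real \<Rightarrow> real) \<Rightarrow> 'a::metric_space set \<Rightarrow> 'a measure \<Rightarrow> 'a \<Rightarrow> ereal \<Rightarrow> bool" where
  "has_upper_doubling_index n \<phi> X M z L \<longleftrightarrow>
     (\<forall>\<rho>\<in>{0<..<1 / real n ^ 3}. upper_doubling_index_at \<phi> X M \<rho> z = L)"

definition has_lower_doubling_index ::
    "nat \<Rightarrow> (real \<Rightarrow> real) \<Rightarrow> 'a::metric_space set \<Rightarrow> 'a measure \<Rightarrow> 'a \<Rightarrow> ereal \<Rightarrow> bool" where
  "has_lower_doubling_index n \<phi> X M z L \<longleftrightarrow>
     (\<forall>\<rho>\<in>{0<..<1 / real n ^ 3}. lower_doubling_index_at \<phi> X M \<rho> z = L)"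


section \<open>Bi-Lipschitz maps\<close>

definition bi_lipschitz_on :: "'a::metric_space set \<Rightarrow> ('a \<Rightarrow> 'b::metric_space) \<Rightarrow> bool" where
  "bi_lipschitz_on X f \<longleftrightarrow>
     (\<exists>C>0. \<forall>x\<in>X. \<forall>y\<in>X. dist x y / C \<le> dist (f x) (f y) \<and> dist (f x) (f y) \<le> C * dist x y)"


section \<open>Codings and vertical separation\<close>

text \<open>Digit sequences are indexed from \<open>0\<close>, so the digits \<open>d\<^sub>1, \<dots>, d\<^sub>k\<close> of the
  literature are \<open>w 0, \<dots>, w (k - 1)\<close>.\<close>

primrec word_map :: "nat \<Rightarrow> nat \<Rightarrow> (nat \<Rightarrow> nat \<times> nat) \<Rightarrow> nat \<Rightarrow> real \<times> real \<Rightarrow> real \<times> real" where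
  "word_map n m w 0 = id"
| "word_map n m w (Suc k) = word_map n m w k \<circ> digit_map n m (w k)"

definition is_coding ::
    "nat \<Rightarrow> nat \<Rightarrow> (nat \<times> nat) set \<Rightarrow> (nat \<Rightarrow> nat \<times> nat) \<Rightarrow> real \<times> real \<Rightarrow> bool" where
  "is_coding n m D w z \<longleftrightarrow>
     (\<forall>j. w j \<in> D) \<and> {z} = (\<Inter>k\<in>{1..}. word_map n m w k ` ({0..1} \<times> {0..1}))"

definition vertical_set ::
    "nat \<Rightarrow> nat \<Rightarrow> (nat \<times> nat) set \<Rightarrow> (real \<times> real) set \<Rightarrow> (real \<times> real) set" where
  "vertical_set n m D E =
     {z\<in>E. \<exists>w w'. is_coding n m D w z \<and> is_coding n m D w' z \<and> snd \<circ> w \<noteq> snd \<circ> w'}"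

definition vertical_separation ::
    "nat \<Rightarrow> nat \<Rightarrow> (nat \<times> nat) set \<Rightarrow> (real \<times> real) set \<Rightarrow> bool" where
  "vertical_separation n m D E \<longleftrightarrow> vertical_set n m D E = {}"


section \<open>Hausdorff dimension\<close>

text \<open>The covering sets are required to be bounded because \<open>diameter\<close> has no meaningful value on
  unbounded sets.\<close>

definition hausdorff_premeasure :: "real \<Rightarrow> real \<Rightarrow> 'a::metric_space set \<Rightarrow> ennreal" where
  "hausdorff_premeasure s \<delta> A =
     (INF U\<in>{U :: nat \<Rightarrow> 'a set. A \<subseteq> (\<Union>i. U i) \<and> (\<forall>i. bounded (U i) \<and> diameter (U i) \<le> \<delta>)}.
        \<Sum>i. ennreal (diameter (U i) powr s))"

definition hausdorff_measure :: "real \<Rightarrow> 'a::metric_space set \<Rightarrow> ennreal" where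
  "hausdorff_measure s A = (SUP \<delta>\<in>{0<..}. hausdorff_premeasure s \<delta> A)"

text \<open>Exponents \<open>s > 0\<close> suffice for the infimum, which avoids the convention for \<open>0 powr 0\<close>.
  The empty set gets dimension \<open>0\<close>.\<close>

definition hausdorff_dim :: "'a::metric_space set \<Rightarrow> ereal" where
  "hausdorff_dim A = Inf {ereal s |s. 0 < s \<and> hausdorff_measure s A = 0}"

end

theory Submission
  imports Defs
begin

text \<open>The Bernoulli measure of a ball is, up to constants, the proportion of approximate squares of a
  small side length that meet it. A bi-Lipschitz map distorts numbers of approximate squares by a
  bounded factor, so \<open>\<mu>\<^sub>E\<close> and \<open>\<mu>\<^sub>F \<circ> f\<close> are comparable on balls.

  If the top and bottom rows are nonempty, then every approximate square contains a smaller ball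
  that meets the carpet only in the same row; the bound \<open>\<rho> < n\<^sup>-\<^sup>3\<close> leaves room for it. Hence the
  doubling ratio of \<open>F\<close> at \<open>f z\<close>, scale \<open>r\<close> and any ratio \<open>\<rho>'\<close> is at most a constant times the
  doubling ratio of \<open>E\<close> at \<open>z\<close>, scale \<open>A r\<close> and ratio \<open>\<rho>\<close>, with a constant \<open>A \<ge> 1\<close>. After
  taking logarithms and dividing, where \<open>\<phi> r \<ge> \<phi> (A r)\<close>, the inequality survives up to \<open>o(1)\<close>; exchanging \<open>E\<close> and \<open>F\<close> gives equality of all indices and their independence of \<open>\<rho>\<close>.

  At a point of \<open>V\<^sub>E\<close> the rows \<open>c (m - 1) (m - 1) \<dots>\<close> and \<open>(c + 1) 0 0 \<dots>\<close> meet, and since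
  \<open>a\<^sub>0 \<noteq> a\<^sub>m\<^sub>-\<^sub>1\<close> their measures differ by an exponential factor, so the doubling ratios tend to
  infinity. Around any other point there are arbitrarily small balls meeting a single row, where
  the ratios are bounded. This separates \<open>V\<^sub>E\<close> from its complement in a bi-Lipschitz invariant way.\<close>

section \<open>Digit expansions and scales\<close>

text \<open>Counting cells can replace the measure because all words of \<open>j\<close> letters
  have the same number of continuations to cells of scale \<open>q\<close>, provided that
  \<open>j \<le> level q\<close>. The count returns the share \<open>1 / card D ^ j\<close> of such
  a word, whatever \<open>q\<close> is. Applied to the whole carpets, the same count makes the total
  numbers of cells of \<open>E\<close> and \<open>F\<close> comparable. The obstacle is that a
  bi-Lipschitz map need not respect rows, whereas the mass of a ball depends on the rows that it
  meets. Hence a small ball of \<open>F\<close> is not matched with its preimage. The supremum in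
  the doubling ratio only asks for some ball of \<open>E\<close> of the prescribed ratio whose mass
  is at most comparable. The centre of the row through the preimage point provides one, since all
  nonempty approximate squares of one row have the same weight. The price is an enlargement of the
  radius by a factor that is the same at all scales.\<close>

primrec digit_number :: "nat \<Rightarrow> (nat \<Rightarrow> nat) \<Rightarrow> nat \<Rightarrow> nat" where
  "digit_number b y 0 = 0"
| "digit_number b y (Suc k) = b * digit_number b y k + y k"

lemma digit_number_cong:
  assumes "\<And>i. i < k \<Longrightarrow> y i = y' i"
  shows "digit_number b y k = digit_number b y' k"
  using assms by (induction k) auto

lemma digit_number_inj:
  assumes "digit_number b y k = digit_number b y' k"
    and "\<And>i. i < k \<Longrightarrow> y i < b" and "\<And>i. i < k \<Longrightarrow> y' i < b" and "i < k"
  shows "y i = y' i"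
  using assms
proof (induction k)
  case (Suc k)
  have *: "b * digit_number b y k + y k = b * digit_number b y' k + y' k"
    using Suc.prems(1) by simp
  have l: "y k < b" "y' k < b"
    using Suc.prems(2,3) by auto
  have "y k = y' k"
    using arg_cong[OF *, of "\<lambda>t. t mod b"] l by simp
  moreover have "digit_number b y k = digit_number b y' k"
    using arg_cong[OF *, of "\<lambda>t. t div b"] l by simp
  ultimately show ?case
    using Suc by (cases "i = k") auto
qed simp

text \<open>Equality holds for a tail of zeros, and in the companion upper bound for a tail of
  digits \<open>b - 1\<close>. These are the tails of points on row boundaries.\<close>

lemma digit_number_prefix_le: "b ^ j * digit_number b y k \<le> digit_number b y (k + j)"
proof (induction j)
  case (Suc j)
  have "b * (b ^ j * digit_number b y k) \<le> b * digit_number b y (k + j)"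
    using Suc by (rule mult_le_mono2)
  then show ?case
    by (simp only: digit_number.simps add_Suc_right power_Suc mult.assoc trans_le_add1)
qed simp

lemma digit_number_prefix_ge:
  assumes "\<And>i. i < k + j \<Longrightarrow> y i < b"
  shows "digit_number b y (k + j) + 1 \<le> b ^ j * (digit_number b y k + 1)"
  using assms
proof (induction j)
  case (Suc j)
  have "digit_number b y (k + Suc j) + 1 \<le> b * (digit_number b y (k + j) + 1)"
    using Suc.prems[of "k + j"] by simp
  also have "\<dots> \<le> b * (b ^ j * (digit_number b y k + 1))"
    using Suc by (intro mult_le_mono2) simp
  finally show ?case
    by (simp add: algebra_simps)
qed simp

text \<open>The level \<open>k\<close> at which columns of width \<open>n\<^sup>-\<^sup>k\<close> match rows of height \<open>m\<^sup>-\<^sup>q\<close>.\<close>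

definition column_level :: "nat \<Rightarrow> nat \<Rightarrow> nat \<Rightarrow> nat" where
  "column_level n m q = (GREATEST k. n ^ k \<le> m ^ q)"

context
  fixes n m :: nat
  assumes m_ge_2: "2 \<le> m" and m_less_n: "m < n"
begin

lemma column_level_bounds: "n ^ column_level n m q \<le> m ^ q \<and> m ^ q < n ^ Suc (column_level n m q)"
proof -
  have n2: "2 \<le> n"
    using m_ge_2 m_less_n by simp
  have bd: "k \<le> m ^ q" if "n ^ k \<le> m ^ q" for k
  proof -
    have "k < n ^ k"
      using n2 by (intro power_gt_expt) simp
    then show ?thesis
      using that by linarith
  qed
  have "n ^ 0 \<le> m ^ q"
    using m_ge_2 by simp
  then have "n ^ column_level n m q \<le> m ^ q"
    unfolding column_level_def by (rule GreatestI_nat) (use bd in auto)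
  moreover have "m ^ q < n ^ Suc (column_level n m q)"
  proof (rule ccontr)
    assume "\<not> ?thesis"
    then have "Suc (column_level n m q) \<le> column_level n m q"
      unfolding column_level_def by (intro Greatest_le_nat[where b = "m ^ q"]) (use bd in auto)
    then show False by simp
  qed
  ultimately show ?thesis by simp
qed

lemma column_level_ge:
  assumes "n ^ k \<le> m ^ q"
  shows "k \<le> column_level n m q"
proof -
  have "n ^ k < n ^ Suc (column_level n m q)"
    using assms column_level_bounds[of q] by linarith
  then show ?thesis
    using power_less_imp_less_exp[of n k "Suc (column_level n m q)"] m_ge_2 m_less_n by simp
qed

lemma column_level_less:
  assumes "m ^ q < n ^ k"
  shows "column_level n m q < k"
proof -
  have "n ^ column_level n m q < n ^ k"
    using assms column_level_bounds[of q] by linarith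
  then show ?thesis
    using power_less_imp_less_exp[of n "column_level n m q" k] m_ge_2 m_less_n by simp
qed

lemma column_level_le: "column_level n m q \<le> q"
proof -
  have "m ^ q \<le> n ^ q"
    using m_less_n by (simp add: power_mono)
  also have "\<dots> < n ^ Suc q"
    using m_ge_2 m_less_n by simp
  finally show ?thesis
    using column_level_less[of q "Suc q"] by simp
qed

lemma column_level_mono: "q \<le> q' \<Longrightarrow> column_level n m q \<le> column_level n m q'"
  using column_level_bounds[of q] m_ge_2
  by (intro column_level_ge) (meson le_trans one_le_numeral power_increasing)

text \<open>Since \<open>m < n\<close>, each further row digit raises the column level by at most
  one. This bounds the loss when a rectangle is refined by a fixed number of levels.\<close>

lemma column_level_add_le: "column_level n m (q + c) \<le> column_level n m q + c"
proof -
  have "m ^ (q + c) = m ^ q * m ^ c"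
    by (rule power_add)
  also have "\<dots> < n ^ Suc (column_level n m q) * n ^ c"
    using column_level_bounds[of q] m_less_n m_ge_2
    by (intro mult_less_le_imp_less power_mono) auto
  also have "\<dots> = n ^ Suc (column_level n m q + c)"
    by (simp add: power_add)
  finally show ?thesis
    using column_level_less[of "q + c" "Suc (column_level n m q + c)"] by simp
qed

lemma column_level_at_top: "filterlim (column_level n m) at_top sequentially"
  unfolding filterlim_at_top
proof
  fix k
  have "k \<le> column_level n m q" if "n ^ k \<le> q" for q
  proof (rule column_level_ge)
    have "q < m ^ q"
      using m_ge_2 by (intro power_gt_expt) simp
    then show "n ^ k \<le> m ^ q"
      using that by simp
  qed
  then show "\<forall>\<^sub>F q in sequentially. k \<le> column_level n m q"
    by (intro eventually_sequentiallyI[of "n ^ k"])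
qed

text \<open>The level is at most \<open>s * q\<close>, where \<open>s = ln m / ln n < 1\<close>. The
  gap is the number of positions at which a rectangle prescribes only the row digit; its growth
  turns different end fibres into an exponential factor.\<close>

lemma column_level_gap_at_top: "filterlim (\<lambda>q. q - column_level n m q) at_top sequentially"
proof -
  define s where "s = ln (real m) / ln (real n)"
  have s: "s < 1"
    using m_ge_2 m_less_n by (simp add: s_def divide_simps)
  have le: "real (column_level n m q) \<le> s * real q" for q
  proof -
    have "real n ^ column_level n m q \<le> real m ^ q"
      using column_level_bounds[of q] by (metis of_nat_le_iff of_nat_power)
    then have "ln (real n ^ column_level n m q) \<le> ln (real m ^ q)"
      using m_ge_2 m_less_n by (subst ln_le_cancel_iff) auto
    then show ?thesis
      using m_ge_2 m_less_n by (simp add: ln_realpow s_def divide_simps mult.commute)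
  qed
  have "filterlim (\<lambda>q. (1 - s) * real q) at_top sequentially"
    using s by (intro filterlim_tendsto_pos_mult_at_top[OF tendsto_const] filterlim_real_sequentially) auto
  then have "filterlim (\<lambda>q. real (q - column_level n m q)) at_top sequentially"
    by (rule filterlim_at_top_mono)
      (use le column_level_le in \<open>auto simp: of_nat_diff algebra_simps\<close>)
  then show ?thesis
    by (subst (asm) filterlim_sequentially_iff_filterlim_real[symmetric])
qed

text \<open>This is the sense in which \<open>level q\<close> column digits together with
  \<open>q\<close> row digits describe an approximate square.\<close>

lemma column_width_bounds:
  "1 / real m ^ q \<le> 1 / real n ^ column_level n m q"
  "1 / real n ^ column_level n m q \<le> real n / real m ^ q"
proof -
  have *: "real n ^ column_level n m q \<le> real m ^ q" "real m ^ q \<le> real n * real n ^ column_level n m q"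
    using column_level_bounds[of q]
    by (metis of_nat_le_iff of_nat_power, metis less_imp_le of_nat_le_iff of_nat_power power_Suc of_nat_mult)
  show "1 / real m ^ q \<le> 1 / real n ^ column_level n m q"
    using * m_ge_2 m_less_n by (intro divide_left_mono) auto
  show "1 / real n ^ column_level n m q \<le> real n / real m ^ q"
    using * m_ge_2 m_less_n by (simp add: field_simps)
qed

end

section \<open>Scales adapted to a given length\<close>

lemma power_scale_below:
  fixes t :: real
  assumes "2 \<le> b" and "0 < t" and "t \<le> 1"
  obtains q where "1 / real b ^ q \<le> t" and "t < real b / real b ^ q"
proof -
  obtain q0 where "(1 / real b) ^ q0 < t"
    using real_arch_pow_inv[of t "1 / real b"] assms by auto
  then have ex: "1 / real b ^ q0 \<le> t"
    by (simp add: power_one_over)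
  define q where "q = (LEAST q. 1 / real b ^ q \<le> t)"
  have 1: "1 / real b ^ q \<le> t"
    unfolding q_def by (rule LeastI) (rule ex)
  have 2: "t < real b / real b ^ q"
  proof (cases q)
    case 0
    then show ?thesis using assms by simp
  next
    case (Suc p)
    then have "\<not> 1 / real b ^ p \<le> t"
      using not_less_Least[of p "\<lambda>q. 1 / real b ^ q \<le> t"] by (simp add: q_def)
    then show ?thesis
      using Suc assms by simp
  qed
  show ?thesis
    using that 1 2 by blast
qed

lemma power_scale_above:
  fixes t :: real
  assumes "2 \<le> b" and "0 < t" and "t \<le> 1"
  obtains q where "t \<le> 1 / real b ^ q" and "1 / real b ^ q \<le> real b * t"
proof -
  obtain q where q: "1 / real b ^ q \<le> t" "t < real b / real b ^ q"
    using power_scale_below[OF assms] by blast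
  show ?thesis
  proof (cases q)
    case 0
    have "1 * 1 \<le> real b * t"
      using q(1) 0 assms(1) by (intro mult_mono) auto
    then show ?thesis
      using that[of 0] assms by simp
  next
    case (Suc p)
    then show ?thesis
      using that[of p] q assms by (simp add: field_simps)
  qed
qed

lemma dist_prod_le:
  fixes z z' :: "real \<times> real"
  shows "dist z z' \<le> \<bar>fst z - fst z'\<bar> + \<bar>snd z - snd z'\<bar>"
  by (simp add: dist_prod_def dist_real_def sqrt_sum_squares_le_sum_abs)

lemma fst_diff_le_dist:
  fixes z z' :: "real \<times> real"
  shows "\<bar>fst z - fst z'\<bar> \<le> dist z z'"
  using dist_fst_le[of z z'] by (simp add: dist_real_def)

lemma snd_diff_le_dist:
  fixes z z' :: "real \<times> real"
  shows "\<bar>snd z - snd z'\<bar> \<le> dist z z'"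
  using dist_snd_le[of z z'] by (simp add: dist_real_def)

section \<open>Cylinders of a carpet\<close>

abbreviation column_index :: "nat \<Rightarrow> (nat \<Rightarrow> nat \<times> nat) \<Rightarrow> nat \<Rightarrow> nat" where
  "column_index n w k \<equiv> digit_number n (\<lambda>i. fst (w i)) k"

abbreviation row_index :: "nat \<Rightarrow> (nat \<Rightarrow> nat \<times> nat) \<Rightarrow> nat \<Rightarrow> nat" where
  "row_index m w k \<equiv> digit_number m (\<lambda>i. snd (w i)) k"

lemma word_map_eq:
  assumes "0 < n" and "0 < m"
  shows "word_map n m w k z =
    ((fst z + real (column_index n w k)) / real n ^ k, (snd z + real (row_index m w k)) / real m ^ k)"
  using assms
  by (induction k arbitrary: z) (auto simp: digit_map_def field_simps)

lemma word_map_cong: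
  assumes "\<And>i. i < k \<Longrightarrow> w i = w' i"
  shows "word_map n m w k = word_map n m w' k"
  using assms by (induction k) auto

lemma word_map_add: "word_map n m w (k + j) = word_map n m w k \<circ> word_map n m (\<lambda>i. w (k + i)) j"
  by (induction j) (auto simp: comp_assoc)

lemma continuous_on_digit_map: "continuous_on A (digit_map n m d)"
  unfolding digit_map_def divide_inverse by (intro continuous_intros)

lemma continuous_on_word_map: "continuous_on A (word_map n m w k)"
proof (induction k arbitrary: A)
  case (Suc k)
  show ?case
    using continuous_on_compose[OF continuous_on_digit_map Suc] by (simp only: word_map.simps)
qed (simp add: continuous_on_id)

locale carpet =
  fixes n m :: nat and D :: "(nat \<times> nat) set" and E :: "(real \<times> real) set"
    and M :: "(real \<times> real) measure"
  assumes m_ge_2: "2 \<le> m" and m_less_n: "m < n"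
    and D_nonempty: "D \<noteq> {}" and D_subset: "D \<subseteq> {0..<n} \<times> {0..<m}"
    and is_carpet: "is_carpet n m D E" and is_bernoulli: "is_uniform_bernoulli n m D E M"
begin

lemma n_ge_3: "3 \<le> n"
  using m_ge_2 m_less_n by simp

lemma pos [simp]: "0 < n" "0 < m" "n \<noteq> 0" "m \<noteq> 0"
  using m_ge_2 m_less_n by auto

lemma finite_D [simp]: "finite D"
  using D_subset by (rule finite_subset) simp

lemma card_D_pos [simp]: "0 < card D"
  using D_nonempty by (simp add: card_gt_0_iff)

lemma digit_less: "d \<in> D \<Longrightarrow> fst d < n" "d \<in> D \<Longrightarrow> snd d < m"
  using D_subset by auto

lemma E_compact: "compact E" and E_nonempty: "E \<noteq> {}" and E_eq: "E = (\<Union>d\<in>D. digit_map n m d ` E)"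
  using is_carpet by (auto simp: is_carpet_def)

lemma E_closed: "closed E"
  using E_compact by (rule compact_imp_closed)

lemma E_borel [measurable]: "E \<in> sets borel"
  using E_closed by (rule borel_closed)

text \<open>An extreme value of a coordinate is attained on the compact set \<open>E\<close>.
  Writing that point as the image of another point of \<open>E\<close> under a digit map gives an
  inequality which expansion by \<open>n\<close> or \<open>m\<close> allows only for values on the
  correct side of 0 or 1.\<close>

lemma E_unit:
  assumes "z \<in> E"
  shows "0 \<le> fst z" "fst z \<le> 1" "0 \<le> snd z" "snd z \<le> 1"
proof -
  have step: "\<exists>d\<in>D. \<exists>p\<in>E. z = ((fst p + real (fst d)) / real n, (snd p + real (snd d)) / real m)"
    if "z \<in> E" for z
    using that by (subst (asm) E_eq) (auto simp: digit_map_def)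
  have digit: "real (fst d) \<le> real n - 1" "real (snd d) \<le> real m - 1" if "d \<in> D" for d
    using digit_less[OF that] by auto
  have nm: "1 < real n" "1 < real m"
    using m_ge_2 m_less_n by auto
  have c1: "continuous_on E (fst :: real \<times> real \<Rightarrow> real)"
    and c2: "continuous_on E (snd :: real \<times> real \<Rightarrow> real)"
    by (auto intro: continuous_intros)
  have contract: "0 \<le> a" if "a * b \<ge> a + e" "0 \<le> e" "1 < b" for a b e :: real
  proof (rule ccontr)
    assume "\<not> 0 \<le> a"
    then have "a * b < a * 1"
      using that by (intro mult_strict_left_mono_neg) auto
    then show False
      using that by simp
  qed
  obtain p where p: "p \<in> E" "\<And>z. z \<in> E \<Longrightarrow> fst z \<le> fst p"
    using continuous_attains_sup[OF E_compact E_nonempty c1] by auto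
  obtain d q where "d \<in> D" "q \<in> E" "fst p = (fst q + real (fst d)) / real n"
    using step[OF p(1)] by auto
  then have "(1 - fst p) * real n \<ge> (1 - fst p) + 0"
    using p(2)[of q] digit(1)[of d] by (simp add: field_simps)
  then have "0 \<le> 1 - fst p"
    using contract nm(1) by blast
  then show "fst z \<le> 1"
    using p(2)[OF assms] by simp
  obtain p where p: "p \<in> E" "\<And>z. z \<in> E \<Longrightarrow> snd z \<le> snd p"
    using continuous_attains_sup[OF E_compact E_nonempty c2] by auto
  obtain d q where "d \<in> D" "q \<in> E" "snd p = (snd q + real (snd d)) / real m"
    using step[OF p(1)] by auto
  then have "(1 - snd p) * real m \<ge> (1 - snd p) + 0"
    using p(2)[of q] digit(2)[of d] by (simp add: field_simps)
  then have "0 \<le> 1 - snd p"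
    using contract nm(2) by blast
  then show "snd z \<le> 1"
    using p(2)[OF assms] by simp
  obtain p where p: "p \<in> E" "\<And>z. z \<in> E \<Longrightarrow> fst p \<le> fst z"
    using continuous_attains_inf[OF E_compact E_nonempty c1] by auto
  obtain d q where "d \<in> D" "q \<in> E" "fst p = (fst q + real (fst d)) / real n"
    using step[OF p(1)] by auto
  then have "fst p * real n \<ge> fst p + real (fst d)"
    using p(2)[of q] by (simp add: field_simps)
  then have "0 \<le> fst p"
    using contract[of "fst p" "real (fst d)" "real n"] nm(1) by simp
  then show "0 \<le> fst z"
    using p(2)[OF assms] by simp
  obtain p where p: "p \<in> E" "\<And>z. z \<in> E \<Longrightarrow> snd p \<le> snd z"
    using continuous_attains_inf[OF E_compact E_nonempty c2] by auto
  obtain d q where "d \<in> D" "q \<in> E" "snd p = (snd q + real (snd d)) / real m"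
    using step[OF p(1)] by auto
  then have "snd p * real m \<ge> snd p + real (snd d)"
    using p(2)[of q] by (simp add: field_simps)
  then have "0 \<le> snd p"
    using contract[of "snd p" "real (snd d)" "real m"] nm(2) by simp
  then show "0 \<le> snd z"
    using p(2)[OF assms] by simp
qed

text \<open>Extensional functions make this set finite and its subsets countable by product
  formulas; maps and cylinders read only the first \<open>q\<close> letters anyway.\<close>

definition words :: "nat \<Rightarrow> (nat \<Rightarrow> nat \<times> nat) set" where
  "words q = PiE {..<q} (\<lambda>_. D)"

lemma finite_words [simp]: "finite (words q)"
  by (simp add: words_def finite_PiE)

lemma words_in_D: "v \<in> words q \<Longrightarrow> i < q \<Longrightarrow> v i \<in> D"
  by (auto simp: words_def)

definition cylinder :: "(nat \<Rightarrow> nat \<times> nat) \<Rightarrow> nat \<Rightarrow> (real \<times> real) set" where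
  "cylinder w q = word_map n m w q ` E"

lemma cylinder_cong: "(\<And>i. i < q \<Longrightarrow> w i = w' i) \<Longrightarrow> cylinder w q = cylinder w' q"
  unfolding cylinder_def using word_map_cong by metis

lemma cylinder_Suc_subset:
  assumes "w q \<in> D"
  shows "cylinder w (Suc q) \<subseteq> cylinder w q"
proof -
  have "digit_map n m (w q) ` E \<subseteq> E"
    using assms by (subst (2) E_eq) auto
  then show ?thesis
    unfolding cylinder_def by auto
qed

lemma cylinder_antimono:
  assumes "k \<le> q" and "\<And>i. i < q \<Longrightarrow> w i \<in> D"
  shows "cylinder w q \<subseteq> cylinder w k"
  using assms
proof (induction q rule: dec_induct)
  case (step q)
  then show ?case
    using cylinder_Suc_subset[of w q] by auto
qed simp

lemma cylinder_subset_E: "(\<And>i. i < q \<Longrightarrow> w i \<in> D) \<Longrightarrow> cylinder w q \<subseteq> E"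
  using cylinder_antimono[of 0 q w] by (simp add: cylinder_def)

lemma cylinder_closed: "closed (cylinder w q)"
  unfolding cylinder_def
  by (intro compact_imp_closed compact_continuous_image continuous_on_word_map E_compact)

lemma cylinder_nonempty: "cylinder w q \<noteq> {}"
  using E_nonempty by (simp add: cylinder_def)

lemma cylinder_bounds:
  assumes "z \<in> cylinder w q"
  shows "real (column_index n w q) / real n ^ q \<le> fst z"
    "fst z \<le> (real (column_index n w q) + 1) / real n ^ q"
    "real (row_index m w q) / real m ^ q \<le> snd z"
    "snd z \<le> (real (row_index m w q) + 1) / real m ^ q"
proof -
  obtain p where p: "p \<in> E" "z = word_map n m w q p"
    using assms by (auto simp: cylinder_def)
  note u = E_unit[OF p(1)]
  show "real (column_index n w q) / real n ^ q \<le> fst z"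
    "fst z \<le> (real (column_index n w q) + 1) / real n ^ q"
    "real (row_index m w q) / real m ^ q \<le> snd z"
    "snd z \<le> (real (row_index m w q) + 1) / real m ^ q"
    using u unfolding p(2) by (auto simp: word_map_eq intro!: divide_right_mono)
qed

text \<open>Columns are compared at level \<open>k\<close> and rows at level \<open>q\<close>, so
  different words may describe the same rectangle. For \<open>k = level q\<close> this bounds the
  diameter of an approximate square.\<close>

lemma dist_le_rectangle:
  assumes "z \<in> cylinder w k" "z \<in> cylinder w q" "z' \<in> cylinder w' k" "z' \<in> cylinder w' q"
    and "column_index n w k = column_index n w' k" and "row_index m w q = row_index m w' q"
  shows "dist z z' \<le> 1 / real n ^ k + 1 / real m ^ q"
proof -
  have "\<bar>fst z - fst z'\<bar> \<le> 1 / real n ^ k"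
    using cylinder_bounds(1,2)[OF assms(1)] cylinder_bounds(1,2)[OF assms(3)] assms(5)
    by (simp add: add_divide_distrib abs_le_iff)
  moreover have "\<bar>snd z - snd z'\<bar> \<le> 1 / real m ^ q"
    using cylinder_bounds(3,4)[OF assms(2)] cylinder_bounds(3,4)[OF assms(4)] assms(6)
    by (simp add: add_divide_distrib abs_le_iff)
  ultimately show ?thesis
    using dist_prod_le[of z z'] by linarith
qed

lemma dist_le_cylinder:
  assumes "z \<in> cylinder w q" and "z' \<in> cylinder w q"
  shows "dist z z' \<le> 2 / real m ^ q"
proof -
  have "1 / real n ^ q \<le> 1 / real m ^ q"
    using m_less_n by (intro divide_left_mono power_mono) auto
  then show ?thesis
    using dist_le_rectangle[OF assms(1,1,2,2)] by simp
qed

section \<open>Codings\<close>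

text \<open>The working form of a coding, with images of \<open>E\<close> in place of images of the
  unit square, so that self-similarity can prolong it. Its equivalence with \<open>is_coding\<close>
  is proved below.\<close>

definition codes :: "(nat \<Rightarrow> nat \<times> nat) \<Rightarrow> real \<times> real \<Rightarrow> bool" where
  "codes w z \<longleftrightarrow> (\<forall>i. w i \<in> D) \<and> (\<forall>k. z \<in> cylinder w k)"

lemma ex_codes:
  assumes "z \<in> E"
  shows "\<exists>w. codes w z"
proof -
  have "\<forall>z\<in>E. \<exists>d p. d \<in> D \<and> p \<in> E \<and> z = digit_map n m d p"
    using E_eq by blast
  then obtain dg nx where dg: "\<And>z. z \<in> E \<Longrightarrow> dg z \<in> D" and nx: "\<And>z. z \<in> E \<Longrightarrow> nx z \<in> E"
    and dn: "\<And>z. z \<in> E \<Longrightarrow> digit_map n m (dg z) (nx z) = z"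
    by metis
  define w where "w i = dg ((nx ^^ i) z)" for i
  have inE: "(nx ^^ i) z \<in> E" for i
    using assms nx by (induction i) auto
  have "word_map n m w k ((nx ^^ k) z) = z" for k
    using dn[OF inE] by (induction k) (simp_all add: w_def)
  then have "z \<in> cylinder w k" for k
    unfolding cylinder_def using inE by (metis imageI)
  then have "codes w z"
    unfolding codes_def using inE dg by (auto simp: w_def)
  then show ?thesis by blast
qed

lemma restrict_in_words: "(\<And>i. i < q \<Longrightarrow> w i \<in> D) \<Longrightarrow> restrict w {..<q} \<in> words q"
  by (auto simp: words_def)

lemma cylinder_restrict [simp]: "cylinder (restrict w {..<q}) q = cylinder w q"
  by (rule cylinder_cong) simp

lemma codes_imp_E: "codes w z \<Longrightarrow> z \<in> E"
  unfolding codes_def using cylinder_subset_E[of 0 w] by blast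

text \<open>The word is continued by a coding of the preimage of \<open>z\<close> in
  \<open>E\<close>. In this way a cylinder in a different row yields a second row sequence for
  \<open>z\<close>.\<close>

lemma ex_codes_prepend:
  assumes "z \<in> cylinder v q" and "\<And>i. i < q \<Longrightarrow> v i \<in> D"
  shows "\<exists>w. codes w z \<and> (\<forall>i<q. w i = v i)"
proof -
  obtain p where p: "p \<in> E" "z = word_map n m v q p"
    using assms(1) by (auto simp: cylinder_def)
  obtain u where u: "codes u p"
    using ex_codes[OF p(1)] ..
  define w where "w i = (if i < q then v i else u (i - q))" for i
  have wD: "w i \<in> D" for i
    using assms(2) u by (auto simp: w_def codes_def)
  have zq: "z \<in> cylinder w (q + j)" for j
  proof -
    obtain p' where p': "p' \<in> E" "p = word_map n m u j p'"
      using u unfolding codes_def cylinder_def by blast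
    have "word_map n m w (q + j) = word_map n m v q \<circ> word_map n m u j"
      unfolding word_map_add by (intro arg_cong2[where f = comp] word_map_cong) (auto simp: w_def)
    then have "z = word_map n m w (q + j) p'"
      using p p' by simp
    then show ?thesis
      using p'(1) by (auto simp: cylinder_def)
  qed
  have "z \<in> cylinder w k" for k
    using zq[of k] cylinder_antimono[of k "q + k" w] wD by auto
  then have "codes w z"
    using wD by (simp add: codes_def)
  moreover have "\<forall>i<q. w i = v i"
    by (simp add: w_def)
  ultimately show ?thesis by blast
qed

lemma row_index_eq_iff:
  assumes "\<And>i. i < q \<Longrightarrow> v i \<in> D" and "\<And>i. i < q \<Longrightarrow> w i \<in> D"
  shows "row_index m v q = row_index m w q \<longleftrightarrow> (\<forall>i<q. snd (v i) = snd (w i))"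
  using digit_number_inj[of m "\<lambda>i. snd (v i)" q "\<lambda>i. snd (w i)"] assms digit_less(2)
    digit_number_cong[of q "\<lambda>i. snd (v i)" "\<lambda>i. snd (w i)"] by blast

lemma column_index_eq_imp:
  assumes "\<And>i. i < q \<Longrightarrow> v i \<in> D" and "\<And>i. i < q \<Longrightarrow> w i \<in> D"
    and "column_index n v q = column_index n w q" and "i < q"
  shows "fst (v i) = fst (w i)"
  using digit_number_inj[of n "\<lambda>i. fst (v i)" q "\<lambda>i. fst (w i)"] assms digit_less(1) by blast

lemma E_subset_unit_square: "E \<subseteq> {0..1} \<times> {0..1}"
  using E_unit by (auto simp: mem_Times_iff)

lemma dist_word_map_le:
  assumes "p \<in> {0..1} \<times> {0..1}" and "p' \<in> {0..1} \<times> {0..1}"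
  shows "dist (word_map n m w k p) (word_map n m w k p') \<le> 2 * (1 / real m) ^ k"
proof -
  have u: "\<bar>fst p - fst p'\<bar> \<le> 1" "\<bar>snd p - snd p'\<bar> \<le> 1"
    using assms by (auto simp: mem_Times_iff abs_le_iff)
  have "\<bar>fst p - fst p'\<bar> / real n ^ k \<le> 1 / real m ^ k"
    using u m_less_n by (intro frac_le power_mono) auto
  moreover have "\<bar>snd p - snd p'\<bar> / real m ^ k \<le> 1 / real m ^ k"
    using u by (intro divide_right_mono) auto
  ultimately show ?thesis
    using dist_prod_le[of "word_map n m w k p" "word_map n m w k p'"]
    by (simp add: word_map_eq power_one_over flip: diff_divide_distrib)
qed

lemma contraction_null: "(\<lambda>k. 2 * (1 / real m) ^ k) \<longlonglongrightarrow> 0"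
  using m_ge_2 by (intro tendsto_mult_right_zero LIMSEQ_power_zero) auto

lemma codes_imp_is_coding:
  assumes "codes w z"
  shows "is_coding n m D w z"
proof -
  have square: "z \<in> word_map n m w k ` ({0..1} \<times> {0..1})" for k
    using assms E_subset_unit_square unfolding codes_def cylinder_def by blast
  moreover have "z' = z" if z': "\<forall>k\<ge>1. z' \<in> word_map n m w k ` ({0..1} \<times> {0..1})" for z'
  proof -
    have "dist z' z \<le> 2 * (1 / real m) ^ k" if "1 \<le> k" for k
      using z'[rule_format, OF that] square[of k] dist_word_map_le by blast
    then have "dist z' z \<le> 0"
      by (intro tendsto_lowerbound[OF contraction_null]) (auto intro: eventually_sequentiallyI[of 1])
    then show ?thesis by simp
  qed
  ultimately have "{z} = (\<Inter>k\<in>{1..}. word_map n m w k ` ({0..1} \<times> {0..1}))"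
    by blast
  then show ?thesis
    using assms by (simp add: is_coding_def codes_def)
qed

text \<open>Images of one point of \<open>E\<close> under the prefixes of \<open>w\<close> converge
  to \<open>z\<close>. Each cylinder of \<open>w\<close> is closed and contains all but finitely
  many of them, hence also the limit.\<close>

lemma is_coding_imp_codes:
  assumes "is_coding n m D w z"
  shows "codes w z"
proof -
  have wD: "w i \<in> D" for i
    using assms by (simp add: is_coding_def)
  obtain p where p: "p \<in> E"
    using E_nonempty by blast
  define s where "s k = word_map n m w k p" for k
  have s_in: "s j \<in> cylinder w k" if "k \<le> j" for j k
    using cylinder_antimono[OF that, of w] wD p by (auto simp: s_def cylinder_def)
  have bound: "dist (s k) z \<le> 2 * (1 / real m) ^ k" if "1 \<le> k" for k
  proof -
    have "z \<in> word_map n m w k ` ({0..1} \<times> {0..1})"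
      using assms that unfolding is_coding_def by blast
    then show ?thesis
      using p E_subset_unit_square dist_word_map_le unfolding s_def by blast
  qed
  have "\<forall>\<^sub>F k in sequentially. norm (dist (s k) z) \<le> 2 * (1 / real m) ^ k"
    using eventually_sequentiallyI[of 1, OF bound] by simp
  then have "(\<lambda>k. dist (s k) z) \<longlonglongrightarrow> 0"
    using contraction_null by (rule Lim_null_comparison)
  then have lim: "s \<longlonglongrightarrow> z"
    by (subst tendsto_dist_iff)
  have "z \<in> cylinder w k" for k
    using Lim_in_closed_set[OF cylinder_closed _ _ lim, of w k] s_in
    by (auto intro: eventually_sequentiallyI[of k])
  then show ?thesis
    using wD by (simp add: codes_def)
qed

lemma is_coding_iff_codes: "is_coding n m D w z \<longleftrightarrow> codes w z"
  using codes_imp_is_coding is_coding_imp_codes by blast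

section \<open>Measure estimates by counting words\<close>

lemma prob: "prob_space M" and sets_M: "sets M = sets borel" and measure_E: "measure M E = 1"
  using is_bernoulli by (auto simp: is_uniform_bernoulli_def)

sublocale prob_space M
  by (rule prob)

lemma space_M [simp]: "space M = UNIV"
  using sets_eq_imp_space_eq[OF sets_M] by simp

lemma vimage_word_map_borel:
  assumes "A \<in> sets borel"
  shows "word_map n m w q -` A \<in> sets borel"
  using measurable_sets[OF borel_measurable_continuous_onI[OF continuous_on_word_map] assms] by simp

text \<open>A new letter acts innermost, so the self-similarity of the measure is applied to the
  preimage of \<open>A\<close> under the shorter word map.\<close>

lemma measure_eq_sum_words:
  assumes A: "A \<in> sets borel"
  shows "measure M A = (1 / real (card D)) ^ q * (\<Sum>w\<in>words q. measure M (word_map n m w q -` A))"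
proof (induction q)
  case 0
  then show ?case by (simp add: words_def)
next
  case (Suc q)
  have split: "measure M (word_map n m w q -` A) =
      1 / real (card D) * (\<Sum>d\<in>D. measure M (word_map n m (w(q := d)) (Suc q) -` A))" for w
  proof -
    have "word_map n m (w(q := d)) q = word_map n m w q" for d
      by (rule word_map_cong) simp
    then have "word_map n m (w(q := d)) (Suc q) -` A = digit_map n m d -` (word_map n m w q -` A)" for d
      by auto
    then show ?thesis
      using is_bernoulli vimage_word_map_borel[OF A] by (simp add: is_uniform_bernoulli_def)
  qed
  have "(\<Sum>w\<in>words (Suc q). measure M (word_map n m w (Suc q) -` A)) =
      (\<Sum>(d, w)\<in>D \<times> words q. measure M (word_map n m (w(q := d)) (Suc q) -` A))"
  proof -
    have eq: "words (Suc q) = (\<lambda>(d, w). w(q := d)) ` (D \<times> words q)"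
      unfolding words_def lessThan_Suc PiE_insert_eq ..
    have inj: "inj_on (\<lambda>(d, w). w(q := d)) (D \<times> words q)"
      unfolding words_def by (rule inj_combinator) simp
    show ?thesis
      unfolding eq by (subst sum.reindex[OF inj]) (auto intro!: sum.cong simp del: word_map.simps)
  qed
  also have "\<dots> = (\<Sum>w\<in>words q. \<Sum>d\<in>D. measure M (word_map n m (w(q := d)) (Suc q) -` A))"
    unfolding sum.cartesian_product[symmetric] by (rule sum.swap)
  finally show ?case
    using Suc by (simp add: split sum_divide_distrib[symmetric] mult_ac del: word_map.simps)
qed

text \<open>Cylinders may overlap, so the measure is not read off from a partition. It is enclosed
  between the share of words whose cylinders lie in the set and the share of words whose cylinders
  meet it. Words of the remaining kind contribute nothing, because \<open>E\<close> carries all the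
  mass.\<close>

lemma measure_le_card_words:
  assumes "A \<in> sets borel"
  shows "measure M A \<le> real (card {w \<in> words q. cylinder w q \<inter> A \<noteq> {}}) / real (card D) ^ q"
proof -
  have "measure M (word_map n m w q -` A) \<le> (if cylinder w q \<inter> A \<noteq> {} then 1 else 0)" for w
  proof (cases "cylinder w q \<inter> A = {}")
    case True
    then have "word_map n m w q -` A \<subseteq> UNIV - E"
      by (auto simp: cylinder_def)
    then have "measure M (word_map n m w q -` A) \<le> measure M (space M - E)"
      by (intro finite_measure_mono) (auto simp: sets_M)
    also have "\<dots> = 0"
      using measure_E by (subst prob_compl) (auto simp: sets_M)
    finally show ?thesis
      using True by simp
  qed simp
  then have "(\<Sum>w\<in>words q. measure M (word_map n m w q -` A)) \<le>
      (\<Sum>w\<in>words q. if cylinder w q \<inter> A \<noteq> {} then 1 else 0)"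
    by (intro sum_mono)
  also have "\<dots> = real (card {w \<in> words q. cylinder w q \<inter> A \<noteq> {}})"
    by (subst sum.inter_filter[symmetric]) auto
  finally show ?thesis
    unfolding measure_eq_sum_words[OF assms, of q]
    by (simp add: power_one_over divide_right_mono)
qed

lemma card_words_le_measure:
  assumes A: "A \<in> sets borel"
  shows "real (card {w \<in> words q. cylinder w q \<subseteq> A}) / real (card D) ^ q \<le> measure M A"
proof -
  have "(if cylinder w q \<subseteq> A then 1 else 0) \<le> measure M (word_map n m w q -` A)" for w
  proof (cases "cylinder w q \<subseteq> A")
    case True
    then have "E \<subseteq> word_map n m w q -` A"
      by (auto simp: cylinder_def)
    then have "measure M E \<le> measure M (word_map n m w q -` A)"
      using vimage_word_map_borel[OF A] by (intro finite_measure_mono) (auto simp: sets_M)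
    then show ?thesis
      using measure_E by simp
  qed simp
  then have "(\<Sum>w\<in>words q. if cylinder w q \<subseteq> A then 1 else 0) \<le>
      (\<Sum>w\<in>words q. measure M (word_map n m w q -` A))"
    by (intro sum_mono)
  moreover have "(\<Sum>w\<in>words q. if cylinder w q \<subseteq> A then 1 else 0) =
      real (card {w \<in> words q. cylinder w q \<subseteq> A})"
    by (subst sum.inter_filter[symmetric]) auto
  ultimately show ?thesis
    unfolding measure_eq_sum_words[OF A, of q]
    by (simp add: power_one_over divide_right_mono)
qed

section \<open>Fibres and the mass of approximate squares\<close>

definition fiber :: "nat \<Rightarrow> nat" where
  "fiber j = card {d \<in> D. snd d = j}"

lemma fiber_pos_iff: "0 < fiber j \<longleftrightarrow> (\<exists>d\<in>D. snd d = j)"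
  by (auto simp: fiber_def card_gt_0_iff) (metis snd_conv)

lemma fiber_pos: "d \<in> D \<Longrightarrow> 0 < fiber (snd d)"
  by (auto simp: fiber_pos_iff)

lemma fiber_le_card: "fiber j \<le> card D"
  unfolding fiber_def by (intro card_mono) auto

text \<open>Up to the factor \<open>card D ^ q\<close>, the measure of the rectangle with \<open>k\<close> column digits and
  row digits \<open>snd (w 0), \<dots>, snd (w (q - 1))\<close>.\<close>

definition weight :: "(nat \<Rightarrow> nat \<times> nat) \<Rightarrow> nat \<Rightarrow> nat \<Rightarrow> nat" where
  "weight w k q = (\<Prod>i\<in>{k..<q}. fiber (snd (w i)))"

lemma card_rectangle_words:
  assumes "k \<le> q"
  shows "card (PiE {..<q} (\<lambda>i. if i < k then {w i} else {d \<in> D. snd d = snd (w i)})) = weight w k q"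
proof -
  have "card (PiE {..<q} (\<lambda>i. if i < k then {w i} else {d \<in> D. snd d = snd (w i)})) =
      (\<Prod>i<q. if i < k then 1 else fiber (snd (w i)))"
    by (simp add: card_PiE fiber_def if_distrib cong: if_cong)
  also have "\<dots> = (\<Prod>i\<in>{k..<q}. if i < k then 1 else fiber (snd (w i)))"
    using assms by (intro prod.mono_neutral_right) auto
  also have "\<dots> = weight w k q"
    by (simp add: weight_def)
  finally show ?thesis .
qed

lemma weight_cong: "(\<And>i. i < q \<Longrightarrow> snd (w i) = snd (w' i)) \<Longrightarrow> weight w k q = weight w' k q"
  unfolding weight_def by (intro prod.cong) auto

lemma weight_pos: "(\<And>i. i < q \<Longrightarrow> w i \<in> D) \<Longrightarrow> 0 < weight w k q"
  unfolding weight_def by (intro prod_pos) (auto intro: fiber_pos)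

text \<open>Fibres of rows that occur are at least 1, so longer row words only increase the product.
  Each column digit that becomes prescribed removes one factor, which is at most
  \<open>card D\<close>.\<close>

lemma weight_refine:
  assumes "k \<le> k'" "k' \<le> q'" "q \<le> q'" and "\<And>i. i < q' \<Longrightarrow> w i \<in> D"
  shows "weight w k q \<le> card D ^ (k' - k) * weight w k' q'"
proof -
  have "weight w k q \<le> weight w k q'"
    unfolding weight_def using assms
    by (intro dvd_imp_le prod_dvd_prod_subset prod_pos) (auto intro: fiber_pos)
  also have "\<dots> = weight w k k' * weight w k' q'"
    unfolding weight_def using assms by (simp add: prod.atLeastLessThan_concat)
  also have "weight w k k' \<le> card D ^ (k' - k)"
    unfolding weight_def using prod_mono[of "{k..<k'}" "\<lambda>i. fiber (snd (w i))" "\<lambda>_. card D"] fiber_le_card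
    by simp
  finally show ?thesis by simp
qed

lemma ball_borel [measurable]: "ball z t \<inter> E \<in> sets borel"
  by (intro sets.Int borel_open E_borel) simp

lemma weight_le_measure_ball:
  assumes w: "codes w z" and "k \<le> q" and t: "1 / real n ^ k + 1 / real m ^ q < t"
  shows "real (weight w k q) / real (card D) ^ q \<le> measure M (ball z t \<inter> E)"
proof -
  let ?P = "PiE {..<q} (\<lambda>i. if i < k then {w i} else {d \<in> D. snd d = snd (w i)})"
  have wD: "w i \<in> D" for i
    using w by (simp add: codes_def)
  have "?P \<subseteq> {v \<in> words q. cylinder v q \<subseteq> ball z t \<inter> E}"
  proof
    fix v assume v: "v \<in> ?P"
    then have vi: "v i \<in> D" "snd (v i) = snd (w i)" if "i < q" for i
      using that PiE_mem[OF v, of i] wD[of i] by (auto split: if_splits)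
    have vk: "v i = w i" if "i < k" for i
      using that PiE_mem[OF v, of i] \<open>k \<le> q\<close> by auto
    have vw: "v \<in> words q"
      using v vi by (auto simp: words_def PiE_iff)
    have "z' \<in> ball z t \<inter> E" if z': "z' \<in> cylinder v q" for z'
    proof -
      have "dist z z' \<le> 1 / real n ^ k + 1 / real m ^ q"
      proof (rule dist_le_rectangle)
        show "z' \<in> cylinder v k"
          using z' cylinder_antimono[OF \<open>k \<le> q\<close>, of v] vi by auto
        show "column_index n w k = column_index n v k"
          by (rule digit_number_cong) (simp add: vk)
        show "row_index m w q = row_index m v q"
          by (rule digit_number_cong) (simp add: vi)
      qed (use w z' in \<open>auto simp: codes_def\<close>)
      then show ?thesis
        using t z' cylinder_subset_E[of q v] vi by auto
    qed
    then show "v \<in> {v \<in> words q. cylinder v q \<subseteq> ball z t \<inter> E}"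
      using vw by auto
  qed
  then have "weight w k q \<le> card {v \<in> words q. cylinder v q \<subseteq> ball z t \<inter> E}"
    unfolding card_rectangle_words[OF \<open>k \<le> q\<close>, symmetric] by (intro card_mono) auto
  then have "real (weight w k q) / real (card D) ^ q \<le>
      real (card {v \<in> words q. cylinder v q \<subseteq> ball z t \<inter> E}) / real (card D) ^ q"
    by (intro divide_right_mono) auto
  also have "\<dots> \<le> measure M (ball z t \<inter> E)"
    by (rule card_words_le_measure) measurable
  finally show ?thesis .
qed

abbreviation level :: "nat \<Rightarrow> nat" where
  "level q \<equiv> column_level n m q"

text \<open>The share of words of length \<open>q\<close> that belong to one approximate square.
  Only row digits enter, so it has the same value for all nonempty approximate squares of a
  row.\<close>

definition rect_measure :: "(nat \<Rightarrow> nat \<times> nat) \<Rightarrow> nat \<Rightarrow> real" where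
  "rect_measure w q = real (weight w (level q) q) / real (card D) ^ q"

lemma rect_measure_cong: "(\<And>i. i < q \<Longrightarrow> snd (w i) = snd (w' i)) \<Longrightarrow> rect_measure w q = rect_measure w' q"
  unfolding rect_measure_def using weight_cong[of q w w'] by simp

lemma rect_measure_pos: "(\<And>i. i < q \<Longrightarrow> w i \<in> D) \<Longrightarrow> 0 < rect_measure w q"
  unfolding rect_measure_def using weight_pos by simp

text \<open>The rectangle may be larger than the ball. One that lies \<open>c\<close> levels deeper
  fits into it, where \<open>c\<close> depends only on \<open>K\<close>. Each level costs at most
  one factor \<open>card D\<close> in the weight and exactly one in the normalisation, hence
  \<open>N ^ (2 * c)\<close>.\<close>

lemma rect_measure_le_ball:
  fixes K :: real
  shows "\<exists>C>0. \<forall>q w z t. codes w z \<longrightarrow> 0 < t \<longrightarrow> 1 / real m ^ q \<le> K * t \<longrightarrow>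
    rect_measure w q \<le> C * measure M (ball z t \<inter> E)"
proof -
  obtain c where c: "(real n + 1) * K < real m ^ c"
    using real_arch_pow[of "real m"] m_ge_2 by auto
  define N where "N = real (card D)"
  have N1: "1 \<le> N"
    using card_D_pos by (simp add: N_def Suc_le_eq del: card_D_pos)
  have "rect_measure w q \<le> N ^ (2 * c) * measure M (ball z t \<inter> E)"
    if w: "codes w z" and t: "0 < t" "1 / real m ^ q \<le> K * t" for q w z t
  proof -
    let ?q = "q + c"
    have "1 / real n ^ level ?q + 1 / real m ^ ?q \<le> (real n + 1) / real m ^ ?q"
      using column_width_bounds(2)[OF m_ge_2 m_less_n, of ?q] by (simp add: add_divide_distrib)
    also have "\<dots> = (real n + 1) * (1 / real m ^ q) / real m ^ c"
      by (simp add: power_add)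
    also have "\<dots> \<le> (real n + 1) * (K * t) / real m ^ c"
      using t by (intro divide_right_mono mult_left_mono) auto
    also have "\<dots> = ((real n + 1) * K) * t / real m ^ c"
      by (simp add: mult_ac)
    also have "\<dots> < real m ^ c * t / real m ^ c"
      using c t by (intro divide_strict_right_mono mult_strict_right_mono) auto
    finally have small: "1 / real n ^ level ?q + 1 / real m ^ ?q < t"
      by simp
    have lev: "level q \<le> level ?q" "level ?q \<le> ?q" "level ?q - level q \<le> c"
      using column_level_mono[OF m_ge_2 m_less_n, of q ?q] column_level_le[OF m_ge_2 m_less_n, of ?q]
        column_level_add_le[OF m_ge_2 m_less_n, of q c] by auto
    have "weight w (level q) q \<le> card D ^ (level ?q - level q) * weight w (level ?q) ?q"
      using w lev by (intro weight_refine) (auto simp: codes_def)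
    also have "\<dots> \<le> card D ^ c * weight w (level ?q) ?q"
      using lev card_D_pos by (intro mult_right_mono power_increasing) (auto simp: Suc_le_eq simp del: card_D_pos)
    finally have "real (weight w (level q) q) \<le> N ^ c * real (weight w (level ?q) ?q)"
      unfolding N_def by (metis of_nat_le_iff of_nat_mult of_nat_power)
    then have "rect_measure w q \<le> N ^ c * real (weight w (level ?q) ?q) / N ^ q"
      unfolding rect_measure_def N_def[symmetric] using N1 by (intro divide_right_mono) auto
    also have "\<dots> = N ^ (2 * c) * (real (weight w (level ?q) ?q) / N ^ ?q)"
      using N1 by (simp add: power_add mult_2)
    also have "\<dots> \<le> N ^ (2 * c) * measure M (ball z t \<inter> E)"
      using weight_le_measure_ball[OF w lev(2) small] N1 by (intro mult_left_mono) (auto simp: N_def)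
    finally show ?thesis .
  qed
  then show ?thesis
    using N1 by (intro exI[of _ "N ^ (2 * c)"]) auto
qed

lemma measure_ball_pos:
  assumes "z \<in> E" and "0 < t"
  shows "0 < measure M (ball z t \<inter> E)"
proof -
  obtain w where w: "codes w z"
    using ex_codes[OF assms(1)] ..
  obtain C where C: "C > 0" "\<forall>q w z t'. codes w z \<longrightarrow> 0 < t' \<longrightarrow> 1 / real m ^ q \<le> 1 / t * t' \<longrightarrow>
      rect_measure w q \<le> C * measure M (ball z t' \<inter> E)"
    using rect_measure_le_ball by blast
  have "0 < rect_measure w 0"
    by (rule rect_measure_pos) simp
  also have "\<dots> \<le> C * measure M (ball z t \<inter> E)"
    using C(2)[rule_format, of w z t 0] w assms(2) by simp
  finally show ?thesis
    using C(1) by (simp add: zero_less_mult_iff)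
qed

text \<open>A closed strip as wide as \<open>c\<close> columns meets at most \<open>c + 2\<close>
  closed columns, the extreme case being a strip that starts on a grid line. Column number and row
  digits together determine the first \<open>k\<close> letters, so each column contributes at most
  the weight of one rectangle.\<close>

lemma card_rectangle_words_le:
  assumes w: "\<And>i. i < q \<Longrightarrow> w i \<in> D" and "k \<le> q"
    and A: "\<And>p. p \<in> A \<Longrightarrow> x \<le> fst p \<and> fst p \<le> x + real c / real n ^ k"
  shows "card {v \<in> words q. cylinder v q \<inter> A \<noteq> {} \<and> (\<forall>i<q. snd (v i) = snd (w i))} \<le> (c + 2) * weight w k q"
proof -
  let ?W = "\<lambda>X. {v \<in> words q. int (column_index n v k) = X \<and> (\<forall>i<q. snd (v i) = snd (w i))}"
  define l where "l = \<lceil>x * real n ^ k\<rceil> - 1"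
  have "{v \<in> words q. cylinder v q \<inter> A \<noteq> {} \<and> (\<forall>i<q. snd (v i) = snd (w i))} \<subseteq> (\<Union>X\<in>{l..l + int c + 1}. ?W X)"
  proof
    fix v assume "v \<in> {v \<in> words q. cylinder v q \<inter> A \<noteq> {} \<and> (\<forall>i<q. snd (v i) = snd (w i))}"
    then obtain p where v: "v \<in> words q" "\<forall>i<q. snd (v i) = snd (w i)" and p: "p \<in> cylinder v q" "p \<in> A"
      by blast
    have "p \<in> cylinder v k"
      using p(1) cylinder_antimono[OF \<open>k \<le> q\<close>, of v] words_in_D[OF v(1)] by auto
    note b = cylinder_bounds(1,2)[OF this]
    let ?X = "real (column_index n v k)"
    have "x \<le> (?X + 1) / real n ^ k"
      using A[OF p(2)] b(2) by linarith
    then have "x * real n ^ k \<le> ?X + 1"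
      by (simp add: field_simps)
    then have "\<lceil>x * real n ^ k\<rceil> \<le> int (column_index n v k) + 1"
      by (simp add: ceiling_le_iff)
    moreover have "?X / real n ^ k \<le> x + real c / real n ^ k"
      using A[OF p(2)] b(1) by linarith
    then have "?X \<le> x * real n ^ k + real c"
      by (simp add: field_simps)
    then have "?X \<le> real_of_int \<lceil>x * real n ^ k\<rceil> + real c"
      by linarith
    then have "int (column_index n v k) \<le> \<lceil>x * real n ^ k\<rceil> + int c"
      by linarith
    ultimately have "int (column_index n v k) \<in> {l..l + int c + 1}"
      by (simp add: l_def)
    then show "v \<in> (\<Union>X\<in>{l..l + int c + 1}. ?W X)"
      using v by blast
  qed
  then have "card {v \<in> words q. cylinder v q \<inter> A \<noteq> {} \<and> (\<forall>i<q. snd (v i) = snd (w i))} \<le>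
      card (\<Union>X\<in>{l..l + int c + 1}. ?W X)"
    by (intro card_mono) auto
  also have "\<dots> \<le> (\<Sum>X\<in>{l..l + int c + 1}. card (?W X))"
    by (rule card_UN_le) simp
  also have "\<dots> \<le> (\<Sum>X\<in>{l..l + int c + 1}. weight w k q)"
  proof (rule sum_mono)
    fix X
    show "card (?W X) \<le> weight w k q"
    proof (cases "?W X = {}")
      case False
      then obtain v0 where v0: "v0 \<in> words q" "int (column_index n v0 k) = X" "\<forall>i<q. snd (v0 i) = snd (w i)"
        by blast
      let ?P = "PiE {..<q} (\<lambda>i. if i < k then {v0 i} else {d \<in> D. snd d = snd (v0 i)})"
      have "?W X \<subseteq> ?P"
      proof
        fix v assume "v \<in> ?W X"
        then have v: "v \<in> words q" "int (column_index n v k) = X" "\<forall>i<q. snd (v i) = snd (w i)"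
          by auto
        have "v i = v0 i" if "i < k" for i
          using column_index_eq_imp[of k v v0 i] v v0 that words_in_D \<open>k \<le> q\<close>
          by (auto simp: prod_eq_iff)
        then show "v \<in> ?P"
          using v v0 by (auto simp: words_def PiE_iff)
      qed
      then have "card (?W X) \<le> card ?P"
        by (intro card_mono finite_PiE) auto
      also have "\<dots> = weight v0 k q"
        by (rule card_rectangle_words) (rule \<open>k \<le> q\<close>)
      also have "\<dots> = weight w k q"
        using v0 by (intro weight_cong) auto
      finally show ?thesis .
    qed (simp only: card.empty)
  qed
  also have "\<dots> = (c + 2) * weight w k q"
    by (simp add: nat_add_distrib algebra_simps)
  finally show ?thesis .
qed

text \<open>A ball of radius at most \<open>K m\<^sup>-\<^sup>q\<close> meets a bounded number of rectangles in each row.\<close>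

lemma card_row_words_le:
  fixes K :: real
  shows "\<exists>C>0. \<forall>q w z t. (\<forall>i<q. w i \<in> D) \<longrightarrow> t \<le> K / real m ^ q \<longrightarrow>
    real (card {v \<in> words q. cylinder v q \<inter> ball z t \<noteq> {} \<and> (\<forall>i<q. snd (v i) = snd (w i))}) / real (card D) ^ q
      \<le> C * rect_measure w q"
proof -
  \<comment> \<open>The diameter of the ball measured in columns, which are at least as wide as
    \<open>1 / real m ^ q\<close>.\<close>
  define c where "c = nat \<lceil>2 * \<bar>K\<bar>\<rceil>"
  have c: "2 * \<bar>K\<bar> \<le> real c"
    by (simp add: c_def)
  have "real (card {v \<in> words q. cylinder v q \<inter> ball z t \<noteq> {} \<and> (\<forall>i<q. snd (v i) = snd (w i))}) / real (card D) ^ q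
      \<le> real (c + 2) * rect_measure w q"
    if w: "\<forall>i<q. w i \<in> D" and t: "t \<le> K / real m ^ q" for q w z t
  proof -
    have "2 * t \<le> (2 * \<bar>K\<bar>) * (1 / real m ^ q)"
      using t by (simp add: field_simps abs_if split: if_splits)
    also have "\<dots> \<le> real c * (1 / real n ^ level q)"
      using c column_width_bounds(1)[OF m_ge_2 m_less_n, of q] by (intro mult_mono) auto
    finally have 2: "2 * t \<le> real c / real n ^ level q"
      by simp
    have "card {v \<in> words q. cylinder v q \<inter> ball z t \<noteq> {} \<and> (\<forall>i<q. snd (v i) = snd (w i))} \<le>
        (c + 2) * weight w (level q) q"
    proof (rule card_rectangle_words_le[where x = "fst z - t"])
      fix p assume "p \<in> ball z t"
      then have "\<bar>fst z - fst p\<bar> < t"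
        using fst_diff_le_dist[of z p] by simp
      then show "fst z - t \<le> fst p \<and> fst p \<le> fst z - t + real c / real n ^ level q"
        using 2 by linarith
    qed (use w column_level_le[OF m_ge_2 m_less_n] in auto)
    from divide_right_mono[OF of_nat_mono[OF this, where 'a = real], of "real (card D) ^ q"]
    show ?thesis
      unfolding rect_measure_def times_divide_eq_right of_nat_mult by simp
  qed
  then show ?thesis
    by (intro exI[of _ "real (c + 2)"]) auto
qed

lemma measure_le_rect_measure:
  fixes K :: real
  shows "\<exists>C>0. \<forall>q w z t. (\<forall>i<q. w i \<in> D) \<longrightarrow> t \<le> K / real m ^ q \<longrightarrow>
    (\<forall>v\<in>words q. cylinder v q \<inter> ball z t \<noteq> {} \<longrightarrow> (\<forall>i<q. snd (v i) = snd (w i))) \<longrightarrow>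
    measure M (ball z t \<inter> E) \<le> C * rect_measure w q"
proof -
  obtain C where C: "C > 0" "\<And>q w z t. (\<forall>i<q. w i \<in> D) \<Longrightarrow> t \<le> K / real m ^ q \<Longrightarrow>
    real (card {v \<in> words q. cylinder v q \<inter> ball z t \<noteq> {} \<and> (\<forall>i<q. snd (v i) = snd (w i))}) / real (card D) ^ q
      \<le> C * rect_measure w q"
    using card_row_words_le[of K] by blast
  have "measure M (ball z t \<inter> E) \<le> C * rect_measure w q"
    if *: "\<forall>i<q. w i \<in> D" "t \<le> K / real m ^ q"
      "\<forall>v\<in>words q. cylinder v q \<inter> ball z t \<noteq> {} \<longrightarrow> (\<forall>i<q. snd (v i) = snd (w i))" for q w z t
  proof -
    have "{v \<in> words q. cylinder v q \<inter> (ball z t \<inter> E) \<noteq> {}} \<subseteq>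
        {v \<in> words q. cylinder v q \<inter> ball z t \<noteq> {} \<and> (\<forall>i<q. snd (v i) = snd (w i))}"
      using *(3) by blast
    then have "card {v \<in> words q. cylinder v q \<inter> (ball z t \<inter> E) \<noteq> {}} \<le>
        card {v \<in> words q. cylinder v q \<inter> ball z t \<noteq> {} \<and> (\<forall>i<q. snd (v i) = snd (w i))}"
      by (intro card_mono) auto
    then have "real (card {v \<in> words q. cylinder v q \<inter> (ball z t \<inter> E) \<noteq> {}}) / real (card D) ^ q \<le>
        real (card {v \<in> words q. cylinder v q \<inter> ball z t \<noteq> {} \<and> (\<forall>i<q. snd (v i) = snd (w i))}) / real (card D) ^ q"
      by (intro divide_right_mono) auto
    then show ?thesis
      using measure_le_card_words[of "ball z t \<inter> E" q] C(2)[OF *(1,2), of z] by simp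
  qed
  then show ?thesis
    using C(1) by blast
qed

section \<open>Non-doubling carpets\<close>

lemma row_neighbour:
  assumes "p \<in> cylinder v q" and "p' \<in> cylinder w q" and "dist p p' < 1 / real m ^ q"
  shows "row_index m v q \<le> row_index m w q + 1"
proof -
  have "\<bar>snd p - snd p'\<bar> < 1 / real m ^ q"
    using snd_diff_le_dist[of p p'] assms(3) by linarith
  then have "real (row_index m v q) / real m ^ q < (real (row_index m w q) + 1) / real m ^ q + 1 / real m ^ q"
    using cylinder_bounds(3)[OF assms(1)] cylinder_bounds(4)[OF assms(2)] by linarith
  then have "real (row_index m v q) < real (row_index m w q) + 2"
    by (simp add: field_simps)
  then show ?thesis
    by linarith
qed

text \<open>Adjacent nonempty rows either share all but the last digit or continue as
  \<open>c (m - 1) \<dots> (m - 1)\<close> and \<open>(c + 1) 0 \<dots> 0\<close>.\<close>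

lemma weight_adjacent_rows:
  assumes "fiber 0 = 0 \<or> fiber (m - 1) = 0 \<or> fiber 0 = fiber (m - 1)"
    and "\<And>i. i < q \<Longrightarrow> v i \<in> D" and "\<And>i. i < q \<Longrightarrow> w i \<in> D"
    and "row_index m v q = row_index m w q + 1"
  shows "weight v k q \<le> card D * weight w k q \<and> weight w k q \<le> card D * weight v k q"
  using assms(2-)
proof (induction q)
  case (Suc q)
  have D: "v q \<in> D" "w q \<in> D"
    using Suc.prems by auto
  have l: "snd (v q) < m" "snd (w q) < m"
    using D digit_less by auto
  have eq: "m * row_index m v q + snd (v q) = m * row_index m w q + (snd (w q) + 1)"
    using Suc.prems(3) by simp
  have div_eq: "a = b" if "m * a + c = m * b + c'" "c < m" "c' < m" for a b c c' :: nat
    using arg_cong[OF that(1), of "\<lambda>t. t div m"] that(2,3) by simp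
  show ?case
  proof (cases "q < k")
    case True
    then show ?thesis
      by (simp add: weight_def Suc_le_eq)
  next
    case False
    then have S: "weight u k (Suc q) = weight u k q * fiber (snd (u q))" for u
      by (simp add: weight_def)
    show ?thesis
    proof (cases "snd (w q) + 1 < m")
      case True
      have "row_index m v q = row_index m w q"
        using div_eq[OF eq l(1) True] .
      then have "weight v k q = weight w k q"
        using row_index_eq_iff[of q v w] Suc.prems by (intro weight_cong) auto
      moreover have "fiber (snd (v q)) \<le> card D * fiber (snd (w q))"
        "fiber (snd (w q)) \<le> card D * fiber (snd (v q))"
        using fiber_le_card fiber_pos D
        by (metis Suc_leI mult.right_neutral mult_le_mono le_trans One_nat_def)+
      ultimately show ?thesis
        unfolding S by (metis mult.left_commute mult_le_mono2)
    next
      case False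
      then have top: "snd (w q) = m - 1"
        using l by simp
      then have eq': "m * row_index m v q + snd (v q) = m * (row_index m w q + 1) + 0"
        using eq l by (simp add: algebra_simps)
      have bot: "snd (v q) = 0"
        using arg_cong[OF eq', of "\<lambda>t. t mod m"] l by simp
      have "row_index m v q = row_index m w q + 1"
        using div_eq[OF eq' l(1)] by simp
      then have "weight v k q \<le> card D * weight w k q \<and> weight w k q \<le> card D * weight v k q"
        using Suc.prems by (intro Suc.IH) auto
      \<comment> \<open>Both end digits occur here, so the alternatives with an empty end row are
        impossible and the end fibres agree: a carry leaves the ratio of the weights
        unchanged.\<close>
      moreover have "fiber (snd (v q)) = fiber (snd (w q))"
        using assms(1) fiber_pos[OF D(1)] fiber_pos[OF D(2)] top bot by auto
      ultimately show ?thesis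
        unfolding S by (simp add: mult.assoc[symmetric])
    qed
  qed
qed simp

lemma msupport_subset: "msupport M \<subseteq> E"
proof
  fix x assume x: "x \<in> msupport M"
  show "x \<in> E"
  proof (rule ccontr)
    assume "x \<notin> E"
    then have "emeasure M (- E) > 0"
      using x E_closed by (auto simp: msupport_def)
    moreover have "measure M (space M - E) = 0"
      using measure_E by (subst prob_compl) (auto simp: sets_M)
    ultimately show False
      by (simp add: emeasure_eq_measure Compl_eq_Diff_UNIV)
  qed
qed

lemma measure_Int_E:
  assumes "A \<in> sets borel"
  shows "measure M (A \<inter> E) = measure M A"
  using measure_E prob_space assms by (intro measure_space_inter) (auto simp: sets_M)

text \<open>Used in contrapositive form, it supplies the fibre conditions for carpets of
  non-doubling type. A ball of small radius meets at most three consecutive rows at its scale. Their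
  weights exceed that of the row of the centre by at most the factor \<open>card D\<close>, and the
  concentric ball of half the radius already carries a fixed part of that row's rectangle.\<close>

lemma doubling:
  assumes fib: "fiber 0 = 0 \<or> fiber (m - 1) = 0 \<or> fiber 0 = fiber (m - 1)"
  shows "doubling_measure M"
proof -
  obtain C where C: "C > 0" "\<And>q w z t. (\<forall>i<q. w i \<in> D) \<Longrightarrow> t \<le> 1 / real m ^ q \<Longrightarrow>
    real (card {v \<in> words q. cylinder v q \<inter> ball z t \<noteq> {} \<and> (\<forall>i<q. snd (v i) = snd (w i))}) / real (card D) ^ q
      \<le> C * rect_measure w q"
    using card_row_words_le[of 1] by blast
  obtain C' where C': "C' > 0" "\<And>q w z t. codes w z \<Longrightarrow> 0 < t \<Longrightarrow> 1 / real m ^ q \<le> real (2 * m) * t \<Longrightarrow>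
    rect_measure w q \<le> C' * measure M (ball z t \<inter> E)"
    using rect_measure_le_ball[of "real (2 * m)"] by blast
  define N where "N = real (card D)"
  have N1: "1 \<le> N"
    using card_D_pos by (simp add: N_def Suc_le_eq del: card_D_pos)
  \<comment> \<open>The first summand accounts for three rows at small radii. The second handles
    large radii, where the total mass 1 is compared with a rectangle of level 0.\<close>
  define B where "B = 3 * C * N * C' + C'"
  have bound: "measure M (ball x (2 * r) \<inter> E) \<le> B * measure M (ball x r \<inter> E)"
    if x: "x \<in> E" and r: "0 < r" for x r
  proof -
    obtain w where w: "codes w x"
      using ex_codes[OF x] ..
    have wD: "w i \<in> D" for i
      using w by (simp add: codes_def)
    show ?thesis
    proof (cases "2 * r \<le> 1")
      case True
      obtain q where q: "2 * r \<le> 1 / real m ^ q" "1 / real m ^ q \<le> real m * (2 * r)"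
        using power_scale_above[OF m_ge_2, of "2 * r"] r True by auto
      define Y where "Y = row_index m w q"
      let ?W = "\<lambda>Z. {v \<in> words q. cylinder v q \<inter> ball x (2 * r) \<noteq> {} \<and> row_index m v q = Z}"
      have W: "real (card (?W Z)) / N ^ q \<le> C * (N * rect_measure w q)" if Z: "Z = Y \<or> Z = Y + 1 \<or> Z + 1 = Y" for Z
      proof (cases "?W Z = {}")
        case True
        have "0 \<le> rect_measure w q"
          using rect_measure_pos[of q w] wD by (simp add: less_imp_le)
        then show ?thesis
          using C(1) N1 unfolding True by simp
      next
        case False
        then obtain v0 where v0: "v0 \<in> words q" "row_index m v0 q = Z"
          by blast
        have v0D: "v0 i \<in> D" if "i < q" for i
          using words_in_D[OF v0(1) that] .
        have "?W Z = {v \<in> words q. cylinder v q \<inter> ball x (2 * r) \<noteq> {} \<and> (\<forall>i<q. snd (v i) = snd (v0 i))}"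
        proof (intro Collect_cong conj_cong refl)
          fix v assume "v \<in> words q"
          then show "row_index m v q = Z \<longleftrightarrow> (\<forall>i<q. snd (v i) = snd (v0 i))"
            using row_index_eq_iff[of q v v0] v0D words_in_D v0(2) by simp
        qed
        then have "real (card (?W Z)) / N ^ q \<le> C * rect_measure v0 q"
          using C(2)[of q v0 "2 * r" x] v0D q(1) by (simp add: N_def)
        also have "weight v0 (level q) q \<le> card D * weight w (level q) q"
        proof (cases "Z = Y")
          case True
          then have "weight v0 (level q) q = weight w (level q) q"
            using row_index_eq_iff[of q v0 w] v0 v0D wD by (intro weight_cong) (auto simp: Y_def)
          then show ?thesis
            by (simp add: Suc_le_eq)
        next
          case False
          then show ?thesis
            using Z v0 v0D wD weight_adjacent_rows[OF fib, of q v0 w "level q"]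
              weight_adjacent_rows[OF fib, of q w v0 "level q"] by (auto simp: Y_def)
        qed
        then have "rect_measure v0 q \<le> N * rect_measure w q"
          unfolding rect_measure_def times_divide_eq_right N_def
          by (intro divide_right_mono) (auto simp flip: of_nat_mult)
        then have "C * rect_measure v0 q \<le> C * (N * rect_measure w q)"
          using C(1) by simp
        finally show ?thesis .
      qed
      \<comment> \<open>For \<open>Y = 0\<close> the difference \<open>Y - 1\<close> equals
        \<open>Y\<close>, a case that \<open>W\<close> admits as well.\<close>
      have "{v \<in> words q. cylinder v q \<inter> (ball x (2 * r) \<inter> E) \<noteq> {}} \<subseteq> ?W Y \<union> (?W (Y + 1) \<union> ?W (Y - 1))"
      proof
        fix v assume "v \<in> {v \<in> words q. cylinder v q \<inter> (ball x (2 * r) \<inter> E) \<noteq> {}}"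
        then obtain p where v: "v \<in> words q" and p: "p \<in> cylinder v q" "p \<in> ball x (2 * r)"
          by blast
        have "x \<in> cylinder w q"
          using w by (simp add: codes_def)
        then have "row_index m v q \<le> Y + 1" "Y \<le> row_index m v q + 1"
          using row_neighbour[OF p(1), of x w] row_neighbour[OF _ p(1), of x w] p(2) q(1)
          by (auto simp: Y_def dist_commute)
        then have "row_index m v q \<in> {Y, Y + 1, Y - 1}"
          by auto
        then show "v \<in> ?W Y \<union> (?W (Y + 1) \<union> ?W (Y - 1))"
          using v p by blast
      qed
      then have "card {v \<in> words q. cylinder v q \<inter> (ball x (2 * r) \<inter> E) \<noteq> {}} \<le>
          card (?W Y \<union> (?W (Y + 1) \<union> ?W (Y - 1)))"
        by (intro card_mono) auto
      also have "\<dots> \<le> card (?W Y) + (card (?W (Y + 1)) + card (?W (Y - 1)))"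
        using card_Un_le[of "?W Y" "?W (Y + 1) \<union> ?W (Y - 1)"] card_Un_le[of "?W (Y + 1)" "?W (Y - 1)"]
        by linarith
      finally have "real (card {v \<in> words q. cylinder v q \<inter> (ball x (2 * r) \<inter> E) \<noteq> {}}) / N ^ q \<le>
          real (card (?W Y) + (card (?W (Y + 1)) + card (?W (Y - 1)))) / N ^ q"
        using N1 by (intro divide_right_mono) auto
      also have "\<dots> = real (card (?W Y)) / N ^ q + (real (card (?W (Y + 1))) / N ^ q + real (card (?W (Y - 1))) / N ^ q)"
        by (simp add: add_divide_distrib)
      also have "\<dots> \<le> C * (N * rect_measure w q) + (C * (N * rect_measure w q) + C * (N * rect_measure w q))"
        by (intro add_mono W) auto
      finally have "measure M (ball x (2 * r) \<inter> E) \<le> 3 * C * N * rect_measure w q"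
        using measure_le_card_words[of "ball x (2 * r) \<inter> E" q] by (simp add: N_def)
      also have "\<dots> \<le> 3 * C * N * (C' * measure M (ball x r \<inter> E))"
        using C(1) N1 q(2) r by (intro mult_left_mono C'(2)[OF w]) (auto simp: mult_ac)
      also have "\<dots> \<le> B * measure M (ball x r \<inter> E)"
        using C'(1) by (simp add: B_def algebra_simps)
      finally show ?thesis .
    next
      case False
      have "rect_measure w 0 \<le> C' * measure M (ball x r \<inter> E)"
      proof (rule C'(2)[OF w r])
        have "1 * 1 \<le> real m * (2 * r)"
          using m_ge_2 False by (intro mult_mono) auto
        then show "1 / real m ^ 0 \<le> real (2 * m) * r"
          by simp
      qed
      moreover have "rect_measure w 0 = 1"
        by (simp add: rect_measure_def weight_def)
      ultimately have "measure M (ball x (2 * r) \<inter> E) \<le> C' * measure M (ball x r \<inter> E)"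
        using prob_le_1[of "ball x (2 * r) \<inter> E"] by linarith
      also have "\<dots> \<le> B * measure M (ball x r \<inter> E)"
        using C(1) C'(1) N1 by (simp add: B_def algebra_simps)
      finally show ?thesis .
    qed
  qed
  have "(SUP x\<in>msupport M. SUP r\<in>{0<..}. ereal (measure M (ball x (2 * r)) / measure M (ball x r))) \<le> ereal B"
  proof (intro SUP_least)
    fix x r :: "_" assume x: "x \<in> msupport M" and r: "r \<in> {0::real<..}"
    then have "x \<in> E" "0 < r"
      using msupport_subset by auto
    from bound[OF this] measure_ball_pos[OF this]
    show "ereal (measure M (ball x (2 * r)) / measure M (ball x r)) \<le> ereal B"
      by (simp add: measure_Int_E divide_le_eq)
  qed
  also have "\<dots> < \<infinity>"
    by simp
  finally show ?thesis
    unfolding doubling_measure_def .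
qed

section \<open>Balls inside a single row\<close>

text \<open>Appending the row digits \<open>0, m - 1\<close> leads to a point in the middle of a row.\<close>

lemma ex_row_centre:
  assumes "0 < fiber 0" and "0 < fiber (m - 1)" and w: "codes w z"
  shows "\<exists>z'\<in>E. dist z z' \<le> 2 / real m ^ q \<and>
    (\<forall>t. t \<le> ((real m - 1) / real m ^ 2) / real m ^ q \<longrightarrow>
      (\<forall>v\<in>words q. cylinder v q \<inter> ball z' t \<noteq> {} \<longrightarrow> (\<forall>i<q. snd (v i) = snd (w i))))"
proof -
  obtain d0 d1 where d: "d0 \<in> D" "snd d0 = 0" "d1 \<in> D" "snd d1 = m - 1"
    using assms by (auto simp: fiber_pos_iff)
  obtain p where p: "p \<in> E"
    using E_nonempty by blast
  have wD: "w i \<in> D" for i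
    using w by (simp add: codes_def)
  define p1 where "p1 = digit_map n m d0 (digit_map n m d1 p)"
  have "digit_map n m d1 p \<in> E"
    using E_eq d p by blast
  then have p1: "p1 \<in> E"
    unfolding p1_def using E_eq d by blast
  \<comment> \<open>The height reached by the row digits \<open>0, m - 1, 0, 0, ...\<close>. The
    point \<open>p1\<close> lies between the heights \<open>h\<close> and \<open>1 / m\<close>, and
    \<open>1 / m \<le> 1 - h\<close> amounts to the nonnegativity of \<open>(m - 1) ^ 2\<close>;
    hence the same margin is available above and below.\<close>
  define h where "h = (real m - 1) / real m ^ 2"
  have m2: "real m \<ge> 2"
    using m_ge_2 by simp
  have s: "snd p1 = (snd p + (real m - 1)) / real m ^ 2"
    using d m2 by (simp add: p1_def digit_map_def of_nat_diff power2_eq_square)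
  have low: "h \<le> snd p1"
    using E_unit[OF p] by (auto simp: s h_def intro!: divide_right_mono)
  have "snd p1 \<le> real m / real m ^ 2"
    using E_unit[OF p] by (auto simp: s intro!: divide_right_mono)
  moreover have "real m / real m ^ 2 \<le> 1 - h"
  proof -
    have "0 \<le> (real m - 1) ^ 2"
      by simp
    then have "real m + (real m - 1) \<le> real m ^ 2"
      by (simp add: power2_eq_square algebra_simps)
    then have "(real m + (real m - 1)) / real m ^ 2 \<le> real m ^ 2 / real m ^ 2"
      by (intro divide_right_mono) auto
    then show ?thesis
      using m2 unfolding h_def add_divide_distrib by simp
  qed
  ultimately have high: "snd p1 \<le> 1 - h"
    by simp
  define z' where "z' = word_map n m w q p1"
  have z'c: "z' \<in> cylinder w q"
    using p1 by (simp add: z'_def cylinder_def)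
  have z'E: "z' \<in> E"
    using z'c cylinder_subset_E[of q w] wD by auto
  have snd_z': "snd z' = (snd p1 + real (row_index m w q)) / real m ^ q"
    by (simp add: z'_def word_map_eq)
  have "\<forall>i<q. snd (v i) = snd (w i)"
    if t: "t \<le> h / real m ^ q" and v: "v \<in> words q" "cylinder v q \<inter> ball z' t \<noteq> {}" for t v
  proof -
    obtain p' where p': "p' \<in> cylinder v q" "p' \<in> ball z' t"
      using v(2) by blast
    have "\<bar>snd z' - snd p'\<bar> < h / real m ^ q"
      using snd_diff_le_dist[of z' p'] p'(2) t by simp
    then have diff: "\<bar>snd z' * real m ^ q - snd p' * real m ^ q\<bar> < h"
      by (simp add: abs_mult flip: left_diff_distrib) (simp add: field_simps)
    have z1: "snd z' * real m ^ q = snd p1 + real (row_index m w q)"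
      by (simp add: snd_z')
    have "real (row_index m v q) \<le> snd p' * real m ^ q"
      "snd p' * real m ^ q \<le> real (row_index m v q) + 1"
      using cylinder_bounds(3,4)[OF p'(1)] by (simp_all add: field_simps)
    then have "real (row_index m v q) < real (row_index m w q) + 1"
      "real (row_index m w q) < real (row_index m v q) + 1"
      using diff z1 low high by linarith+
    then have "row_index m v q = row_index m w q"
      by linarith
    then show ?thesis
      using row_index_eq_iff[of q v w] wD words_in_D[OF v(1)] by blast
  qed
  then show ?thesis
    using z'E dist_le_cylinder[of z w q z'] z'c w by (intro bexI[of _ z']) (auto simp: codes_def h_def)
qed

text \<open>\<open>\<rho> < n\<^sup>-\<^sup>3\<close> makes the balls of radius \<open>\<rho> r\<close> around row centres fit into a row of height
  comparable to \<open>r\<close>.\<close>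

lemma small_ratio_le:
  assumes \<rho>: "0 < \<rho>" "\<rho> < 1 / real n ^ 3" and r: "0 < r" "r / 3 < real m / real m ^ q"
  shows "\<rho> * r \<le> ((real m - 1) / real m ^ 2) / real m ^ q"
proof -
  define x where "x = real m"
  have x: "2 \<le> x"
    using m_ge_2 by (simp add: x_def)
  have "(x + 1) ^ 3 \<le> real n ^ 3"
    using m_less_n by (intro power_mono) (auto simp: x_def)
  then have "\<rho> * (x + 1) ^ 3 \<le> \<rho> * real n ^ 3"
    using \<rho> by (intro mult_left_mono) auto
  also have "\<dots> \<le> 1"
    using \<rho> by (simp add: field_simps)
  finally have \<rho>1: "\<rho> * (x + 1) ^ 3 \<le> 1" .
  \<comment> \<open>The exponent 3 in the bound for \<rho> enters here, through \<rho> at most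
    \<open>1 / (m + 1) ^ 3\<close>; the factor 3 comes from measuring rows against
    \<open>r / 3\<close>. Expanded around \<open>x = 2\<close>, the difference has only positive
    coefficients.\<close>
  have "3 * x ^ 3 \<le> (x - 1) * (x + 1) ^ 3"
  proof -
    define y where "y = x - 2"
    have y: "0 \<le> y" "x = y + 2"
      using x by (auto simp: y_def)
    have "(x - 1) * (x + 1) ^ 3 - 3 * x ^ 3 = y ^ 4 + 7 * y ^ 3 + 18 * y ^ 2 + 18 * y + 3"
      unfolding y(2) by (simp add: power3_eq_cube power4_eq_xxxx power2_eq_square algebra_simps)
    then show ?thesis
      using y(1) by (smt (verit) zero_le_power)
  qed
  then have "\<rho> * (3 * x ^ 3) \<le> \<rho> * ((x - 1) * (x + 1) ^ 3)"
    using \<rho> by (intro mult_left_mono) auto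
  also have "\<dots> = (x - 1) * (\<rho> * (x + 1) ^ 3)"
    by (simp add: mult_ac)
  also have "\<dots> \<le> (x - 1) * 1"
    using \<rho>1 x by (intro mult_left_mono) auto
  finally have *: "\<rho> * (3 * x) \<le> (x - 1) / x ^ 2"
    using x by (simp add: field_simps power2_eq_square power3_eq_cube)
  have "\<rho> * r \<le> \<rho> * (3 * x / real m ^ q)"
    using \<rho> r by (intro mult_left_mono) (auto simp: x_def mult.commute)
  also have "\<dots> = \<rho> * (3 * x) / real m ^ q"
    by simp
  also have "\<dots> \<le> ((x - 1) / x ^ 2) / real m ^ q"
    using * by (intro divide_right_mono) auto
  finally show ?thesis
    by (simp add: x_def)
qed

text \<open>The row centre is within \<open>2 * r / 3\<close> of \<open>z\<close>, and the small
  radius is at most \<open>r / 27\<close>; the sum stays below \<open>3 / 4 * r\<close>. The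
  remaining quarter of the radius is reserved for displacing the centre of the large ball in
  \<open>ex_comparable_ball\<close>.\<close>

lemma ex_ball_in_row:
  assumes fib: "0 < fiber 0" "0 < fiber (m - 1)" and \<rho>: "0 < \<rho>" "\<rho> < 1 / real n ^ 3"
  shows "\<exists>C>0. \<forall>q w z r. codes w z \<longrightarrow> 0 < r \<longrightarrow> 1 / real m ^ q \<le> r / 3 \<longrightarrow> r / 3 < real m / real m ^ q \<longrightarrow>
    (\<exists>z'\<in>E. dist z z' + \<rho> * r < 3 / 4 * r \<and> measure M (ball z' (\<rho> * r) \<inter> E) \<le> C * rect_measure w q)"
proof -
  obtain C where C: "C > 0" "\<And>q w z t. (\<forall>i<q. w i \<in> D) \<Longrightarrow> t \<le> ((real m - 1) / real m ^ 2) / real m ^ q \<Longrightarrow>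
    (\<forall>v\<in>words q. cylinder v q \<inter> ball z t \<noteq> {} \<longrightarrow> (\<forall>i<q. snd (v i) = snd (w i))) \<Longrightarrow>
    measure M (ball z t \<inter> E) \<le> C * rect_measure w q"
    using measure_le_rect_measure[of "(real m - 1) / real m ^ 2"] by blast
  have "\<exists>z'\<in>E. dist z z' + \<rho> * r < 3 / 4 * r \<and> measure M (ball z' (\<rho> * r) \<inter> E) \<le> C * rect_measure w q"
    if w: "codes w z" and r: "0 < r" "1 / real m ^ q \<le> r / 3" "r / 3 < real m / real m ^ q" for q w z r
  proof -
    obtain z' where z': "z' \<in> E" "dist z z' \<le> 2 / real m ^ q"
      "\<And>t. t \<le> ((real m - 1) / real m ^ 2) / real m ^ q \<Longrightarrow>
        (\<forall>v\<in>words q. cylinder v q \<inter> ball z' t \<noteq> {} \<longrightarrow> (\<forall>i<q. snd (v i) = snd (w i)))"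
      using ex_row_centre[OF fib w, of q] by blast
    note small = small_ratio_le[OF \<rho> r(1,3)]
    have "measure M (ball z' (\<rho> * r) \<inter> E) \<le> C * rect_measure w q"
      using w by (intro C(2) small z'(3)) (auto simp: codes_def)
    moreover have "dist z z' + \<rho> * r < 3 / 4 * r"
    proof -
      have "3 ^ 3 \<le> real n ^ 3"
        using n_ge_3 by (intro power_mono) auto
      then have "1 / real n ^ 3 \<le> 1 / 27"
        by (intro divide_left_mono) auto
      then have "\<rho> \<le> 1 / 27"
        using \<rho> by linarith
      then have "\<rho> * r \<le> 1 / 27 * r"
        using r by (intro mult_right_mono) auto
      moreover have "dist z z' \<le> 2 * (r / 3)"
        using z'(2) r(2) by simp
      ultimately show ?thesis
        using r(1) by linarith
    qed
    ultimately show ?thesis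
      using z'(1) by blast
  qed
  then show ?thesis
    using C(1) by blast
qed

text \<open>Idea: move from \<open>z'\<close> to the centre of its row. A fixed enlargement of the ball around \<open>z\<close>
  makes room for this even if that ball barely reaches the row of \<open>z'\<close>.\<close>

lemma ex_comparable_ball:
  assumes fib: "0 < fiber 0" "0 < fiber (m - 1)" and \<rho>: "0 < \<rho>" "\<rho> < 1 / real n ^ 3" and \<tau>: "0 < \<tau>"
  shows "\<exists>C>0. \<forall>z z' s. z' \<in> E \<longrightarrow> s \<le> 3 / 4 \<longrightarrow> dist z z' < s \<longrightarrow>
    (\<exists>z''\<in>E. ball z'' (\<rho> * (4 * s)) \<subseteq> ball z (4 * s) \<and>
      measure M (ball z'' (\<rho> * (4 * s)) \<inter> E) \<le> C * measure M (ball z' (\<tau> * s) \<inter> E))"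
proof -
  obtain C where C: "C > 0" "\<And>q w z r. codes w z \<Longrightarrow> 0 < r \<Longrightarrow> 1 / real m ^ q \<le> r / 3 \<Longrightarrow>
    r / 3 < real m / real m ^ q \<Longrightarrow>
    (\<exists>z'\<in>E. dist z z' + \<rho> * r < 3 / 4 * r \<and> measure M (ball z' (\<rho> * r) \<inter> E) \<le> C * rect_measure w q)"
    using ex_ball_in_row[OF fib \<rho>] by blast
  obtain C' where C': "C' > 0" "\<And>q w z t. codes w z \<Longrightarrow> 0 < t \<Longrightarrow> 1 / real m ^ q \<le> 4 / 3 / \<tau> * t \<Longrightarrow>
    rect_measure w q \<le> C' * measure M (ball z t \<inter> E)"
    using rect_measure_le_ball[of "4 / 3 / \<tau>"] by blast
  have "\<exists>z''\<in>E. ball z'' (\<rho> * (4 * s)) \<subseteq> ball z (4 * s) \<and>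
      measure M (ball z'' (\<rho> * (4 * s)) \<inter> E) \<le> (C * C') * measure M (ball z' (\<tau> * s) \<inter> E)"
    if z': "z' \<in> E" and s: "s \<le> 3 / 4" and zz': "dist z z' < s" for z z' s
  proof -
    have s0: "0 < s"
      using zz' zero_le_dist[of z z'] by linarith
    \<comment> \<open>The bound on \<open>s\<close> keeps this length at most 1. Of the radius
      \<open>4 * s\<close>, one part \<open>s\<close> covers the way from \<open>z\<close> to
      \<open>z'\<close>, and three parts contain the small ball around the row centre.\<close>
    obtain q where q: "1 / real m ^ q \<le> 4 * s / 3" "4 * s / 3 < real m / real m ^ q"
      using power_scale_below[OF m_ge_2, of "4 * s / 3"] s s0 by auto
    obtain w where w: "codes w z'"
      using ex_codes[OF z'] ..
    obtain z'' where z'': "z'' \<in> E" "dist z' z'' + \<rho> * (4 * s) < 3 / 4 * (4 * s)"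
      "measure M (ball z'' (\<rho> * (4 * s)) \<inter> E) \<le> C * rect_measure w q"
      using C(2)[OF w, of "4 * s" q] q s0 by auto
    have "ball z'' (\<rho> * (4 * s)) \<subseteq> ball z (4 * s)"
    proof
      fix p assume "p \<in> ball z'' (\<rho> * (4 * s))"
      moreover have "dist z p \<le> dist z z' + dist z' z'' + dist z'' p"
        using dist_triangle[of z p z'] dist_triangle[of z' p z''] by linarith
      ultimately show "p \<in> ball z (4 * s)"
        using z''(2) zz' by simp
    qed
    moreover have "measure M (ball z'' (\<rho> * (4 * s)) \<inter> E) \<le> (C * C') * measure M (ball z' (\<tau> * s) \<inter> E)"
    proof -
      have "rect_measure w q \<le> C' * measure M (ball z' (\<tau> * s) \<inter> E)"
        using q s0 \<tau> by (intro C'(2)[OF w]) auto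
      then have "C * rect_measure w q \<le> C * (C' * measure M (ball z' (\<tau> * s) \<inter> E))"
        using C(1) by (intro mult_left_mono) auto
      then show ?thesis
        using z''(3) by simp
    qed
    ultimately show ?thesis
      using z''(1) by blast
  qed
  then show ?thesis
    using C(1) C'(1) by (intro exI[of _ "C * C'"]) auto
qed

end

section \<open>The vertical set and the doubling behaviour of single points\<close>

text \<open>A gauge-free property: the lower limit of the ratios is finite. Arbitrarily small radii
  suffice because, off the vertical set, balls meeting a single row are found at infinitely many
  scales but not necessarily at all of them.\<close>

definition doubling_along_scales :: "'a::metric_space set \<Rightarrow> 'a measure \<Rightarrow> real \<Rightarrow> 'a \<Rightarrow> bool" where
  "doubling_along_scales X M \<rho> z \<longleftrightarrow>
     (\<exists>B. \<forall>\<delta>>0. \<exists>r. 0 < r \<and> r < \<delta> \<and>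
        (\<forall>z'\<in>X. ball_in X z' (\<rho> * r) \<subseteq> ball_in X z r \<longrightarrow>
           measure M (ball_in X z r) \<le> B * measure M (ball_in X z' (\<rho> * r))))"

context carpet
begin

text \<open>The cylinders of level \<open>q\<close> in other rows form a finite union of closed
  sets. If \<open>z\<close> belonged to one of them, prolonging its word to a coding would place
  \<open>z\<close> in the vertical set.\<close>

lemma not_vertical_isolated:
  assumes w: "codes w z" and z: "z \<notin> vertical_set n m D E"
  shows "\<exists>\<epsilon>>0. \<forall>v\<in>words q. cylinder v q \<inter> ball z \<epsilon> \<noteq> {} \<longrightarrow> (\<forall>i<q. snd (v i) = snd (w i))"
proof -
  define U where "U = (\<Union>v\<in>{v \<in> words q. \<not> (\<forall>i<q. snd (v i) = snd (w i))}. cylinder v q)"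
  have "closed U"
    unfolding U_def by (intro closed_UN) (auto intro: cylinder_closed)
  moreover have "z \<notin> U"
  proof
    assume "z \<in> U"
    then obtain v where v: "v \<in> words q" "z \<in> cylinder v q" "\<not> (\<forall>i<q. snd (v i) = snd (w i))"
      by (auto simp: U_def)
    obtain w' where w': "codes w' z" "\<forall>i<q. w' i = v i"
      using ex_codes_prepend[OF v(2)] words_in_D[OF v(1)] by blast
    have "snd \<circ> w \<noteq> snd \<circ> w'"
      using v(3) w'(2) by (metis comp_apply)
    then have "z \<in> vertical_set n m D E"
      using w w' codes_imp_E unfolding vertical_set_def is_coding_iff_codes by blast
    then show False
      using z by simp
  qed
  ultimately obtain \<epsilon> where "\<epsilon> > 0" "ball z \<epsilon> \<subseteq> - U"
    using openE[of "- U" z] by (auto simp: open_Compl)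
  then show ?thesis
    unfolding U_def by blast
qed

text \<open>If the row digits are not eventually constant \<open>0\<close> or \<open>m - 1\<close>, then \<open>z\<close> is far from the row
  boundaries at infinitely many levels; otherwise \<open>z\<close> lies on a row boundary with no point of the
  carpet nearby on the other side.\<close>

lemma not_vertical_single_row:
  assumes w: "codes w z" and z: "z \<notin> vertical_set n m D E"
  shows "\<exists>q\<ge>Q. \<forall>v\<in>words q. cylinder v q \<inter> ball z (1 / real m ^ (q + 2)) \<noteq> {} \<longrightarrow> (\<forall>i<q. snd (v i) = snd (w i))"
proof -
  define y where "y i = snd (w i)" for i
  have wD: "w i \<in> D" for i
    using w by (simp add: codes_def)
  have ym: "y i < m" for i
    using digit_less[OF wD] by (simp add: y_def)
  have m4: "4 \<le> m * m"
    using mult_le_mono[OF m_ge_2 m_ge_2] by simp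
  have near: "row_index m v q * (m * m) < row_index m w (q + 2) + 2"
    "row_index m w (q + 2) < (row_index m v q + 1) * (m * m) + 1"
    if p: "p \<in> cylinder v q" "p \<in> ball z (1 / real m ^ (q + 2))" for p v q
  proof -
    have "\<bar>snd z - snd p\<bar> < 1 / real m ^ (q + 2)"
      using snd_diff_le_dist[of z p] p(2) by simp
    then have 1: "\<bar>snd z * real m ^ (q + 2) - snd p * real m ^ (q + 2)\<bar> < 1"
      by (simp add: abs_mult flip: left_diff_distrib) (simp add: field_simps)
    have "z \<in> cylinder w (q + 2)"
      using w by (simp add: codes_def)
    from cylinder_bounds(3,4)[OF this] have 2: "real (row_index m w (q + 2)) \<le> snd z * real m ^ (q + 2)"
      "snd z * real m ^ (q + 2) \<le> real (row_index m w (q + 2)) + 1"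
      by (simp_all only: pos_divide_le_eq pos_le_divide_eq zero_less_power of_nat_0_less_iff pos)
    have "real (row_index m v q) \<le> snd p * real m ^ q" "snd p * real m ^ q \<le> real (row_index m v q) + 1"
      using cylinder_bounds(3,4)[OF p(1)] by (simp_all add: field_simps)
    then have "real (row_index m v q) * real (m * m) \<le> snd p * real m ^ q * real (m * m)"
      "snd p * real m ^ q * real (m * m) \<le> (real (row_index m v q) + 1) * real (m * m)"
      by (intro mult_right_mono; simp)+
    then have 3: "real (row_index m v q) * real (m * m) \<le> snd p * real m ^ (q + 2)"
      "snd p * real m ^ (q + 2) \<le> (real (row_index m v q) + 1) * real (m * m)"
      by (simp_all add: power_add power2_eq_square mult_ac)
    have "real (row_index m v q) * real (m * m) < real (row_index m w (q + 2)) + 2"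
      "real (row_index m w (q + 2)) < (real (row_index m v q) + 1) * real (m * m) + 1"
      using 1 2 3 by linarith+
    then have "real (row_index m v q * (m * m)) < real (row_index m w (q + 2) + 2)"
      "real (row_index m w (q + 2)) < real ((row_index m v q + 1) * (m * m) + 1)"
      unfolding of_nat_mult of_nat_add of_nat_1 of_nat_numeral .
    then show "row_index m v q * (m * m) < row_index m w (q + 2) + 2"
      "row_index m w (q + 2) < (row_index m v q + 1) * (m * m) + 1"
      unfolding of_nat_less_iff .
  qed
  have step: "row_index m w (q + 2) = m * m * row_index m w q + (m * y q + y (q + 1))" for q
    by (simp add: y_def algebra_simps)
  have le_digits: "row_index m v q \<le> row_index m w q"
    if "p \<in> cylinder v q" "p \<in> ball z (1 / real m ^ (q + 2))" "m * y q + y (q + 1) + 2 \<le> m * m" for p v q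
  proof (rule ccontr)
    assume "\<not> ?thesis"
    then have "(row_index m w q + 1) * (m * m) \<le> row_index m v q * (m * m)"
      by (intro mult_le_mono1) simp
    then show False
      using near(1)[OF that(1,2)] that(3) unfolding step by (simp add: algebra_simps)
  qed
  have ge_digits: "row_index m w q \<le> row_index m v q"
    if "p \<in> cylinder v q" "p \<in> ball z (1 / real m ^ (q + 2))" "1 \<le> m * y q + y (q + 1)" for p v q
  proof (rule ccontr)
    assume "\<not> ?thesis"
    then have "(row_index m v q + 1) * (m * m) \<le> row_index m w q * (m * m)"
      by (intro mult_le_mono1) simp
    then show False
      using near(2)[OF that(1,2)] that(3) unfolding step by (simp add: algebra_simps)
  qed
  have concl: ?thesis if "Q \<le> q" and
    le: "\<And>v p. v \<in> words q \<Longrightarrow> p \<in> cylinder v q \<Longrightarrow> p \<in> ball z (1 / real m ^ (q + 2)) \<Longrightarrow>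
      row_index m v q = row_index m w q" for q
  proof (intro exI[of _ q] conjI ballI impI)
    fix v assume v: "v \<in> words q" "cylinder v q \<inter> ball z (1 / real m ^ (q + 2)) \<noteq> {}"
    then obtain p where "p \<in> cylinder v q" "p \<in> ball z (1 / real m ^ (q + 2))"
      by blast
    then have "row_index m v q = row_index m w q"
      by (rule le[OF v(1)])
    then show "\<forall>i<q. snd (v i) = snd (w i)"
      using row_index_eq_iff[of q v w] wD words_in_D[OF v(1)] by simp
  qed (rule that(1))
  \<comment> \<open>Two digits 0 put \<open>z\<close> into the lowest, two digits
    \<open>m - 1\<close> into the highest of the \<open>m * m\<close> subrows of its row. In every
    other case a full subrow separates \<open>z\<close> from either boundary, which is why the
    radius is \<open>1 / real m ^ (q + 2)\<close>.\<close>
  define interior where "interior q \<longleftrightarrow> \<not> (y q = 0 \<and> y (q + 1) = 0) \<and> \<not> (y q = m - 1 \<and> y (q + 1) = m - 1)" for q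
  show ?thesis
  proof (cases "\<exists>q\<ge>Q. interior q")
    case True
    then obtain q where q: "Q \<le> q" "interior q"
      by blast
    have "1 \<le> m * y q + y (q + 1)"
      using q(2) by (auto simp: interior_def Suc_le_eq)
    moreover have "m * y q + y (q + 1) + 2 \<le> m * m"
    proof (cases "y q = m - 1")
      case True
      then have "y (q + 1) + 2 \<le> m"
        using q(2) ym[of "q + 1"] by (auto simp: interior_def)
      moreover have "m * (y q + 1) = m * m"
        using True by simp
      then have "m * m = m * y q + m"
        by (simp only: distrib_left mult_1_right)
      ultimately show ?thesis
        by simp
    next
      case False
      then have "y q + 2 \<le> m"
        using ym[of q] by simp
      then have "m * (y q + 2) \<le> m * m"
        by (rule mult_le_mono2)
      then show ?thesis
        using ym[of "q + 1"] m_ge_2 by (simp add: algebra_simps)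
    qed
    ultimately show ?thesis
      by (intro concl[OF q(1)] antisym) (auto intro: le_digits ge_digits)
  next
    case False
    obtain \<epsilon> where \<epsilon>: "\<epsilon> > 0" "\<And>v. v \<in> words Q \<Longrightarrow> cylinder v Q \<inter> ball z \<epsilon> \<noteq> {} \<Longrightarrow> (\<forall>i<Q. snd (v i) = snd (w i))"
      using not_vertical_isolated[OF w z, of Q] by blast
    obtain j0 where j0: "(1 / real m) ^ j0 < \<epsilon>"
      using real_arch_pow_inv[OF \<epsilon>(1), of "1 / real m"] m_ge_2 by auto
    \<comment> \<open>Deep enough for the ball to lie inside the isolating ball of level
      \<open>Q\<close>; every row met at level \<open>q\<close> then has the same first
      \<open>Q\<close> digits as \<open>w\<close>.\<close>
    define q where "q = Q + j0"
    have "1 / real m ^ (q + 2) \<le> 1 / real m ^ j0"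
      using m_ge_2 by (intro divide_left_mono power_increasing) (auto simp: q_def)
    then have sub: "ball z (1 / real m ^ (q + 2)) \<subseteq> ball z \<epsilon>"
      using j0 by (intro subset_ball) (simp add: power_one_over)
    have prefix: "row_index m v Q = row_index m w Q"
      if v: "v \<in> words q" "p \<in> cylinder v q" "p \<in> ball z (1 / real m ^ (q + 2))" for v p
    proof -
      have vD: "v i \<in> D" if "i < q" for i
        using words_in_D[OF v(1) that] .
      have "p \<in> cylinder v Q"
        using v(2) cylinder_antimono[of Q q v] vD by (auto simp: q_def)
      then have meets: "cylinder (restrict v {..<Q}) Q \<inter> ball z \<epsilon> \<noteq> {}"
        using v(3) sub unfolding cylinder_restrict by blast
      have "restrict v {..<Q} \<in> words Q"
        using vD by (intro restrict_in_words) (simp add: q_def)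
      from \<epsilon>(2)[OF this meets] have "\<forall>i<Q. snd (restrict v {..<Q} i) = snd (w i)" .
      then show ?thesis
        by (intro digit_number_cong) simp
    qed
    have const: "y i = y Q" if "Q \<le> i" for i
      using that
    proof (induction i rule: dec_induct)
      case (step i)
      then show ?case
        using False by (auto simp: interior_def)
    qed simp
    have end_digit: "y Q = 0 \<or> y Q = m - 1"
      using False by (auto simp: interior_def)
    show ?thesis
    proof (cases "y Q = 0")
      case True
      \<comment> \<open>The row of \<open>z\<close> is the lowest one with its prefix of length
        \<open>Q\<close>. Rows above are too far away, and rows below would have another
        prefix.\<close>
      have w0: "row_index m w (Q + j) = m ^ j * row_index m w Q" for j
        using const[of "Q + j" for j] True by (induction j) (simp_all add: y_def)
      have "row_index m v q = row_index m w q"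
        if v: "v \<in> words q" "p \<in> cylinder v q" "p \<in> ball z (1 / real m ^ (q + 2))" for v p
      proof (rule antisym)
        show "row_index m v q \<le> row_index m w q"
          using const[of q] const[of "q + 1"] True m4 by (intro le_digits[OF v(2,3)]) (simp add: q_def)
        show "row_index m w q \<le> row_index m v q"
          using digit_number_prefix_le[of m j0 "\<lambda>i. snd (v i)" Q] prefix[OF v] w0[of j0] by (simp add: q_def)
      qed
      then show ?thesis
        by (intro concl[of q]) (auto simp: q_def)
    next
      case False
      then have top: "y i = m - 1" if "Q \<le> i" for i
        using const[OF that] end_digit by simp
      \<comment> \<open>The mirror image: the row of \<open>z\<close> is the highest one with its
        prefix.\<close>
      have w1: "row_index m w (Q + j) + 1 = m ^ j * (row_index m w Q + 1)" for j
      proof (induction j)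
        case (Suc j)
        have "row_index m w (Q + Suc j) + 1 = m * row_index m w (Q + j) + (m - 1) + 1"
          using top[of "Q + j"] by (simp add: y_def)
        also have "\<dots> = m * (row_index m w (Q + j) + 1)"
          using m_ge_2 by simp
        finally show ?case
          using Suc by (simp only: mult.assoc power_Suc)
      qed simp
      have "row_index m v q = row_index m w q"
        if v: "v \<in> words q" "p \<in> cylinder v q" "p \<in> ball z (1 / real m ^ (q + 2))" for v p
      proof (rule antisym)
        have "snd (v i) < m" if "i < Q + j0" for i
          using digit_less(2)[OF words_in_D[OF v(1)]] that by (simp add: q_def)
        then show "row_index m v q \<le> row_index m w q"
          using digit_number_prefix_ge[of Q j0 "\<lambda>i. snd (v i)" m] prefix[OF v] w1[of j0] by (simp add: q_def)
        show "row_index m w q \<le> row_index m v q"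
          using top[of q] top[of "q + 1"] m_ge_2 by (intro ge_digits[OF v(2,3)]) (simp add: q_def)
      qed
      then show ?thesis
        by (intro concl[of q]) (auto simp: q_def)
    qed
  qed
qed

text \<open>At a scale where the ball meets a single row, the ball and all smaller balls centred in
  it are compared with one and the same rectangle mass: from above for the large ball, from below
  for the small ones.\<close>

lemma not_vertical_imp_doubling_along_scales:
  assumes "z \<in> E" and z: "z \<notin> vertical_set n m D E" and \<rho>: "0 < \<rho>"
  shows "doubling_along_scales E M \<rho> z"
proof -
  obtain w where w: "codes w z"
    using ex_codes[OF assms(1)] ..
  have wD: "w i \<in> D" for i
    using w by (simp add: codes_def)
  obtain C where C: "C > 0" "\<And>q w z t. (\<forall>i<q. w i \<in> D) \<Longrightarrow> t \<le> (1 / real m ^ 2) / real m ^ q \<Longrightarrow>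
    (\<forall>v\<in>words q. cylinder v q \<inter> ball z t \<noteq> {} \<longrightarrow> (\<forall>i<q. snd (v i) = snd (w i))) \<Longrightarrow>
    measure M (ball z t \<inter> E) \<le> C * rect_measure w q"
    using measure_le_rect_measure[of "1 / real m ^ 2"] by blast
  obtain C' where C': "C' > 0" "\<And>q w z t. codes w z \<Longrightarrow> 0 < t \<Longrightarrow> 1 / real m ^ q \<le> real m ^ 2 / \<rho> * t \<Longrightarrow>
    rect_measure w q \<le> C' * measure M (ball z t \<inter> E)"
    using rect_measure_le_ball[of "real m ^ 2 / \<rho>"] by blast
  have "\<exists>r. 0 < r \<and> r < \<delta> \<and> (\<forall>z'\<in>E. ball_in E z' (\<rho> * r) \<subseteq> ball_in E z r \<longrightarrow>
      measure M (ball_in E z r) \<le> (C * C') * measure M (ball_in E z' (\<rho> * r)))" if \<delta>: "\<delta> > 0" for \<delta>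
  proof -
    obtain Q where Q: "(1 / real m) ^ Q < \<delta>"
      using real_arch_pow_inv[OF \<delta>, of "1 / real m"] m_ge_2 by auto
    obtain q where q: "Q \<le> q"
      "\<And>v. v \<in> words q \<Longrightarrow> cylinder v q \<inter> ball z (1 / real m ^ (q + 2)) \<noteq> {} \<Longrightarrow> (\<forall>i<q. snd (v i) = snd (w i))"
      using not_vertical_single_row[OF w z, of Q] by blast
    define r where "r = 1 / real m ^ (q + 2)"
    have r: "0 < r"
      by (simp add: r_def)
    have "r \<le> (1 / real m) ^ Q"
      using q(1) m_ge_2 unfolding r_def power_one_over by (intro divide_left_mono power_increasing) auto
    then have "r < \<delta>"
      using Q by simp
    moreover have "measure M (ball_in E z r) \<le> (C * C') * measure M (ball_in E z' (\<rho> * r))"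
      if z': "z' \<in> E" "ball_in E z' (\<rho> * r) \<subseteq> ball_in E z r" for z'
    proof -
      have "z' \<in> ball_in E z' (\<rho> * r)"
        using z'(1) \<rho> r by (simp add: ball_in_def)
      from subsetD[OF z'(2) this] have "z' \<in> ball z r"
        by (simp add: ball_in_def)
      obtain w' where w': "codes w' z'"
        using ex_codes[OF z'(1)] ..
      have meets: "cylinder (restrict w' {..<q}) q \<inter> ball z (1 / real m ^ (q + 2)) \<noteq> {}"
        using w' \<open>z' \<in> ball z r\<close> unfolding cylinder_restrict codes_def r_def by blast
      have "restrict w' {..<q} \<in> words q"
        using w' by (intro restrict_in_words) (simp add: codes_def)
      from q(2)[OF this meets] have "\<forall>i<q. snd (restrict w' {..<q} i) = snd (w i)" .
      then have eq: "rect_measure w q = rect_measure w' q"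
        by (intro rect_measure_cong) auto
      have "measure M (ball z r \<inter> E) \<le> C * rect_measure w q"
        using wD q(2) by (intro C(2)) (auto simp: r_def power_add power2_eq_square mult_ac)
      also have "rect_measure w q \<le> C' * measure M (ball z' (\<rho> * r) \<inter> E)"
        unfolding eq using \<rho> r by (intro C'(2)[OF w']) (auto simp: r_def power_add power2_eq_square)
      then have "C * rect_measure w q \<le> C * (C' * measure M (ball z' (\<rho> * r) \<inter> E))"
        using C(1) by simp
      finally show ?thesis
        by (simp add: ball_in_def)
    qed
    ultimately show ?thesis
      using r by blast
  qed
  then show ?thesis
    unfolding doubling_along_scales_def by blast
qed

text \<open>The two expansions of an m-adic rational. As \<open>z\<close> lies in the cylinders of
  both codings, the row numbers differ by at most one at every level. After the first different
  digit they differ by exactly one, and this persists only if the lower sequence goes on with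
  \<open>m - 1\<close> and the upper one with 0.\<close>

lemma distinct_row_codings:
  assumes w: "codes w z" "codes w' z" and eq: "\<And>i. i < p \<Longrightarrow> snd (w i) = snd (w' i)"
    and less: "snd (w p) < snd (w' p)" and "p < q"
  shows "snd (w q) = m - 1 \<and> snd (w' q) = 0"
proof -
  have le: "row_index m w' k \<le> row_index m w k + 1" for k
  proof -
    have "z \<in> cylinder w k" "z \<in> cylinder w' k"
      using w by (auto simp: codes_def)
    then show ?thesis
      using row_neighbour[of z w' k z w] by simp
  qed
  have step: "row_index m w' (Suc k) = m * row_index m w' k + snd (w' k)"
    "row_index m w (Suc k) = m * row_index m w k + snd (w k)" for k
    by auto
  have lt: "snd (w k) < m" "snd (w' k) < m" for k
    using w digit_less(2) by (auto simp: codes_def)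
  have eq1: "row_index m w' k = row_index m w k + 1" if "Suc p \<le> k" for k
    using that
  proof (induction k rule: dec_induct)
    case base
    have "row_index m w' p = row_index m w p"
      using eq by (intro digit_number_cong) simp
    then show ?case
      using le[of "Suc p"] less by simp
  next
    case (step k)
    have "row_index m w (Suc k) + 1 \<le> row_index m w' (Suc k)"
      using step lt(1)[of k] by simp
    then show ?case
      using le[of "Suc k"] by simp
  qed
  show ?thesis
    using eq1[of q] eq1[of "Suc q"] lt[of q] \<open>p < q\<close> by (simp add: algebra_simps)
qed

lemma vertical_imp_not_doubling_along_scales:
  assumes fib: "0 < fiber 0" "0 < fiber (m - 1)" "fiber 0 \<noteq> fiber (m - 1)"
    and z: "z \<in> vertical_set n m D E" and \<rho>: "0 < \<rho>" "\<rho> < 1 / real n ^ 3"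
  shows "\<not> doubling_along_scales E M \<rho> z"
proof
  assume "doubling_along_scales E M \<rho> z"
  then obtain B where B: "\<And>\<delta>. \<delta> > 0 \<Longrightarrow> \<exists>r. 0 < r \<and> r < \<delta> \<and> (\<forall>z'\<in>E. ball_in E z' (\<rho> * r) \<subseteq> ball_in E z r \<longrightarrow>
      measure M (ball_in E z r) \<le> B * measure M (ball_in E z' (\<rho> * r)))"
    unfolding doubling_along_scales_def by blast
  obtain u u' p where u: "codes u z" "codes u' z" "\<And>q. p < q \<Longrightarrow> snd (u q) = m - 1 \<and> snd (u' q) = 0"
  proof -
    obtain w w' where w: "codes w z" "codes w' z" "snd \<circ> w \<noteq> snd \<circ> w'"
      using z by (auto simp: vertical_set_def is_coding_iff_codes)
    then have ex: "\<exists>i. snd (w i) \<noteq> snd (w' i)"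
      by (auto simp: fun_eq_iff)
    define p where "p = (LEAST i. snd (w i) \<noteq> snd (w' i))"
    have p: "snd (w p) \<noteq> snd (w' p)"
      using LeastI_ex[OF ex] by (simp add: p_def)
    have pre: "snd (w i) = snd (w' i)" if "i < p" for i
      using not_less_Least[OF that[unfolded p_def]] by simp
    show ?thesis
    proof (cases "snd (w p) < snd (w' p)")
      case True
      then show ?thesis
        using that[OF w(1,2)] distinct_row_codings[OF w(1,2) pre True] by blast
    next
      case False
      then have "snd (w' p) < snd (w p)"
        using p by simp
      then show ?thesis
        using that[OF w(2,1)] distinct_row_codings[OF w(2,1) pre[symmetric]] by blast
    qed
  qed
  \<comment> \<open>\<open>l\<close> is the coding whose tail runs through the lighter end fibre and
    \<open>h\<close> the one through the heavier. Which side of the boundary is heavier depends on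
    the carpet.\<close>
  obtain l h al ah where lh: "codes l z" "codes h z" "\<And>q. p < q \<Longrightarrow> fiber (snd (l q)) = al"
    "\<And>q. p < q \<Longrightarrow> fiber (snd (h q)) = ah" and a: "0 < al" "al < ah"
  proof (cases "fiber 0 < fiber (m - 1)")
    case True
    then show ?thesis
      using that[of u' u "fiber 0" "fiber (m - 1)"] u fib by simp
  next
    case False
    then show ?thesis
      using that[of u u' "fiber (m - 1)" "fiber 0"] u fib by simp
  qed
  obtain C where C: "C > 0" "\<And>q w z r. codes w z \<Longrightarrow> 0 < r \<Longrightarrow> 1 / real m ^ q \<le> r / 3 \<Longrightarrow>
    r / 3 < real m / real m ^ q \<Longrightarrow>
    (\<exists>z'\<in>E. dist z z' + \<rho> * r < 3 / 4 * r \<and> measure M (ball z' (\<rho> * r) \<inter> E) \<le> C * rect_measure w q)"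
    using ex_ball_in_row[OF fib(1,2) \<rho>] by blast
  obtain C' where C': "C' > 0" "\<And>q w z t. codes w z \<Longrightarrow> 0 < t \<Longrightarrow> 1 / real m ^ q \<le> 1 / 3 * t \<Longrightarrow>
    rect_measure w q \<le> C' * measure M (ball z t \<inter> E)"
    using rect_measure_le_ball[of "1 / 3"] by blast
  define K where "K = C' * (\<bar>B\<bar> * C)"
  have compare: "\<exists>q\<ge>Q. rect_measure h q \<le> K * rect_measure l q" for Q
  proof -
    have "0 < 1 / real m ^ Q"
      by simp
    from B[OF this] obtain r where r: "0 < r" "r < 1 / real m ^ Q"
      "\<And>z'. z' \<in> E \<Longrightarrow> ball_in E z' (\<rho> * r) \<subseteq> ball_in E z r \<Longrightarrow>
        measure M (ball_in E z r) \<le> B * measure M (ball_in E z' (\<rho> * r))"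
      by blast
    have "1 / real m ^ Q \<le> 1 / 1"
      using m_ge_2 by (intro divide_left_mono) auto
    then have "0 < r / 3" "r / 3 \<le> 1"
      using r(1,2) by linarith+
    then obtain q where q: "1 / real m ^ q \<le> r / 3" "r / 3 < real m / real m ^ q"
      by (rule power_scale_below[OF m_ge_2])
    have "1 / real m ^ q < 1 / real m ^ Q"
      using q(1) r by linarith
    then have "real m ^ Q < real m ^ q"
      by (simp add: field_simps)
    then have "Q \<le> q"
      using m_ge_2 by (simp add: power_less_imp_less_exp less_imp_le)
    obtain z' where z': "z' \<in> E" "dist z z' + \<rho> * r < 3 / 4 * r"
      "measure M (ball z' (\<rho> * r) \<inter> E) \<le> C * rect_measure l q"
      using C(2)[OF lh(1) r(1) q] by blast
    have "ball_in E z' (\<rho> * r) \<subseteq> ball_in E z r"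
    proof
      fix x assume "x \<in> ball_in E z' (\<rho> * r)"
      moreover have "dist z x \<le> dist z z' + dist z' x"
        by (rule dist_triangle)
      ultimately show "x \<in> ball_in E z r"
        using z'(2) r(1) by (simp add: ball_in_def)
    qed
    from r(3)[OF z'(1) this] have "measure M (ball z r \<inter> E) \<le> B * measure M (ball z' (\<rho> * r) \<inter> E)"
      by (simp add: ball_in_def)
    also have "\<dots> \<le> \<bar>B\<bar> * measure M (ball z' (\<rho> * r) \<inter> E)"
      by (intro mult_right_mono) auto
    also have "\<dots> \<le> \<bar>B\<bar> * (C * rect_measure l q)"
      using z'(3) by (intro mult_left_mono) auto
    finally have "C' * measure M (ball z r \<inter> E) \<le> C' * (\<bar>B\<bar> * (C * rect_measure l q))"
      using C'(1) by (intro mult_left_mono) auto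
    moreover have "rect_measure h q \<le> C' * measure M (ball z r \<inter> E)"
      using q(1) r(1) by (intro C'(2)[OF lh(2)]) auto
    ultimately have "rect_measure h q \<le> K * rect_measure l q"
      by (simp add: K_def mult_ac)
    then show ?thesis
      using \<open>Q \<le> q\<close> by blast
  qed
  \<comment> \<open>As soon as \<open>level q\<close> exceeds \<open>p\<close>, the weight involves
    only the constant tail and is a pure power with exponent \<open>q - level q\<close>, which is
    unbounded.\<close>
  have pow: "weight w k q = c ^ (q - k)" if "\<And>i. p < i \<Longrightarrow> fiber (snd (w i)) = c" "p < k" for w k q c
    using that by (simp add: weight_def)
  obtain g where g: "K < (real ah / real al) ^ g"
    using real_arch_pow[of "real ah / real al" K] a by auto
  have "\<forall>\<^sub>F q in sequentially. Suc p \<le> level q" "\<forall>\<^sub>F q in sequentially. g \<le> q - level q"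
    using column_level_at_top[OF m_ge_2 m_less_n] column_level_gap_at_top[OF m_ge_2 m_less_n]
    unfolding filterlim_at_top by blast+
  then have "\<forall>\<^sub>F q in sequentially. p < level q \<and> g \<le> q - level q"
    by eventually_elim simp
  then obtain Q where Q: "\<And>q. Q \<le> q \<Longrightarrow> p < level q \<and> g \<le> q - level q"
    by (auto simp: eventually_sequentially)
  obtain q where q: "Q \<le> q" "rect_measure h q \<le> K * rect_measure l q"
    using compare by blast
  note lev = Q[OF q(1)]
  have "real (ah ^ (q - level q)) \<le> K * real (al ^ (q - level q))"
    using q(2) lev pow[of h ah] pow[of l al] lh by (simp add: rect_measure_def divide_le_cancel)
  then have "(real ah / real al) ^ (q - level q) \<le> K"
    using a by (simp add: power_divide divide_le_eq)
  moreover have "(real ah / real al) ^ g \<le> (real ah / real al) ^ (q - level q)"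
    using a lev by (intro power_increasing) auto
  ultimately show False
    using g by linarith
qed

end

section \<open>Comparison of the Bernoulli measures of bi-Lipschitz equivalent carpets\<close>

context carpet
begin

section \<open>Approximate squares as cells, and their number\<close>

definition rows :: "nat set" where
  "rows = snd ` D"

text \<open>The rectangles of side about \<open>m\<^sup>-\<^sup>q\<close> inside the cylinder of the first \<open>j\<close> letters of \<open>u\<close>.
  Beyond position \<open>level q\<close> only the row digits count, and the column digits are set to \<open>0\<close>.\<close>

definition cells :: "(nat \<Rightarrow> nat \<times> nat) \<Rightarrow> nat \<Rightarrow> nat \<Rightarrow> (nat \<Rightarrow> nat \<times> nat) set" where
  "cells u j q = PiE {..<q} (\<lambda>i. if i < j then {u i} else if i < level q then D else Pair 0 ` rows)"

definition cell_total :: "nat \<Rightarrow> real" where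
  "cell_total q = real (card D ^ level q * card rows ^ (q - level q))"

text \<open>A cell forgets the column digits beyond \<open>level q\<close>, while a cylinder needs
  complete letters; hence the quantifier over words. A point on a grid line may lie in several
  cells.\<close>

definition in_cell :: "nat \<Rightarrow> (nat \<Rightarrow> nat \<times> nat) \<Rightarrow> real \<times> real \<Rightarrow> bool" where
  "in_cell q c z \<longleftrightarrow> (\<exists>v. (\<forall>i<q. v i \<in> D) \<and> z \<in> cylinder v q \<and>
     (\<forall>i<level q. v i = c i) \<and> (\<forall>i<q. snd (v i) = snd (c i)))"

lemma finite_rows [simp]: "finite rows"
  by (simp add: rows_def)

lemma cell_total_pos: "0 < cell_total q"
  using D_nonempty by (simp add: cell_total_def rows_def card_gt_0_iff)

lemma level_le [simp]: "level q \<le> q"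
  using column_level_le[OF m_ge_2 m_less_n] .

lemma finite_cells [simp]: "finite (cells u j q)"
  unfolding cells_def by (intro finite_PiE) auto

text \<open>The number does not depend on \<open>u\<close>: each word of length \<open>j\<close>
  owns the same share of all cells as of all words. The condition on \<open>j\<close> guarantees
  that a cell still records its first \<open>j\<close> letters completely.\<close>

lemma card_cells:
  assumes "j \<le> level q"
  shows "real (card (cells u j q)) * real (card D) ^ j = cell_total q"
proof -
  let ?f = "\<lambda>i. if i < j then 1 else if i < level q then card D else card rows"
  have "card (cells u j q) = (\<Prod>i<q. card (if i < j then {u i} else if i < level q then D else Pair (0::nat) ` rows))"
    unfolding cells_def by (rule card_PiE) simp
  also have "\<dots> = (\<Prod>i<q. ?f i)"
    by (intro prod.cong refl) (simp add: card_image inj_on_def)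
  also have "\<dots> = (\<Prod>i\<in>{0..<j}. ?f i) * (\<Prod>i\<in>{j..<q}. ?f i)"
    unfolding lessThan_atLeast0
    by (rule prod.atLeastLessThan_concat[symmetric]) (use order_trans[OF assms level_le] in auto)
  also have "(\<Prod>i\<in>{j..<q}. ?f i) = (\<Prod>i\<in>{j..<level q}. ?f i) * (\<Prod>i\<in>{level q..<q}. ?f i)"
    by (rule prod.atLeastLessThan_concat[symmetric]) (use assms in auto)
  also have "(\<Prod>i\<in>{0..<j}. ?f i) * \<dots> = 1 * (card D ^ (level q - j) * card rows ^ (q - level q))"
  proof -
    have "(\<Prod>i\<in>{0..<j}. ?f i) = (\<Prod>i\<in>{0..<j}. 1)"
      "(\<Prod>i\<in>{j..<level q}. ?f i) = (\<Prod>i\<in>{j..<level q}. card D)"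
      "(\<Prod>i\<in>{level q..<q}. ?f i) = (\<Prod>i\<in>{level q..<q}. card rows)"
      using assms by (auto intro!: prod.cong)
    then show ?thesis
      by simp
  qed
  finally have "card (cells u j q) * card D ^ j = card D ^ (level q - j + j) * card rows ^ (q - level q)"
    by (simp add: power_add)
  then have "real (card (cells u j q) * card D ^ j) = cell_total q"
    using assms by (simp add: cell_total_def)
  then show ?thesis
    by simp
qed

lemma cell_nonempty:
  assumes u: "u \<in> words j" and "j \<le> level q" and c: "c \<in> cells u j q"
  shows "\<exists>p\<in>cylinder u j. in_cell q c p"
proof -
  have "\<exists>d\<in>D. (i < j \<longrightarrow> d = u i) \<and> (i < level q \<longrightarrow> d = c i) \<and> snd d = snd (c i)" if "i < q" for i
  proof -
    note ci = PiE_mem[OF c[unfolded cells_def], of i]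
    consider "i < j" | "\<not> i < j" "i < level q" | "\<not> i < j" "\<not> i < level q"
      by blast
    then show ?thesis
    proof cases
      case 3
      then obtain d where "d \<in> D" "c i = (0, snd d)"
        using ci \<open>i < q\<close> by (auto simp: rows_def)
      then show ?thesis
        using 3 by (intro bexI[of _ d]) auto
    qed (use ci that words_in_D[OF u, of i] in auto)
  qed
  then obtain v where v: "\<And>i. i < q \<Longrightarrow> v i \<in> D \<and> (i < j \<longrightarrow> v i = u i) \<and> (i < level q \<longrightarrow> v i = c i) \<and> snd (v i) = snd (c i)"
    by metis
  obtain p where p: "p \<in> cylinder v q"
    using cylinder_nonempty[of v q] by blast
  have jq: "j \<le> q"
    using \<open>j \<le> level q\<close> level_le[of q] by linarith
  have "cylinder v q \<subseteq> cylinder v j"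
    using jq v by (intro cylinder_antimono) auto
  also have "cylinder v j = cylinder u j"
    using v jq by (intro cylinder_cong) auto
  finally show ?thesis
    using p v less_le_trans[OF _ level_le] unfolding in_cell_def by (intro bexI[of _ p] exI[of _ v]) auto
qed

lemma in_cell_imp_E: "in_cell q c p \<Longrightarrow> p \<in> E"
  unfolding in_cell_def using cylinder_subset_E by blast

lemma dist_same_cell:
  assumes "in_cell q c p" and "in_cell q c p'"
  shows "dist p p' \<le> (real n + 1) / real m ^ q"
proof -
  obtain v v' where v: "\<forall>i<q. v i \<in> D" "p \<in> cylinder v q" "\<forall>i<level q. v i = c i" "\<forall>i<q. snd (v i) = snd (c i)"
    and v': "\<forall>i<q. v' i \<in> D" "p' \<in> cylinder v' q" "\<forall>i<level q. v' i = c i" "\<forall>i<q. snd (v' i) = snd (c i)"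
    using assms unfolding in_cell_def by blast
  have "dist p p' \<le> 1 / real n ^ level q + 1 / real m ^ q"
  proof (rule dist_le_rectangle)
    show "p \<in> cylinder v (level q)" "p' \<in> cylinder v' (level q)"
      using v v' cylinder_antimono[of "level q" q] level_le by blast+
    show "column_index n v (level q) = column_index n v' (level q)"
      using v v' by (intro digit_number_cong) simp
    show "row_index m v q = row_index m v' q"
      using v v' by (intro digit_number_cong) simp
  qed (use v v' in auto)
  then show ?thesis
    using column_width_bounds(2)[OF m_ge_2 m_less_n, of q] by (simp add: add_divide_distrib)
qed

lemma cell_index_inj: "inj_on (\<lambda>c. (int (column_index n c (level q)), int (row_index m c q))) (cells u 0 q)"
proof (rule inj_onI)
  fix c c' assume c: "c \<in> cells u 0 q" "c' \<in> cells u 0 q"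
    and eq: "(int (column_index n c (level q)), int (row_index m c q)) = (int (column_index n c' (level q)), int (row_index m c' q))"
  have mem: "(i < level q \<longrightarrow> c i \<in> D) \<and> (\<not> i < level q \<longrightarrow> fst (c i) = 0) \<and> snd (c i) < m"
    if "c \<in> cells u 0 q" "i < q" for c i
    using PiE_mem[OF that(1)[unfolded cells_def], of i] that(2) digit_less by (auto simp: rows_def split: if_splits)
  have lq: "i < q" if "i < level q" for i
    using that level_le[of q] by linarith
  have "snd (c i) = snd (c' i)" if "i < q" for i
    using digit_number_inj[of m "\<lambda>i. snd (c i)" q "\<lambda>i. snd (c' i)"] eq mem[OF c(1)] mem[OF c(2)] that by simp
  moreover have "fst (c i) = fst (c' i)" if "i < q" for i
  proof (cases "i < level q")
    case True
    then show ?thesis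
      using column_index_eq_imp[of "level q" c c' i] eq mem[OF c(1)] mem[OF c(2)] lq by auto
  next
    case False
    then show ?thesis
      using mem[OF c(1) that] mem[OF c(2) that] by simp
  qed
  ultimately have "c i = c' i" if "i < q" for i
    using that by (simp add: prod_eq_iff)
  then show "c = c'"
    using c unfolding cells_def by (intro PiE_ext) auto
qed

text \<open>Columns are at least as wide as rows are high, so the distance \<open>R / m ^ q\<close>
  spans at most \<open>R\<close> of them. A closed window of half-width \<open>R\<close> meets at
  most \<open>2 * R + 2\<close> closed grid intervals in each direction. Integers are used because
  the window can reach below 0.\<close>

lemma card_near_cells:
  assumes Z: "Z \<subseteq> cells u 0 q"
    and near: "\<And>c. c \<in> Z \<Longrightarrow> \<exists>p'. in_cell q c p' \<and> dist p p' \<le> real R / real m ^ q"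
  shows "card Z \<le> (2 * R + 2)\<^sup>2"
proof -
  let ?k = "level q"
  let ?f = "\<lambda>c. (int (column_index n c ?k), int (row_index m c q))"
  let ?I = "\<lambda>a. {\<lceil>a\<rceil> - int R - 1..\<lceil>a\<rceil> + int R} :: int set"
  have card_I: "card (?I a) = 2 * R + 2" for a
    by (simp add: nat_eq_iff)
  have index: "int X \<in> ?I a" if "real X \<le> b" "b \<le> real X + 1" "\<bar>a - b\<bar> \<le> real R" for X a b
    using that by simp linarith
  have scale: "\<bar>a * c - b * c\<bar> \<le> e" if "\<bar>a - b\<bar> \<le> e / c" "0 < c" for a b c e :: real
  proof -
    have "\<bar>a * c - b * c\<bar> = \<bar>a - b\<bar> * c"
      using that(2) by (simp add: abs_mult flip: left_diff_distrib)
    then show ?thesis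
      using that by (simp add: pos_le_divide_eq)
  qed
  have "?f ` Z \<subseteq> ?I (fst p * real n ^ ?k) \<times> ?I (snd p * real m ^ q)"
  proof (intro image_subsetI SigmaI)
    fix c assume "c \<in> Z"
    then obtain v p' where v: "\<forall>i<q. v i \<in> D" "p' \<in> cylinder v q" "\<forall>i<?k. v i = c i" "\<forall>i<q. snd (v i) = snd (c i)"
      and d: "dist p p' \<le> real R / real m ^ q"
      using near[OF \<open>c \<in> Z\<close>] unfolding in_cell_def by blast
    have X: "column_index n c ?k = column_index n v ?k"
      using v by (intro digit_number_cong) simp
    have Y: "row_index m c q = row_index m v q"
      using v by (intro digit_number_cong) simp
    have "p' \<in> cylinder v ?k"
      using v cylinder_antimono[of ?k q] level_le by blast
    note b1 = cylinder_bounds(1,2)[OF this]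
    note b2 = cylinder_bounds(3,4)[OF v(2)]
    have "real R / real m ^ q \<le> real R / real n ^ ?k"
      using column_width_bounds(1)[OF m_ge_2 m_less_n, of q] mult_left_mono[of _ _ "real R"] by fastforce
    then have "\<bar>fst p - fst p'\<bar> \<le> real R / real n ^ ?k"
      using fst_diff_le_dist[of p p'] d by linarith
    then have "\<bar>fst p * real n ^ ?k - fst p' * real n ^ ?k\<bar> \<le> real R"
      by (rule scale) simp
    then show "int (column_index n c ?k) \<in> ?I (fst p * real n ^ ?k)"
      using b1 unfolding X by (intro index[of _ "fst p' * real n ^ ?k"]) (simp_all add: field_simps)
    have "\<bar>snd p - snd p'\<bar> \<le> real R / real m ^ q"
      using snd_diff_le_dist[of p p'] d by linarith
    then have "\<bar>snd p * real m ^ q - snd p' * real m ^ q\<bar> \<le> real R"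
      by (rule scale) simp
    then show "int (row_index m c q) \<in> ?I (snd p * real m ^ q)"
      using b2 unfolding Y by (intro index[of _ "snd p' * real m ^ q"]) (simp_all add: field_simps)
  qed
  then have "card (?f ` Z) \<le> card (?I (fst p * real n ^ ?k) \<times> ?I (snd p * real m ^ q))"
    by (intro card_mono) auto
  also have "\<dots> = (2 * R + 2)\<^sup>2"
    by (simp only: card_cartesian_product card_I power2_eq_square)
  finally show ?thesis
    using card_image[OF inj_on_subset[OF cell_index_inj Z]] by simp
qed

lemma cells_subset: "u \<in> words j \<Longrightarrow> j \<le> level q \<Longrightarrow> cells u j q \<subseteq> cells u' 0 q"
  unfolding cells_def by (intro PiE_mono) (auto intro: words_in_D)

lemma disjoint_cells:
  assumes "u \<in> words j" "u' \<in> words j" "u \<noteq> u'" "j \<le> q"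
  shows "cells u j q \<inter> cells u' j q = {}"
proof (rule ccontr)
  assume "cells u j q \<inter> cells u' j q \<noteq> {}"
  then obtain c where c: "c \<in> cells u j q" "c \<in> cells u' j q"
    by blast
  have "u i = u' i" if "i < j" for i
    using PiE_mem[OF c(1)[unfolded cells_def], of i] PiE_mem[OF c(2)[unfolded cells_def], of i] that \<open>j \<le> q\<close>
    by simp
  then have "u = u'"
    using assms(1,2) unfolding words_def by (intro PiE_ext) auto
  then show False
    using assms(3) by simp
qed

text \<open>Cells are counted as digit sequences, so those of distinct words are distinct even where
  the cylinders touch, and the numbers add up without loss.\<close>

lemma card_UN_cells:
  assumes "U \<subseteq> words j" and "j \<le> level q"
  shows "real (card (\<Union>u\<in>U. cells u j q)) = real (card U) / real (card D) ^ j * cell_total q"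
proof -
  have fin: "finite U"
    using assms(1) by (rule finite_subset) simp
  have jq: "j \<le> q"
    using assms(2) level_le[of q] by linarith
  have "real (card (\<Union>u\<in>U. cells u j q)) = (\<Sum>u\<in>U. real (card (cells u j q)))"
  proof (subst card_UN_disjoint)
    show "\<forall>i\<in>U. \<forall>j'\<in>U. i \<noteq> j' \<longrightarrow> cells i j q \<inter> cells j' j q = {}"
      using disjoint_cells[OF _ _ _ jq] assms(1) by blast
  qed (use fin in auto)
  also have "\<dots> = (\<Sum>u\<in>U. cell_total q / real (card D) ^ j)"
    using D_nonempty by (intro sum.cong refl) (simp add: eq_divide_eq card_cells[OF assms(2)])
  finally show ?thesis
    by simp
qed

end

lemma card_le_card_image_fibers:
  assumes "finite Z" and "\<And>b. b \<in> h ` Z \<Longrightarrow> card {c \<in> Z. h c = b} \<le> K"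
  shows "card Z \<le> K * card (h ` Z)"
proof -
  have "Z = (\<Union>b\<in>h ` Z. {c \<in> Z. h c = b})"
    by blast
  then have "card Z \<le> (\<Sum>b\<in>h ` Z. card {c \<in> Z. h c = b})"
    using card_UN_le[of "h ` Z" "\<lambda>b. {c \<in> Z. h c = b}"] assms(1) by simp
  also have "\<dots> \<le> (\<Sum>b\<in>h ` Z. K)"
    using assms(2) by (intro sum_mono)
  finally show ?thesis
    by (simp add: mult.commute)
qed

text \<open>The Bernoulli measure of a set is comparable to the proportion of the small cells that meet it,
  and a bi-Lipschitz map distorts numbers of cells by a bounded factor.\<close>

lemma cell_comparison:
  fixes g :: "real \<times> real \<Rightarrow> real \<times> real"
  assumes "carpet n m D E M" and "carpet n m D' F M'" and g: "g ` F \<subseteq> E"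
    and L: "\<And>p p'. p \<in> F \<Longrightarrow> p' \<in> F \<Longrightarrow> dist p p' \<le> L * dist (g p) (g p')"
  shows "\<exists>K>0. \<forall>A A' j q. A \<in> sets borel \<longrightarrow> A' \<in> sets borel \<longrightarrow> j \<le> column_level n m q \<longrightarrow>
    (\<forall>p\<in>F. \<forall>a\<in>A. dist a p \<le> 2 / real m ^ j \<longrightarrow>
      (\<forall>u\<in>carpet.words D j. g p \<in> carpet.cylinder n m E u j \<longrightarrow> carpet.cylinder n m E u j \<subseteq> A')) \<longrightarrow>
    measure M' A * carpet.cell_total n m D' q \<le> K * (measure M A' * carpet.cell_total n m D q)"
proof -
  interpret E: carpet n m D E M by fact
  interpret F: carpet n m D' F M' by fact
  \<comment> \<open>Cells of \<open>F\<close> whose sample points are mapped into the same cell of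
    \<open>E\<close> lie close together: \<open>(n + 1) / m ^ q\<close> bounds the diameter of a
    cell of \<open>E\<close>, and \<open>L\<close> bounds the expansion on the way back.\<close>
  define R where "R = nat \<lceil>\<bar>L\<bar> * (real n + 1)\<rceil>"
  have R: "\<bar>L\<bar> * (real n + 1) \<le> real R"
    by (simp add: R_def)
  have main: "measure M' A * F.cell_total q \<le> real ((2 * R + 2)\<^sup>2) * (measure M A' * E.cell_total q)"
    if A: "A \<in> sets borel" and A': "A' \<in> sets borel" and j: "j \<le> column_level n m q"
      and near: "\<And>p a u. p \<in> F \<Longrightarrow> a \<in> A \<Longrightarrow> dist a p \<le> 2 / real m ^ j \<Longrightarrow> u \<in> E.words j \<Longrightarrow>
        g p \<in> E.cylinder u j \<Longrightarrow> E.cylinder u j \<subseteq> A'" for A A' j q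
  proof -
    define U where "U = {u \<in> F.words j. F.cylinder u j \<inter> A \<noteq> {}}"
    define Z where "Z = (\<Union>u\<in>U. F.cells u j q)"
    define U' where "U' = {u \<in> E.words j. E.cylinder u j \<subseteq> A'}"
    define Z' where "Z' = (\<Union>u\<in>U'. E.cells u j q)"
    have U: "U \<subseteq> F.words j" "U' \<subseteq> E.words j"
      by (auto simp: U_def U'_def)
    have finZ: "finite Z" "finite Z'"
      unfolding Z_def Z'_def U_def U'_def by auto
    have "\<forall>c\<in>Z. \<exists>p. F.in_cell q c p \<and> (\<exists>a\<in>A. dist a p \<le> 2 / real m ^ j)"
    proof
      fix c assume "c \<in> Z"
      then obtain u where u: "u \<in> F.words j" "F.cylinder u j \<inter> A \<noteq> {}" "c \<in> F.cells u j q"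
        by (auto simp: Z_def U_def)
      obtain p where p: "p \<in> F.cylinder u j" "F.in_cell q c p"
        using F.cell_nonempty[OF u(1) j u(3)] by blast
      then show "\<exists>p. F.in_cell q c p \<and> (\<exists>a\<in>A. dist a p \<le> 2 / real m ^ j)"
        using u(2) F.dist_le_cylinder[OF _ p(1)] by blast
    qed
    then obtain pt where pt: "\<And>c. c \<in> Z \<Longrightarrow> F.in_cell q c (pt c) \<and> (\<exists>a\<in>A. dist a (pt c) \<le> 2 / real m ^ j)"
      by metis
    have ptF: "pt c \<in> F" if "c \<in> Z" for c
      using pt[OF that] F.in_cell_imp_E by blast
    have "\<forall>c\<in>Z. \<exists>b\<in>Z'. E.in_cell q b (g (pt c))"
    proof
      fix c assume c: "c \<in> Z"
      have "g (pt c) \<in> E"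
        using ptF[OF c] g by blast
      then obtain w where w: "E.codes w (g (pt c))"
        using E.ex_codes by blast
      then have wD: "w i \<in> D" for i
        by (simp add: E.codes_def)
      define u where "u = restrict w {..<j}"
      have u: "u \<in> E.words j"
        unfolding u_def using wD by (intro E.restrict_in_words)
      have "g (pt c) \<in> E.cylinder u j"
        using w by (simp add: u_def E.codes_def)
      then have "E.cylinder u j \<subseteq> A'"
        using near[OF ptF[OF c] _ _ u] pt[OF c] by blast
      then have "u \<in> U'"
        using u by (simp add: U'_def)
      \<comment> \<open>A cell containing \<open>g (pt c)\<close>, obtained from a coding by erasing
        the column digits beyond the level, in the normal form of \<open>cells\<close>.\<close>
      define b where "b = (\<lambda>i\<in>{..<q}. if i < column_level n m q then w i else (0, snd (w i)))"
      have "b \<in> E.cells u j q"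
        using j wD E.level_le[of q] unfolding E.cells_def b_def u_def
        by (auto simp: E.rows_def intro!: imageI)
      then have "b \<in> Z'"
        using \<open>u \<in> U'\<close> by (auto simp: Z'_def)
      moreover have "E.in_cell q b (g (pt c))"
        unfolding E.in_cell_def using w wD less_le_trans[OF _ E.level_le]
        by (intro exI[of _ w]) (auto simp: b_def E.codes_def)
      ultimately show "\<exists>b\<in>Z'. E.in_cell q b (g (pt c))"
        by blast
    qed
    then obtain h where h: "\<And>c. c \<in> Z \<Longrightarrow> h c \<in> Z' \<and> E.in_cell q (h c) (g (pt c))"
      by metis
    have Zsub: "Z \<subseteq> F.cells (\<lambda>_. undefined) 0 q"
      unfolding Z_def using U j F.cells_subset by blast
    have "card Z \<le> (2 * R + 2)\<^sup>2 * card (h ` Z)"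
    proof (rule card_le_card_image_fibers[OF finZ(1)])
      fix b assume "b \<in> h ` Z"
      then obtain c0 where c0: "c0 \<in> Z" "h c0 = b"
        by blast
      show "card {c \<in> Z. h c = b} \<le> (2 * R + 2)\<^sup>2"
      proof (rule F.card_near_cells)
        show "{c \<in> Z. h c = b} \<subseteq> F.cells (\<lambda>_. undefined) 0 q"
          using Zsub by blast
        fix c assume "c \<in> {c \<in> Z. h c = b}"
        then have c: "c \<in> Z" "h c = b"
          by auto
        have "dist (pt c0) (pt c) \<le> L * dist (g (pt c0)) (g (pt c))"
          using ptF c0 c by (intro L)
        also have "\<dots> \<le> \<bar>L\<bar> * dist (g (pt c0)) (g (pt c))"
          by (intro mult_right_mono) auto
        also have "\<dots> \<le> \<bar>L\<bar> * ((real n + 1) / real m ^ q)"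
          using h[OF c0(1)] h[OF c(1)] c0(2) c(2) by (intro mult_left_mono E.dist_same_cell[of q b]) auto
        also have "\<dots> \<le> real R / real m ^ q"
          using R by (simp add: divide_right_mono)
        finally show "\<exists>p'. F.in_cell q c p' \<and> dist (pt c0) p' \<le> real R / real m ^ q"
          using pt[OF c(1)] by blast
      qed
    qed
    also have "card (h ` Z) \<le> card Z'"
      using h finZ(2) by (intro card_mono) auto
    finally have "card Z \<le> (2 * R + 2)\<^sup>2 * card Z'"
      by simp
    then have ZZ': "real (card Z) \<le> real ((2 * R + 2)\<^sup>2) * real (card Z')"
      unfolding of_nat_mult[symmetric] of_nat_le_iff .
    \<comment> \<open>From here on shares of words of length \<open>j\<close> are exchanged for
      numbers of cells of scale \<open>q\<close> without loss, so \<open>q\<close> enters only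
      through the two totals.\<close>
    have "measure M' A * F.cell_total q \<le> real (card U) / real (card D') ^ j * F.cell_total q"
      using F.measure_le_card_words[OF A, of j] F.cell_total_pos[of q]
      by (intro mult_right_mono) (auto simp: U_def)
    also have "\<dots> = real (card Z)"
      unfolding Z_def F.card_UN_cells[OF U(1) j] ..
    also note ZZ'
    also have "real (card Z') = real (card U') / real (card D) ^ j * E.cell_total q"
      unfolding Z'_def E.card_UN_cells[OF U(2) j] ..
    also have "real ((2 * R + 2)\<^sup>2) * \<dots> \<le> real ((2 * R + 2)\<^sup>2) * (measure M A' * E.cell_total q)"
      using E.card_words_le_measure[OF A', of j] E.cell_total_pos[of q]
      by (intro mult_left_mono mult_right_mono) (auto simp: U'_def)
    finally show ?thesis .
  qed
  show ?thesis
  proof (intro exI[of _ "real ((2 * R + 2)\<^sup>2)"] conjI allI impI)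
    show "0 < real ((2 * R + 2)\<^sup>2)"
      by simp
  qed (rule main; blast)
qed

section \<open>From cells to measures of balls\<close>

lemma bi_lipschitz_onE:
  assumes "bi_lipschitz_on X f"
  obtains L where "1 \<le> L" "\<And>x y. x \<in> X \<Longrightarrow> y \<in> X \<Longrightarrow> dist (f x) (f y) \<le> L * dist x y"
    "\<And>x y. x \<in> X \<Longrightarrow> y \<in> X \<Longrightarrow> dist x y \<le> L * dist (f x) (f y)"
proof -
  obtain C where C: "C > 0" "\<And>x y. x \<in> X \<Longrightarrow> y \<in> X \<Longrightarrow> dist x y / C \<le> dist (f x) (f y) \<and> dist (f x) (f y) \<le> C * dist x y"
    using assms unfolding bi_lipschitz_on_def by blast
  show ?thesis
  proof (rule that[of "max 1 C"])
    fix x y assume xy: "x \<in> X" "y \<in> X"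
    have "C * dist x y \<le> max 1 C * dist x y" "C * dist (f x) (f y) \<le> max 1 C * dist (f x) (f y)"
      by (intro mult_right_mono; simp)+
    then show "dist (f x) (f y) \<le> max 1 C * dist x y" "dist x y \<le> max 1 C * dist (f x) (f y)"
      using C(2)[OF xy] C(1) by (auto simp: field_simps)
  qed simp
qed

lemma bi_lipschitz_on_inv_into:
  assumes "bi_lipschitz_on X f" and "bij_betw f X Y"
  shows "bi_lipschitz_on Y (inv_into X f)"
proof -
  obtain L where L: "1 \<le> L" "\<And>x y. x \<in> X \<Longrightarrow> y \<in> X \<Longrightarrow> dist (f x) (f y) \<le> L * dist x y"
    "\<And>x y. x \<in> X \<Longrightarrow> y \<in> X \<Longrightarrow> dist x y \<le> L * dist (f x) (f y)"
    using bi_lipschitz_onE[OF assms(1)] by blast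
  have inX: "inv_into X f y \<in> X" "f (inv_into X f y) = y" if "y \<in> Y" for y
    using that assms(2) by (auto simp: bij_betw_def inv_into_into f_inv_into_f)
  show ?thesis
    unfolding bi_lipschitz_on_def
  proof (intro exI[of _ L] conjI ballI)
    fix x y assume xy: "x \<in> Y" "y \<in> Y"
    show "dist x y / L \<le> dist (inv_into X f x) (inv_into X f y)"
      using L(2)[OF inX(1)[OF xy(1)] inX(1)[OF xy(2)]] L(1) inX(2) xy by (simp add: divide_le_eq mult.commute)
    show "dist (inv_into X f x) (inv_into X f y) \<le> L * dist x y"
      using L(3)[OF inX(1)[OF xy(1)] inX(1)[OF xy(2)]] inX(2) xy by simp
  qed (use L(1) in auto)
qed

text \<open>The case of the whole carpets: both measures are 1 at \<open>j = 0\<close>, so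
  \<open>cell_comparison\<close> leaves only the totals. As the bound is uniform in
  \<open>q\<close>, the totals can be cancelled in the comparison of balls.\<close>

lemma cell_total_comparison:
  assumes "carpet n m D E M" and "carpet n m D' F M'" and f: "f ` E \<subseteq> F" and lip: "bi_lipschitz_on E f"
  shows "\<exists>K>0. \<forall>q. carpet.cell_total n m D q \<le> K * carpet.cell_total n m D' q"
proof -
  interpret E: carpet n m D E M by fact
  interpret F: carpet n m D' F M' by fact
  obtain L where L: "\<And>x y. x \<in> E \<Longrightarrow> y \<in> E \<Longrightarrow> dist x y \<le> L * dist (f x) (f y)"
    using bi_lipschitz_onE[OF lip] by metis
  obtain K where K: "K > 0" "\<And>A A' j q. A \<in> sets borel \<Longrightarrow> A' \<in> sets borel \<Longrightarrow> j \<le> column_level n m q \<Longrightarrow>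
    (\<forall>p\<in>E. \<forall>a\<in>A. dist a p \<le> 2 / real m ^ j \<longrightarrow>
      (\<forall>u\<in>F.words j. f p \<in> F.cylinder u j \<longrightarrow> F.cylinder u j \<subseteq> A')) \<Longrightarrow>
    measure M A * E.cell_total q \<le> K * (measure M' A' * F.cell_total q)"
    using cell_comparison[OF F.carpet_axioms E.carpet_axioms f L] by blast
  have "E.cell_total q \<le> K * F.cell_total q" for q
    using K(2)[of E F 0 q] F.cylinder_subset_E[of 0] E.measure_E F.measure_E by simp
  then show ?thesis
    using K(1) by blast
qed

text \<open>The level \<open>j\<close> makes cylinders small compared with the ball, and
  \<open>q\<close> is any scale with \<open>j \<le> level q\<close>. Neither enters the constants,
  because the cell totals cancel.\<close>

lemma measure_comparison:
  assumes "carpet n m D E M" and "carpet n m D' F M'" and f: "bij_betw f E F" and lip: "bi_lipschitz_on E f"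
  shows "\<exists>C\<ge>1. \<forall>z\<in>E. \<forall>r. 0 < r \<longrightarrow> r \<le> 1 \<longrightarrow> measure M' (ball (f z) r \<inter> F) \<le> C * measure M (ball z (C * r) \<inter> E)"
proof -
  interpret E: carpet n m D E M by fact
  interpret F: carpet n m D' F M' by fact
  define g where "g = inv_into E f"
  have lip': "bi_lipschitz_on F g"
    unfolding g_def using bi_lipschitz_on_inv_into[OF lip f] .
  have g: "g ` F \<subseteq> E" "\<And>z. z \<in> E \<Longrightarrow> g (f z) = z"
    using f by (auto simp: g_def bij_betw_def inv_into_into)
  obtain L where L: "1 \<le> L" "\<And>x y. x \<in> F \<Longrightarrow> y \<in> F \<Longrightarrow> dist (g x) (g y) \<le> L * dist x y"
    "\<And>x y. x \<in> F \<Longrightarrow> y \<in> F \<Longrightarrow> dist x y \<le> L * dist (g x) (g y)"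
    using bi_lipschitz_onE[OF lip'] by metis
  obtain K where K: "K > 0" "\<And>A A' j q. A \<in> sets borel \<Longrightarrow> A' \<in> sets borel \<Longrightarrow> j \<le> column_level n m q \<Longrightarrow>
    (\<forall>p\<in>F. \<forall>a\<in>A. dist a p \<le> 2 / real m ^ j \<longrightarrow>
      (\<forall>u\<in>E.words j. g p \<in> E.cylinder u j \<longrightarrow> E.cylinder u j \<subseteq> A')) \<Longrightarrow>
    measure M' A * F.cell_total q \<le> K * (measure M A' * E.cell_total q)"
    using cell_comparison[OF E.carpet_axioms F.carpet_axioms g(1) L(3)] by blast
  obtain K' where K': "K' > 0" "\<And>q. E.cell_total q \<le> K' * F.cell_total q"
    using cell_total_comparison[OF E.carpet_axioms F.carpet_axioms _ lip] f by (auto simp: bij_betw_def)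
  \<comment> \<open>One constant serves for mass and radius. A displacement of less than
    \<open>2 * r\<close> in \<open>F\<close> becomes at most \<open>2 * L * r\<close>, and the
    cylinder adds at most \<open>r \<le> L * r\<close>; the factor 4 makes the inequality
    strict.\<close>
  define C where "C = max (K * K') (4 * L)"
  have "measure M' (ball (f z) r \<inter> F) \<le> C * measure M (ball z (C * r) \<inter> E)"
    if z: "z \<in> E" and r: "0 < r" "r \<le> 1" for z r
  proof -
    obtain j where j: "1 / real m ^ j \<le> r / 2"
      using power_scale_below[OF E.m_ge_2, of "r / 2"] r by auto
    obtain q where q: "j \<le> column_level n m q"
      using column_level_at_top[OF E.m_ge_2 E.m_less_n] unfolding filterlim_at_top eventually_sequentially
      by blast
    have fz: "f z \<in> F"
      using f z by (auto simp: bij_betw_def)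
    have near: "\<forall>p\<in>F. \<forall>a\<in>ball (f z) r \<inter> F. dist a p \<le> 2 / real m ^ j \<longrightarrow>
      (\<forall>u\<in>E.words j. g p \<in> E.cylinder u j \<longrightarrow> E.cylinder u j \<subseteq> ball z (4 * L * r) \<inter> E)"
    proof (intro ballI impI subsetI)
      fix p a u x
      assume p: "p \<in> F" and a: "a \<in> ball (f z) r \<inter> F" and ap: "dist a p \<le> 2 / real m ^ j"
        and u: "u \<in> E.words j" and gp: "g p \<in> E.cylinder u j" and x: "x \<in> E.cylinder u j"
      have "dist (f z) p \<le> dist (f z) a + dist a p"
        by (rule dist_triangle)
      then have "dist (f z) p < 2 * r"
        using a ap j by simp
      then have "L * dist (f z) p \<le> L * (2 * r)"
        using L(1) by (intro mult_left_mono) auto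
      then have "dist z (g p) \<le> 2 * L * r"
        using L(2)[OF fz p] g(2)[OF z] by simp
      moreover have "dist (g p) x \<le> r"
        using E.dist_le_cylinder[OF gp x] j by simp
      moreover have "r \<le> L * r" "0 < L * r"
        using L(1) r by auto
      moreover have "dist z x \<le> dist z (g p) + dist (g p) x"
        by (rule dist_triangle)
      ultimately have "dist z x < 4 * L * r"
        by linarith
      then show "x \<in> ball z (4 * L * r) \<inter> E"
        using x E.cylinder_subset_E[of j u] E.words_in_D[OF u] by auto
    qed
    have "measure M' (ball (f z) r \<inter> F) * F.cell_total q \<le> K * (measure M (ball z (4 * L * r) \<inter> E) * E.cell_total q)"
      by (rule K(2)[OF F.ball_borel E.ball_borel q near])
    also have "\<dots> \<le> K * (measure M (ball z (4 * L * r) \<inter> E) * (K' * F.cell_total q))"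
      using K(1) K'(2) by (intro mult_left_mono) auto
    also have "\<dots> = (K * K' * measure M (ball z (4 * L * r) \<inter> E)) * F.cell_total q"
      by (simp add: mult_ac)
    finally have "measure M' (ball (f z) r \<inter> F) \<le> K * K' * measure M (ball z (4 * L * r) \<inter> E)"
      using F.cell_total_pos[of q] by (simp add: mult_le_cancel_right)
    also have "\<dots> \<le> C * measure M (ball z (4 * L * r) \<inter> E)"
      by (intro mult_right_mono) (auto simp: C_def)
    also have "\<dots> \<le> C * measure M (ball z (C * r) \<inter> E)"
    proof -
      have "4 * L * r \<le> C * r"
        using r by (intro mult_right_mono) (auto simp: C_def)
      then have "ball z (4 * L * r) \<inter> E \<subseteq> ball z (C * r) \<inter> E"
        by auto
      then show ?thesis
        using K(1) K'(1) L(1) by (intro mult_left_mono E.finite_measure_mono) (auto simp: E.sets_M C_def max_def)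
    qed
    finally show ?thesis .
  qed
  moreover have "1 \<le> C"
    using L(1) by (simp add: C_def)
  ultimately show ?thesis
    by blast
qed

section \<open>Transfer of doubling ratios\<close>

text \<open>A form without divisions, so that it serves the doubling indices and
  \<open>doubling_along_scales\<close> alike. The mass at \<open>z'\<close> is bounded below by that
  of a very small ball around \<open>g z'\<close>, which \<open>ex_comparable_ball\<close> exchanges
  for a ball of the prescribed ratio \<rho>. Therefore \<rho>' may be any positive number.\<close>

lemma ratio_domination:
  assumes "carpet n m D E M" and "carpet n m D' F M'" and f: "bij_betw f E F" and lip: "bi_lipschitz_on E f"
    and fib: "0 < carpet.fiber D 0" "0 < carpet.fiber D (m - 1)"
    and \<rho>: "0 < \<rho>" "\<rho> < 1 / real n ^ 3" and \<rho>': "0 < \<rho>'"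
  shows "\<exists>C>0. \<exists>A\<ge>1. \<exists>r0>0. \<forall>z\<in>E. \<forall>r z'. 0 < r \<longrightarrow> r < r0 \<longrightarrow> z' \<in> F \<longrightarrow>
    ball_in F z' (\<rho>' * r) \<subseteq> ball_in F (f z) r \<longrightarrow>
    (\<exists>z''\<in>E. ball_in E z'' (\<rho> * (A * r)) \<subseteq> ball_in E z (A * r) \<and>
      measure M' (ball_in F (f z) r) * measure M (ball_in E z'' (\<rho> * (A * r))) \<le>
        C * (measure M (ball_in E z (A * r)) * measure M' (ball_in F z' (\<rho>' * r))))"
proof -
  interpret E: carpet n m D E M by fact
  interpret F: carpet n m D' F M' by fact
  define g where "g = inv_into E f"
  have lip': "bi_lipschitz_on F g"
    unfolding g_def using bi_lipschitz_on_inv_into[OF lip f] .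
  have bij': "bij_betw g F E"
    unfolding g_def using f by (rule bij_betw_inv_into)
  have fg: "\<And>z. z \<in> F \<Longrightarrow> f (g z) = z" "\<And>z. z \<in> E \<Longrightarrow> g (f z) = z" and gE: "\<And>z. z \<in> F \<Longrightarrow> g z \<in> E"
    and fF: "\<And>z. z \<in> E \<Longrightarrow> f z \<in> F"
    using f by (auto simp: g_def bij_betw_def inv_into_into f_inv_into_f)
  obtain L where L: "1 \<le> L" "\<And>x y. x \<in> F \<Longrightarrow> y \<in> F \<Longrightarrow> dist (g x) (g y) \<le> L * dist x y"
    using bi_lipschitz_onE[OF lip'] by metis
  obtain C1 where C1: "1 \<le> C1" "\<And>z r. z \<in> E \<Longrightarrow> 0 < r \<Longrightarrow> r \<le> 1 \<Longrightarrow>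
      measure M' (ball (f z) r \<inter> F) \<le> C1 * measure M (ball z (C1 * r) \<inter> E)"
    using measure_comparison[OF E.carpet_axioms F.carpet_axioms f lip] by blast
  obtain C2 where C2: "1 \<le> C2" "\<And>z r. z \<in> F \<Longrightarrow> 0 < r \<Longrightarrow> r \<le> 1 \<Longrightarrow>
      measure M (ball (g z) r \<inter> E) \<le> C2 * measure M' (ball z (C2 * r) \<inter> F)"
    using measure_comparison[OF F.carpet_axioms E.carpet_axioms bij' lip'] by blast
  define B where "B = max C1 (max C2 L)"
  have B: "1 \<le> B" "C1 \<le> B" "C2 \<le> B" "L \<le> B"
    using L(1) by (auto simp: B_def)
  \<comment> \<open>Chosen so that, for \<open>s = B * r\<close>, the radius
    \<open>\<tau> * s\<close> is at most 1 and stays below \<open>\<rho>' * r\<close> after the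
    enlargement by \<open>C2 \<le> B\<close>.\<close>
  define \<tau> where "\<tau> = min \<rho>' 1 / (B * B)"
  have \<tau>: "0 < \<tau>"
    using \<rho>' B by (simp add: \<tau>_def)
  obtain C3 where C3: "C3 > 0" "\<And>z z' s. z' \<in> E \<Longrightarrow> s \<le> 3 / 4 \<Longrightarrow> dist z z' < s \<Longrightarrow>
    (\<exists>z''\<in>E. ball z'' (\<rho> * (4 * s)) \<subseteq> ball z (4 * s) \<and>
      measure M (ball z'' (\<rho> * (4 * s)) \<inter> E) \<le> C3 * measure M (ball z' (\<tau> * s) \<inter> E))"
    using E.ex_comparable_ball[OF fib \<rho> \<tau>] by blast
  \<comment> \<open>Guarantees \<open>s = B * r \<le> 3 / 4\<close>, as
    \<open>ex_comparable_ball\<close> requires.\<close>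
  define r0 where "r0 = 3 / (4 * B)"
  have r0: "0 < r0" "r0 \<le> 1"
    using B(1) by (auto simp: r0_def)
  have "\<exists>z''\<in>E. ball_in E z'' (\<rho> * (4 * B * r)) \<subseteq> ball_in E z (4 * B * r) \<and>
      measure M' (ball_in F (f z) r) * measure M (ball_in E z'' (\<rho> * (4 * B * r))) \<le>
        (C1 * (C3 * C2)) * (measure M (ball_in E z (4 * B * r)) * measure M' (ball_in F z' (\<rho>' * r)))"
    if z: "z \<in> E" and r: "0 < r" "r < r0" and z': "z' \<in> F" and sub: "ball_in F z' (\<rho>' * r) \<subseteq> ball_in F (f z) r"
    for z r z'
  proof -
    define s where "s = B * r"
    have "r * (4 * B) < 3"
      using r(2) B(1) by (simp add: r0_def less_divide_eq)
    then have s: "0 < s" "s \<le> 3 / 4"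
      using r(1) B(1) by (auto simp: s_def mult_ac)
    have "z' \<in> ball_in F z' (\<rho>' * r)"
      using z' \<rho>' r by (simp add: ball_in_def)
    from subsetD[OF sub this] have d: "dist (f z) z' < r"
      by (simp add: ball_in_def)
    have "dist z (g z') \<le> L * dist (f z) z'"
      using L(2)[OF fF[OF z] z'] fg(2)[OF z] by simp
    also have "\<dots> < L * r"
      using d L(1) by simp
    also have "\<dots> \<le> s"
      using B r by (simp add: s_def)
    finally obtain z'' where z'': "z'' \<in> E" "ball z'' (\<rho> * (4 * s)) \<subseteq> ball z (4 * s)"
      "measure M (ball z'' (\<rho> * (4 * s)) \<inter> E) \<le> C3 * measure M (ball (g z') (\<tau> * s) \<inter> E)"
      using C3(2)[OF gE[OF z'] s(2)] by blast
    have \<tau>s: "\<tau> * s = min \<rho>' 1 * r / B"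
      using B(1) by (simp add: \<tau>_def s_def)
    have r1: "r \<le> 1"
      using r r0 by simp
    have "\<tau> * s \<le> 1"
    proof -
      have "min \<rho>' 1 * r \<le> 1 * 1"
        using r1 r(1) \<rho>' by (intro mult_mono) auto
      then show ?thesis
        using B(1) unfolding \<tau>s by simp
    qed
    then have "measure M (ball (g z') (\<tau> * s) \<inter> E) \<le> C2 * measure M' (ball z' (C2 * (\<tau> * s)) \<inter> F)"
      using \<tau> s by (intro C2(2)[OF z']) auto
    also have "\<dots> \<le> C2 * measure M' (ball z' (\<rho>' * r) \<inter> F)"
    proof -
      have "C2 * (\<tau> * s) \<le> B * (\<tau> * s)"
        using B \<tau> s by (intro mult_right_mono) auto
      also have "\<dots> = min \<rho>' 1 * r"
        using B(1) by (simp add: \<tau>s)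
      also have "\<dots> \<le> \<rho>' * r"
        using r by (intro mult_right_mono) auto
      finally have "ball z' (C2 * (\<tau> * s)) \<inter> F \<subseteq> ball z' (\<rho>' * r) \<inter> F"
        by auto
      then show ?thesis
        using C2(1) by (intro mult_left_mono F.finite_measure_mono) (auto simp: F.sets_M)
    qed
    finally have "C3 * measure M (ball (g z') (\<tau> * s) \<inter> E) \<le> C3 * (C2 * measure M' (ball z' (\<rho>' * r) \<inter> F))"
      using C3(1) by (intro mult_left_mono) auto
    then have small: "measure M (ball z'' (\<rho> * (4 * s)) \<inter> E) \<le> C3 * (C2 * measure M' (ball z' (\<rho>' * r) \<inter> F))"
      using z''(3) by linarith
    have "measure M' (ball (f z) r \<inter> F) \<le> C1 * measure M (ball z (C1 * r) \<inter> E)"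
      by (rule C1(2)[OF z r(1) r1])
    also have "\<dots> \<le> C1 * measure M (ball z (4 * s) \<inter> E)"
    proof -
      have "C1 * r \<le> s"
        using B r by (simp add: s_def)
      then have "ball z (C1 * r) \<inter> E \<subseteq> ball z (4 * s) \<inter> E"
        using s by auto
      then show ?thesis
        using C1(1) by (intro mult_left_mono E.finite_measure_mono) (auto simp: E.sets_M)
    qed
    finally have "measure M' (ball (f z) r \<inter> F) * measure M (ball z'' (\<rho> * (4 * s)) \<inter> E) \<le>
        (C1 * measure M (ball z (4 * s) \<inter> E)) * (C3 * (C2 * measure M' (ball z' (\<rho>' * r) \<inter> F)))"
      using small C1(1) by (intro mult_mono) auto
    moreover have "4 * B * r = 4 * s"
      by (simp add: s_def)
    ultimately show ?thesis
      using z''(1,2) by (intro bexI[of _ z'']) (auto simp: ball_in_def mult_ac)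
  qed
  moreover have "0 < C1 * (C3 * C2)" "1 \<le> 4 * B"
    using C1(1) C2(1) C3(1) B(1) by auto
  ultimately show ?thesis
    using r0(1) by blast
qed

text \<open>Since the small ball lies in the large one, the logarithm on the side of
  \<open>X\<close> is nonnegative; this is what allows passing to the smaller denominator
  \<open>\<phi> (A * r)\<close>.\<close>

lemma doubling_ratio_comparison:
  fixes X :: "'a::metric_space set" and X' :: "'b::metric_space set"
  assumes \<phi>: "gauge_function \<phi>"
    and pos: "\<And>x t. x \<in> X \<Longrightarrow> 0 < t \<Longrightarrow> 0 < measure M (ball_in X x t)"
    and pos': "\<And>x t. x \<in> X' \<Longrightarrow> 0 < t \<Longrightarrow> 0 < measure M' (ball_in X' x t)"
    and mono: "\<And>x y s t. ball_in X x s \<subseteq> ball_in X y t \<Longrightarrow> measure M (ball_in X x s) \<le> measure M (ball_in X y t)"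
    and z: "z \<in> X" "z' \<in> X'" and \<rho>: "0 < \<rho>" "0 < \<rho>'" and CA: "0 < C" "1 \<le> A"
    and r: "0 < r" "A * r < 1"
    and dom: "\<And>x'. x' \<in> X' \<Longrightarrow> ball_in X' x' (\<rho>' * r) \<subseteq> ball_in X' z' r \<Longrightarrow>
      \<exists>x\<in>X. ball_in X x (\<rho> * (A * r)) \<subseteq> ball_in X z (A * r) \<and>
        measure M' (ball_in X' z' r) * measure M (ball_in X x (\<rho> * (A * r))) \<le>
          C * (measure M (ball_in X z (A * r)) * measure M' (ball_in X' x' (\<rho>' * r)))"
  shows "doubling_ratio \<phi> X' M' \<rho>' z' r \<le> doubling_ratio \<phi> X M \<rho> z (A * r) + ereal (\<bar>ln C\<bar> / \<phi> r)"
  unfolding doubling_ratio_def[of \<phi> X']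
proof (rule SUP_least)
  fix x' assume "x' \<in> {x' \<in> X'. ball_in X' x' (\<rho>' * r) \<subseteq> ball_in X' z' r}"
  then have x': "x' \<in> X'" "ball_in X' x' (\<rho>' * r) \<subseteq> ball_in X' z' r"
    by auto
  obtain x where x: "x \<in> X" "ball_in X x (\<rho> * (A * r)) \<subseteq> ball_in X z (A * r)"
    "measure M' (ball_in X' z' r) * measure M (ball_in X x (\<rho> * (A * r))) \<le>
          C * (measure M (ball_in X z (A * r)) * measure M' (ball_in X' x' (\<rho>' * r)))"
    using dom[OF x'] by blast
  define a where "a = measure M' (ball_in X' z' r)"
  define b where "b = measure M' (ball_in X' x' (\<rho>' * r))"
  define c where "c = measure M (ball_in X z (A * r))"
  define d where "d = measure M (ball_in X x (\<rho> * (A * r)))"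
  have Ar: "0 < A * r" "r \<le> A * r"
    using CA r by auto
  have ab: "0 < a" "0 < b" "0 < c" "0 < d" "d \<le> c"
    unfolding a_def b_def c_def d_def using z x(1) x'(1) r(1) \<rho> Ar(1)
    by (auto intro!: pos pos' mono[OF x(2)])
  have "a * d \<le> C * (c * b)"
    using x(3) by (simp add: a_def b_def c_def d_def)
  then have "a / b \<le> C * (c / d)"
    using ab by (simp add: field_simps)
  then have "ln (a / b) \<le> ln (C * (c / d))"
    using ab CA by (subst ln_le_cancel_iff) auto
  also have "\<dots> = ln C + ln (c / d)"
    using ab CA by (subst ln_mult) auto
  finally have ln: "ln (a / b) \<le> \<bar>ln C\<bar> + ln (c / d)"
    by linarith
  have r1: "r \<in> {0<..<1}" "A * r \<in> {0<..<1}"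
    using r Ar le_less_trans[OF Ar(2) r(2)] by (simp_all only: greaterThanLessThan_iff)
  have \<phi>r: "0 < \<phi> r" "0 < \<phi> (A * r)"
    using \<phi> r1 by (auto simp: gauge_function_def)
  have le: "\<phi> (A * r) \<le> \<phi> r"
  proof (cases "r = A * r")
    case True
    then show ?thesis
      by (metis order_refl)
  next
    case False
    then have "r < A * r"
      using Ar(2) by (rule le_neq_trans[rotated])
    then have "\<phi> (A * r) < \<phi> r"
      using \<phi> r1 unfolding gauge_function_def by (blast dest: monotone_onD)
    then show ?thesis by simp
  qed
  have "ln (a / b) / \<phi> r \<le> (\<bar>ln C\<bar> + ln (c / d)) / \<phi> r"
    using ln \<phi>r by (intro divide_right_mono) auto
  also have "\<dots> = \<bar>ln C\<bar> / \<phi> r + ln (c / d) / \<phi> r"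
    by (rule add_divide_distrib)
  also have "ln (c / d) / \<phi> r \<le> ln (c / d) / \<phi> (A * r)"
    using le \<phi>r ab by (intro divide_left_mono) auto
  finally have "ln (a / b) / \<phi> r \<le> ln (c / d) / \<phi> (A * r) + \<bar>ln C\<bar> / \<phi> r"
    by simp
  then have "ereal (ln (a / b) / \<phi> r) \<le> ereal (ln (c / d) / \<phi> (A * r)) + ereal (\<bar>ln C\<bar> / \<phi> r)"
    by simp
  also have "ereal (ln (c / d) / \<phi> (A * r)) \<le> doubling_ratio \<phi> X M \<rho> z (A * r)"
    unfolding doubling_ratio_def c_def d_def using x(1,2)
    by (intro SUP_upper2[of x]) auto
  finally show "ereal (ln (measure M' (ball_in X' z' r) / measure M' (ball_in X' x' (\<rho>' * r))) / \<phi> r) \<le>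
      doubling_ratio \<phi> X M \<rho> z (A * r) + ereal (\<bar>ln C\<bar> / \<phi> r)"
    by (simp add: a_def b_def add_right_mono)
qed

text \<open>Right neighbourhoods of 0 are invariant under scaling by \<open>A\<close>. The error is
  replaced by a constant \<epsilon> before taking limits, so that the sum rules apply to infinite
  limits as well.\<close>

lemma limits_le_of_rescaled:
  fixes a b :: "real \<Rightarrow> ereal"
  assumes A: "0 < A" and e: "(e \<longlongrightarrow> 0) (at_right 0)"
    and le: "\<forall>\<^sub>F r in at_right 0. a r \<le> b (A * r) + ereal (e r)"
  shows "Limsup (at_right 0) a \<le> Limsup (at_right 0) b" and "Liminf (at_right 0) a \<le> Liminf (at_right 0) b"
proof -
  have scale: "eventually P (at_right 0) \<longleftrightarrow> (\<forall>\<^sub>F r in at_right 0. P (A * r))" for P :: "real \<Rightarrow> bool"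
    using filtermap_times_pos_at_right[OF A, of 0] eventually_filtermap[of P "(*) A" "at_right 0"] by simp
  have ev: "\<forall>\<^sub>F r in at_right 0. a r \<le> b (A * r) + ereal \<epsilon>" if "0 < \<epsilon>" for \<epsilon>
    using le order_tendstoD(2)[OF e that]
  proof eventually_elim
    case (elim r)
    have "b (A * r) + ereal (e r) \<le> b (A * r) + ereal \<epsilon>"
      using elim(2) by (intro add_left_mono) simp
    with elim(1) show ?case
      by (rule order_trans)
  qed
  have bot: "at_right (0::real) \<noteq> bot"
    by simp
  show "Limsup (at_right 0) a \<le> Limsup (at_right 0) b"
  proof (rule ereal_le_epsilon2)
    fix \<epsilon> :: real assume \<epsilon>: "0 < \<epsilon>"
    have "Limsup (at_right 0) a \<le> Limsup (at_right 0) (\<lambda>r. b (A * r) + ereal \<epsilon>)"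
      using ev[OF \<epsilon>] by (rule Limsup_mono)
    also have "\<dots> = Limsup (at_right 0) (\<lambda>r. b (A * r)) + ereal \<epsilon>"
      by (rule Limsup_add_ereal_right) (auto simp: bot)
    also have "Limsup (at_right 0) (\<lambda>r. b (A * r)) \<le> Limsup (at_right 0) b"
      unfolding Limsup_le_iff using scale[of "\<lambda>r. b r < y" for y, THEN iffD1] Limsup_lessD by blast
    finally show "Limsup (at_right 0) a \<le> Limsup (at_right 0) b + ereal \<epsilon>"
      by (simp add: add_right_mono)
  qed
  show "Liminf (at_right 0) a \<le> Liminf (at_right 0) b"
  proof (rule ereal_le_epsilon2)
    fix \<epsilon> :: real assume \<epsilon>: "0 < \<epsilon>"
    have "Liminf (at_right 0) a \<le> Liminf (at_right 0) (\<lambda>r. b (A * r) + ereal \<epsilon>)"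
      using ev[OF \<epsilon>] by (rule Liminf_mono)
    also have "\<dots> = Liminf (at_right 0) (\<lambda>r. b (A * r)) + ereal \<epsilon>"
      by (rule Liminf_add_ereal_right) (auto simp: bot)
    also have "Liminf (at_right 0) (\<lambda>r. b (A * r)) \<le> Liminf (at_right 0) b"
      unfolding le_Liminf_iff using scale[of "\<lambda>r. y < b r" for y, THEN iffD2] less_LiminfD by blast
    finally show "Liminf (at_right 0) a \<le> Liminf (at_right 0) b + ereal \<epsilon>"
      by (simp add: add_right_mono)
  qed
qed

lemma doubling_index_le:
  assumes "carpet n m D E M" and "carpet n m D' F M'" and f: "bij_betw f E F" and lip: "bi_lipschitz_on E f"
    and fib: "0 < carpet.fiber D 0" "0 < carpet.fiber D (m - 1)"
    and \<rho>: "0 < \<rho>" "\<rho> < 1 / real n ^ 3" and \<rho>': "0 < \<rho>'"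
    and \<phi>: "gauge_function \<phi>" and z: "z \<in> E"
  shows "upper_doubling_index_at \<phi> F M' \<rho>' (f z) \<le> upper_doubling_index_at \<phi> E M \<rho> z"
    and "lower_doubling_index_at \<phi> F M' \<rho>' (f z) \<le> lower_doubling_index_at \<phi> E M \<rho> z"
proof -
  interpret E: carpet n m D E M by fact
  interpret F: carpet n m D' F M' by fact
  obtain C A r0 where C: "C > 0" and A: "A \<ge> 1" and r0: "r0 > 0" and dom: "\<And>r z'. 0 < r \<Longrightarrow> r < r0 \<Longrightarrow> z' \<in> F \<Longrightarrow>
    ball_in F z' (\<rho>' * r) \<subseteq> ball_in F (f z) r \<Longrightarrow>
    (\<exists>z''\<in>E. ball_in E z'' (\<rho> * (A * r)) \<subseteq> ball_in E z (A * r) \<and>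
      measure M' (ball_in F (f z) r) * measure M (ball_in E z'' (\<rho> * (A * r))) \<le>
        C * (measure M (ball_in E z (A * r)) * measure M' (ball_in F z' (\<rho>' * r))))"
    using ratio_domination[OF E.carpet_axioms F.carpet_axioms f lip fib \<rho> \<rho>'] z by blast
  have fz: "f z \<in> F"
    using f z by (auto simp: bij_betw_def)
  have "doubling_ratio \<phi> F M' \<rho>' (f z) r \<le> doubling_ratio \<phi> E M \<rho> z (A * r) + ereal (\<bar>ln C\<bar> / \<phi> r)"
    if r: "0 < r" "r < min r0 (1 / A)" for r
  proof (rule doubling_ratio_comparison[OF \<phi> _ _ _ z fz \<rho>(1) \<rho>' C A r(1)])
    show "A * r < 1"
      using r A by (simp add: field_simps)
    show "measure M (ball_in E x s) \<le> measure M (ball_in E y t)" if "ball_in E x s \<subseteq> ball_in E y t" for x y s t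
      using that by (intro E.finite_measure_mono) (auto simp: ball_in_def E.sets_M E.ball_borel)
    fix x' assume "x' \<in> F" "ball_in F x' (\<rho>' * r) \<subseteq> ball_in F (f z) r"
    then show "\<exists>x\<in>E. ball_in E x (\<rho> * (A * r)) \<subseteq> ball_in E z (A * r) \<and>
        measure M' (ball_in F (f z) r) * measure M (ball_in E x (\<rho> * (A * r))) \<le>
          C * (measure M (ball_in E z (A * r)) * measure M' (ball_in F x' (\<rho>' * r)))"
      using r by (intro dom) auto
  qed (auto simp: ball_in_def E.measure_ball_pos F.measure_ball_pos)
  then have ev: "\<forall>\<^sub>F r in at_right 0. doubling_ratio \<phi> F M' \<rho>' (f z) r \<le>
      doubling_ratio \<phi> E M \<rho> z (A * r) + ereal (\<bar>ln C\<bar> / \<phi> r)"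
    using r0 A by (intro eventually_at_rightI[of 0 "min r0 (1 / A)"]) auto
  have e: "((\<lambda>r. \<bar>ln C\<bar> / \<phi> r) \<longlongrightarrow> 0) (at_right 0)"
    using \<phi> unfolding gauge_function_def
    by (intro real_tendsto_divide_at_top[OF tendsto_const]) auto
  have "0 < A"
    using A by simp
  from limits_le_of_rescaled[OF this e ev]
  show "upper_doubling_index_at \<phi> F M' \<rho>' (f z) \<le> upper_doubling_index_at \<phi> E M \<rho> z"
    and "lower_doubling_index_at \<phi> F M' \<rho>' (f z) \<le> lower_doubling_index_at \<phi> E M \<rho> z"
    unfolding upper_doubling_index_at_def lower_doubling_index_at_def .
qed

text \<open>A good radius \<open>s\<close> at \<open>z\<close> becomes the good radius
  \<open>s / A\<close> at \<open>f z\<close>. The mass of the ball around \<open>z''\<close> can be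
  cancelled because balls centred in the carpet have positive mass.\<close>

lemma doubling_along_scales_image:
  assumes "carpet n m D E M" and "carpet n m D' F M'" and f: "bij_betw f E F" and lip: "bi_lipschitz_on E f"
    and fib: "0 < carpet.fiber D 0" "0 < carpet.fiber D (m - 1)"
    and \<rho>: "0 < \<rho>" "\<rho> < 1 / real n ^ 3" and z: "z \<in> E"
    and doubling: "doubling_along_scales E M \<rho> z"
  shows "doubling_along_scales F M' \<rho> (f z)"
proof -
  interpret E: carpet n m D E M by fact
  interpret F: carpet n m D' F M' by fact
  obtain C A r0 where C: "C > 0" and A: "A \<ge> 1" and r0: "r0 > 0" and dom: "\<And>r z'. 0 < r \<Longrightarrow> r < r0 \<Longrightarrow> z' \<in> F \<Longrightarrow>
    ball_in F z' (\<rho> * r) \<subseteq> ball_in F (f z) r \<Longrightarrow>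
    (\<exists>z''\<in>E. ball_in E z'' (\<rho> * (A * r)) \<subseteq> ball_in E z (A * r) \<and>
      measure M' (ball_in F (f z) r) * measure M (ball_in E z'' (\<rho> * (A * r))) \<le>
        C * (measure M (ball_in E z (A * r)) * measure M' (ball_in F z' (\<rho> * r))))"
    using ratio_domination[OF E.carpet_axioms F.carpet_axioms f lip fib \<rho> \<rho>(1)] z by blast
  obtain B where B: "\<And>\<delta>. \<delta> > 0 \<Longrightarrow> \<exists>r. 0 < r \<and> r < \<delta> \<and> (\<forall>z'\<in>E. ball_in E z' (\<rho> * r) \<subseteq> ball_in E z r \<longrightarrow>
      measure M (ball_in E z r) \<le> B * measure M (ball_in E z' (\<rho> * r)))"
    using doubling unfolding doubling_along_scales_def by blast
  have "\<exists>r. 0 < r \<and> r < \<delta> \<and> (\<forall>z'\<in>F. ball_in F z' (\<rho> * r) \<subseteq> ball_in F (f z) r \<longrightarrow>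
      measure M' (ball_in F (f z) r) \<le> (C * B) * measure M' (ball_in F z' (\<rho> * r)))" if \<delta>: "\<delta> > 0" for \<delta>
  proof -
    have "0 < A * min \<delta> r0"
      using A r0 \<delta> by simp
    from B[OF this] obtain s where s: "0 < s" "s < A * min \<delta> r0" "\<And>z'. z' \<in> E \<Longrightarrow> ball_in E z' (\<rho> * s) \<subseteq> ball_in E z s \<Longrightarrow>
      measure M (ball_in E z s) \<le> B * measure M (ball_in E z' (\<rho> * s))"
      by blast
    define r where "r = s / A"
    have Ar: "A * r = s"
      using A by (simp add: r_def)
    have "r < min \<delta> r0"
      using s(2) A unfolding r_def by (simp add: divide_less_eq mult.commute del: min_less_iff_conj)
    then have r: "0 < r" "r < \<delta>" "r < r0"
      using s(1) A by (auto simp: r_def)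
    have "measure M' (ball_in F (f z) r) \<le> (C * B) * measure M' (ball_in F z' (\<rho> * r))"
      if z': "z' \<in> F" "ball_in F z' (\<rho> * r) \<subseteq> ball_in F (f z) r" for z'
    proof -
      obtain z'' where z'': "z'' \<in> E" "ball_in E z'' (\<rho> * s) \<subseteq> ball_in E z s"
        "measure M' (ball_in F (f z) r) * measure M (ball_in E z'' (\<rho> * s)) \<le>
          C * (measure M (ball_in E z s) * measure M' (ball_in F z' (\<rho> * r)))"
        using dom[OF r(1,3) z'] unfolding Ar by blast
      have "C * (measure M (ball_in E z s) * measure M' (ball_in F z' (\<rho> * r))) \<le>
          C * ((B * measure M (ball_in E z'' (\<rho> * s))) * measure M' (ball_in F z' (\<rho> * r)))"
        using C s(3)[OF z''(1,2)] by (intro mult_left_mono mult_right_mono) auto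
      with z''(3) have "measure M' (ball_in F (f z) r) * measure M (ball_in E z'' (\<rho> * s)) \<le>
          ((C * B) * measure M' (ball_in F z' (\<rho> * r))) * measure M (ball_in E z'' (\<rho> * s))"
        by (simp add: mult_ac)
      moreover have "0 < measure M (ball_in E z'' (\<rho> * s))"
        using E.measure_ball_pos[OF z''(1)] \<rho> s(1) by (simp add: ball_in_def)
      ultimately show ?thesis
        by (rule mult_right_le_imp_le)
    qed
    then show ?thesis
      using r by blast
  qed
  then show ?thesis
    unfolding doubling_along_scales_def by blast
qed

lemma (in carpet) fibers_of_not_doubling:
  assumes "\<not> doubling_measure M"
  shows "0 < fiber 0" "0 < fiber (m - 1)" "fiber 0 \<noteq> fiber (m - 1)"
proof -
  have "\<not> (fiber 0 = 0 \<or> fiber (m - 1) = 0 \<or> fiber 0 = fiber (m - 1))"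
    using doubling assms by blast
  then show "0 < fiber 0" "0 < fiber (m - 1)" "fiber 0 \<noteq> fiber (m - 1)"
    by (metis gr0I)+
qed

text \<open>Doubling along scales holds off the vertical set of \<open>E\<close>, is carried over by
  \<open>f\<close>, and fails on the vertical set of \<open>F\<close>. Applied to \<open>f\<close>
  and to its inverse, this gives both inclusions.\<close>

lemma vertical_set_image_subset:
  assumes "carpet n m D E M" and "carpet n m D' F M'" and f: "bij_betw f E F" and lip: "bi_lipschitz_on E f"
    and nd: "\<not> doubling_measure M" "\<not> doubling_measure M'"
    and z: "z \<in> E" "f z \<in> vertical_set n m D' F"
  shows "z \<in> vertical_set n m D E"
proof (rule ccontr)
  interpret E: carpet n m D E M by fact
  interpret F: carpet n m D' F M' by fact
  note fib = E.fibers_of_not_doubling[OF nd(1)] F.fibers_of_not_doubling[OF nd(2)]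
  assume "z \<notin> vertical_set n m D E"
  define \<rho> where "\<rho> = 1 / (2 * real n ^ 3)"
  have \<rho>: "0 < \<rho>" "\<rho> < 1 / real n ^ 3"
    using E.n_ge_3 by (auto simp: \<rho>_def intro!: divide_strict_left_mono)
  have "doubling_along_scales E M \<rho> z"
    by (rule E.not_vertical_imp_doubling_along_scales) fact+
  then have "doubling_along_scales F M' \<rho> (f z)"
    by (rule doubling_along_scales_image[OF E.carpet_axioms F.carpet_axioms f lip fib(1,2) \<rho> z(1)])
  then show False
    using F.vertical_imp_not_doubling_along_scales[OF fib(4,5,6) z(2) \<rho>] by blast
qed

section \<open>Hausdorff dimension under Lipschitz maps\<close>

text \<open>Null measure is all that the dimension, an infimum over such exponents, depends on.
  Inside the proof the factor \<open>L powr s\<close> is divided off on the left, so that the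
  infimum over covers of \<open>A\<close> stands alone on the right.\<close>

lemma hausdorff_measure_Lipschitz_image_null:
  fixes f :: "'a::metric_space \<Rightarrow> 'b::metric_space"
  assumes L: "0 < L" "\<And>x y. x \<in> A \<Longrightarrow> y \<in> A \<Longrightarrow> dist (f x) (f y) \<le> L * dist x y"
    and s: "0 < s" and null: "hausdorff_measure s A = 0"
  shows "hausdorff_measure s (f ` A) = 0"
proof -
  have pre: "hausdorff_premeasure s (L * \<delta>) (f ` A) / ennreal (L powr s) \<le> hausdorff_premeasure s \<delta> A" for \<delta>
  proof -
    let ?U = "{U :: nat \<Rightarrow> 'a set. A \<subseteq> (\<Union>i. U i) \<and> (\<forall>i. bounded (U i) \<and> diameter (U i) \<le> \<delta>)}"
    have "hausdorff_premeasure s (L * \<delta>) (f ` A) \<le> ennreal (L powr s) * (\<Sum>i. ennreal (diameter (U i) powr s))"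
      if U: "U \<in> ?U" for U
    proof -
      \<comment> \<open>The covering sets are cut down to \<open>A\<close>, where the Lipschitz
        bound holds.\<close>
      define V where "V i = f ` (U i \<inter> A)" for i
      have d: "dist (f x) (f y) \<le> L * diameter (U i)" if "x \<in> U i \<inter> A" "y \<in> U i \<inter> A" for x y i
      proof -
        have "dist x y \<le> diameter (U i)"
          using U that by (intro diameter_bounded_bound) auto
        then have "L * dist x y \<le> L * diameter (U i)"
          using L(1) by simp
        then show ?thesis
          using L(2)[of x y] that by auto
      qed
      have bV: "bounded (V i)" for i
        unfolding bounded_two_points V_def using d by blast
      have dV: "diameter (V i) \<le> L * diameter (U i)" for i
      proof (cases "V i = {}")
        case True
        then show ?thesis
          using U L(1) by (simp add: diameter_ge_0)
      next
        case False
        then have "(SUP (x, y)\<in>V i \<times> V i. dist x y) \<le> L * diameter (U i)"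
          using d by (intro cSUP_least) (auto simp: V_def)
        then show ?thesis
          using False by (simp add: diameter_def[of "V i"])
      qed
      have "L * diameter (U i) \<le> L * \<delta>" for i
        using U L(1) by simp
      then have "diameter (V i) \<le> L * \<delta>" for i
        using dV[of i] order_trans by blast
      then have "V \<in> {V :: nat \<Rightarrow> 'b set. f ` A \<subseteq> (\<Union>i. V i) \<and> (\<forall>i. bounded (V i) \<and> diameter (V i) \<le> L * \<delta>)}"
        using bV U unfolding V_def by blast
      then have "hausdorff_premeasure s (L * \<delta>) (f ` A) \<le> (\<Sum>i. ennreal (diameter (V i) powr s))"
        unfolding hausdorff_premeasure_def by (rule INF_lower)
      also have "\<dots> \<le> (\<Sum>i. ennreal (L powr s) * ennreal (diameter (U i) powr s))"
      proof (intro suminf_le summableI)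
        fix i
        have "diameter (V i) powr s \<le> (L * diameter (U i)) powr s"
          using dV[of i] bV s by (intro powr_mono2) (auto simp: diameter_ge_0)
        also have "\<dots> = L powr s * diameter (U i) powr s"
          by (rule powr_mult)
        finally show "ennreal (diameter (V i) powr s) \<le> ennreal (L powr s) * ennreal (diameter (U i) powr s)"
          by (simp add: ennreal_mult[symmetric] ennreal_leI)
      qed
      also have "\<dots> = ennreal (L powr s) * (\<Sum>i. ennreal (diameter (U i) powr s))"
        by (rule ennreal_suminf_cmult)
      finally show ?thesis .
    qed
    then show ?thesis
      unfolding hausdorff_premeasure_def[of s \<delta> A] using L(1)
      by (intro INF_greatest divide_le_posI_ennreal) auto
  qed
  have "hausdorff_premeasure s \<delta> (f ` A) = 0" if "0 < \<delta>" for \<delta>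
  proof -
    have "hausdorff_premeasure s (\<delta> / L) A \<le> hausdorff_measure s A"
      unfolding hausdorff_measure_def using that L(1) by (intro SUP_upper) auto
    then show ?thesis
      using pre[of "\<delta> / L"] null L(1) by simp
  qed
  then show ?thesis
    unfolding hausdorff_measure_def by (simp add: SUP_eq_const)
qed

lemma hausdorff_dim_bi_lipschitz_image:
  fixes f :: "'a::metric_space \<Rightarrow> 'b::metric_space"
  assumes lip: "bi_lipschitz_on A f"
  shows "hausdorff_dim (f ` A) = hausdorff_dim A"
proof -
  obtain L where L: "1 \<le> L" "\<And>x y. x \<in> A \<Longrightarrow> y \<in> A \<Longrightarrow> dist (f x) (f y) \<le> L * dist x y"
    "\<And>x y. x \<in> A \<Longrightarrow> y \<in> A \<Longrightarrow> dist x y \<le> L * dist (f x) (f y)"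
    using bi_lipschitz_onE[OF lip] by metis
  have inj: "inj_on f A"
  proof (rule inj_onI)
    fix x y assume "x \<in> A" "y \<in> A" "f x = f y"
    then show "x = y"
      using L(3)[of x y] by simp
  qed
  have "hausdorff_measure s (f ` A) = 0 \<longleftrightarrow> hausdorff_measure s A = 0" if s: "0 < s" for s
  proof
    assume "hausdorff_measure s A = 0"
    then show "hausdorff_measure s (f ` A) = 0"
      using L s by (intro hausdorff_measure_Lipschitz_image_null[of L]) auto
  next
    assume null: "hausdorff_measure s (f ` A) = 0"
    have "dist (inv_into A f x) (inv_into A f y) \<le> L * dist x y" if "x \<in> f ` A" "y \<in> f ` A" for x y
      using that L(3) inj by auto
    then have "hausdorff_measure s (inv_into A f ` f ` A) = 0"
      using L(1) s null
      by (intro hausdorff_measure_Lipschitz_image_null[where A = "f ` A" and L = L]) auto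
    then show "hausdorff_measure s A = 0"
      using inj by simp
  qed
  then show ?thesis
    unfolding hausdorff_dim_def by (intro arg_cong[where f = Inf]) auto
qed

theorem theorem1p3:
  fixes n m :: nat
    and D D' :: "(nat \<times> nat) set"
    and E F :: "(real \<times> real) set"
    and \<mu>\<^sub>E \<mu>\<^sub>F :: "(real \<times> real) measure"
    and f :: "real \<times> real \<Rightarrow> real \<times> real"
  assumes "2 \<le> m" and "m < n"
    and "D \<noteq> {}" and "D \<subseteq> {0..<n} \<times> {0..<m}"
    and "D' \<noteq> {}" and "D' \<subseteq> {0..<n} \<times> {0..<m}"
    and "is_carpet n m D E" and "is_uniform_bernoulli n m D E \<mu>\<^sub>E"
    and "is_carpet n m D' F" and "is_uniform_bernoulli n m D' F \<mu>\<^sub>F"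
    and "\<not> doubling_measure \<mu>\<^sub>E" and "\<not> doubling_measure \<mu>\<^sub>F"
    and "bij_betw f E F" and "bi_lipschitz_on E f"
  shows "(\<forall>\<phi>. gauge_function \<phi> \<longrightarrow>
            (\<exists>l>0. (\<lambda>k. ereal (real k / \<phi> (1 / real n ^ k))) \<longlonglongrightarrow> l) \<longrightarrow>
            (\<forall>z\<in>E.
               (\<exists>L. has_upper_doubling_index n \<phi> E \<mu>\<^sub>E z L \<and> has_upper_doubling_index n \<phi> F \<mu>\<^sub>F (f z) L) \<and>
               (\<exists>L. has_lower_doubling_index n \<phi> E \<mu>\<^sub>E z L \<and> has_lower_doubling_index n \<phi> F \<mu>\<^sub>F (f z) L)))
         \<and> vertical_set n m D' F = f ` vertical_set n m D E
         \<and> hausdorff_dim (vertical_set n m D E) = hausdorff_dim (vertical_set n m D' F)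
         \<and> (vertical_separation n m D E \<longleftrightarrow> vertical_separation n m D' F)"
proof -
  interpret E: carpet n m D E \<mu>\<^sub>E
    by unfold_locales fact+
  interpret F: carpet n m D' F \<mu>\<^sub>F
    by unfold_locales fact+
  note f = \<open>bij_betw f E F\<close> and lip = \<open>bi_lipschitz_on E f\<close>
  note fibE = E.fibers_of_not_doubling[OF \<open>\<not> doubling_measure \<mu>\<^sub>E\<close>]
  note fibF = F.fibers_of_not_doubling[OF \<open>\<not> doubling_measure \<mu>\<^sub>F\<close>]
  define g where "g = inv_into E f"
  have g: "bij_betw g F E" "bi_lipschitz_on F g"
    using bij_betw_inv_into[OF f] bi_lipschitz_on_inv_into[OF lip f] by (auto simp: g_def)
  have gf: "g (f z) = z" "f z \<in> F" if "z \<in> E" for z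
    using f that by (auto simp: g_def bij_betw_def)
  have fg: "f (g z) = z" "g z \<in> E" if "z \<in> F" for z
    using f that by (auto simp: g_def bij_betw_def f_inv_into_f inv_into_into)

  \<comment> \<open>The two ratios are independent of each other, so varying one of them alone also
    shows that each index has a common value over all admissible ratios.\<close>
  have index_eq: "upper_doubling_index_at \<phi> F \<mu>\<^sub>F \<rho>' (f z) = upper_doubling_index_at \<phi> E \<mu>\<^sub>E \<rho> z"
    "lower_doubling_index_at \<phi> F \<mu>\<^sub>F \<rho>' (f z) = lower_doubling_index_at \<phi> E \<mu>\<^sub>E \<rho> z"
    if \<phi>: "gauge_function \<phi>" and z: "z \<in> E" and \<rho>: "0 < \<rho>" "\<rho> < 1 / real n ^ 3" "0 < \<rho>'" "\<rho>' < 1 / real n ^ 3"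
    for \<phi> z \<rho> \<rho>'
    using doubling_index_le[OF E.carpet_axioms F.carpet_axioms f lip fibE(1,2) \<rho>(1-3) \<phi> z]
      doubling_index_le[OF F.carpet_axioms E.carpet_axioms g fibF(1,2) \<rho>(3,4,1) \<phi> gf(2)[OF z]] gf(1)[OF z]
    by auto
  \<comment> \<open>An arbitrary admissible ratio at which the common value is read off.\<close>
  define \<rho>0 where "\<rho>0 = 1 / (2 * real n ^ 3)"
  have \<rho>0: "0 < \<rho>0" "\<rho>0 < 1 / real n ^ 3"
    using E.n_ge_3 by (auto simp: \<rho>0_def intro!: divide_strict_left_mono)
  have upper: "has_upper_doubling_index n \<phi> E \<mu>\<^sub>E z (upper_doubling_index_at \<phi> E \<mu>\<^sub>E \<rho>0 z) \<and>
      has_upper_doubling_index n \<phi> F \<mu>\<^sub>F (f z) (upper_doubling_index_at \<phi> E \<mu>\<^sub>E \<rho>0 z)"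
    and lower: "has_lower_doubling_index n \<phi> E \<mu>\<^sub>E z (lower_doubling_index_at \<phi> E \<mu>\<^sub>E \<rho>0 z) \<and>
      has_lower_doubling_index n \<phi> F \<mu>\<^sub>F (f z) (lower_doubling_index_at \<phi> E \<mu>\<^sub>E \<rho>0 z)"
    if "gauge_function \<phi>" "z \<in> E" for \<phi> z
    unfolding has_upper_doubling_index_def has_lower_doubling_index_def
    using index_eq[OF that] \<rho>0 by (metis greaterThanLessThan_iff)+

  have vertical: "vertical_set n m D' F = f ` vertical_set n m D E"
  proof (intro equalityI subsetI)
    fix z assume z: "z \<in> vertical_set n m D' F"
    then have "z \<in> F"
      by (simp add: vertical_set_def)
    then have "g z \<in> vertical_set n m D E"
      using vertical_set_image_subset[OF E.carpet_axioms F.carpet_axioms f lip, of "g z"] z fg assms(11,12) by simp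
    then show "z \<in> f ` vertical_set n m D E"
      using fg(1)[OF \<open>z \<in> F\<close>] by (metis imageI)
  next
    fix z assume "z \<in> f ` vertical_set n m D E"
    then obtain x where x: "x \<in> vertical_set n m D E" "z = f x"
      by blast
    then have "x \<in> E"
      by (simp add: vertical_set_def)
    then show "z \<in> vertical_set n m D' F"
      using vertical_set_image_subset[OF F.carpet_axioms E.carpet_axioms g, of z] x gf assms(11,12) by simp
  qed
  have "bi_lipschitz_on (vertical_set n m D E) f"
    using lip unfolding bi_lipschitz_on_def vertical_set_def by blast
  then have "hausdorff_dim (vertical_set n m D E) = hausdorff_dim (vertical_set n m D' F)"
    unfolding vertical by (rule hausdorff_dim_bi_lipschitz_image[symmetric])
  moreover have "vertical_separation n m D E \<longleftrightarrow> vertical_separation n m D' F"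
    unfolding vertical_separation_def vertical by simp
  ultimately show ?thesis
    using upper lower vertical by blast
qed

end
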